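(* Let $(M_1,\tilde g_1)$ and $(M_2,\tilde g_2)$ be pseudo-Riemannian manifolds with cometrics $g_1,g_2$, $n_2=\dim M_2$, let $\Pi_i$ be a bivector field on $M_i$ ($i=1,2$), let $f$ be a positive smooth function on $M_1$ and $\mu$ a smooth function on $M_1$. Let $\mathcal S$, $\mathcal S_1$, $\mathcal S_2$ be the scalar curvatures of $(M_1\times M_2,g^f,\Pi^\mu)$, $(M_1,g_1,\Pi_1)$, $(M_2,g_2,\Pi_2)$ respectively. Then $$\mathcal S=\mathcal S_1^h+\left(\frac{\mu^2}{f}\right)^h\mathcal S_2^v-\left(\frac{\|d\mu\|_1^2}{4f^2}\right)^h\left(\|J_2\|_2^2\right)^v-\left(\frac{n_2(n_2-3)\|J_1df\|_1^2}{4f^2}-\frac{n_2}{f}\,\triangleleft_{\Pi_1}(f)\right)^h .$$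
   Context: For a bivector field $\Pi$ on $M$, the anchor map $\sharp_\Pi:T^*M\to TM$ is given by $\beta(\sharp_\Pi(\alpha))=\Pi(\alpha,\beta)$, and the Koszul bracket of 1-forms is $[\alpha,\beta]_\Pi=\mathcal L_{\sharp_\Pi(\alpha)}\beta-\mathcal L_{\sharp_\Pi(\beta)}\alpha-d(\Pi(\alpha,\beta))$. A contravariant connection with respect to $\Pi$ is an $\mathbb R$-bilinear map $\mathcal D:\Gamma(T^*M)\times\Gamma(T^*M)\to\Gamma(T^*M)$ with $\mathcal D_{\varphi\alpha}\beta=\varphi\mathcal D_\alpha\beta$ and $\mathcal D_\alpha(\varphi\beta)=\varphi\mathcal D_\alpha\beta+\sharp_\Pi(\alpha)(\varphi)\beta$. The cometric of a pseudo-Riemannian metric $\tilde g$ is the induced metric $g$ on $T^*M$. The Levi-Civita contravariant connection of $(g,\Pi)$ is the unique contravariant connection with respect to $\Pi$ satisfying $\sharp_\Pi(\alpha).g(\beta,\gamma)=g(\mathcal D_\alpha\beta,\gamma)+g(\beta,\mathcal D_\alpha\gamma)$ and $\mathcal D_\alpha\beta-\mathcal D_\beta\alpha=[\alpha,\beta]_\Pi$. Its curvature is $\mathcal R(\alpha,\beta)=\mathcal D_\alpha\mathcal D_\beta-\mathcal D_\beta\mathcal D_\alpha-\mathcal D_{[\alpha,\beta]_\Pi}$. The scalar curvature of $(M,g,\Pi)$ is $\mathcal S=\sum_{i,j}\varepsilon_i\varepsilon_j\,g(\mathcal R(e_i,e_j)e_j,e_i)$ for a local $g$-orthonormal frame $\{e_i\}$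 of 1-forms, $\varepsilon_i=g(e_i,e_i)=\pm1$ (this is independent of the frame when $\Pi$ is Poisson). In general $\mathcal S_1,\mathcal S_2$ are computed with local orthonormal frames $\{\theta_i\}$ of $T^*M_1$ and $\{\eta_j\}$ of $T^*M_2$, and $\mathcal S$ with the induced $g^f$-orthonormal frame $\{\theta_i^h,\ \eta_j^v/\sqrt{f^h}\}$. The endomorphism field $J_i$ of $T^*M_i$ is defined by $g_i(J_i\alpha,\beta)=\Pi_i(\alpha,\beta)$; $\|\alpha\|_1^2=g_1(\alpha,\alpha)$; $\|J_2\|_2^2=-\mathrm{tr}(J_2\circ J_2)$; and $\triangleleft_{\Pi_1}(f)=\mathrm{tr}(\alpha\mapsto\mathcal D^1_\alpha(J_1df))$, where $\mathcal D^1$ is the Levi-Civita contravariant connection of $(g_1,\Pi_1)$ and the trace is that of an endomorphism of $T^*M_1$. With $\sigma_i:M_1\times M_2\to M_i$ the projections, lifts of functions and forms are $\omega_1^h=\sigma_1^*\omega_1$, $\omega_2^v=\sigma_2^*\omega_2$. The warped bivector field $\Pi^\mu$ is determined by $\Pi^\mu(\alpha_1^h,\beta_1^h)=\Pi_1(\alpha_1,\beta_1)^h$, $\Pi^\mu(\alpha_2^v,\beta_2^v)=\mu^h\Pi_2(\alpha_2,\beta_2)^v$, $\Pi^\mu(\alpha_1^h,\beta_2^v)=0$, and the contravariant warped metric $g^f$ by $g^f(\alpha_1^h,\beta_1^h)=g_1(\alpha_1,\beta_1)^h$, $g^f(\alpha_2^v,\beta_2^v)=f^hg_2(\alpha_2,\beta_2)^v$,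 $g^f(\alpha_1^h,\alpha_2^v)=0$. *)

theory Defs
  imports "HOL-Analysis.Analysis"
begin

section \<open>Smooth maps and manifolds\<close>

primrec Ck_on :: "nat \<Rightarrow> 'a::euclidean_space set \<Rightarrow> ('a \<Rightarrow> 'b::euclidean_space) \<Rightarrow> bool" where
  "Ck_on 0 S f \<longleftrightarrow> continuous_on S f"
| "Ck_on (Suc k) S f \<longleftrightarrow>
     f differentiable_on S \<and> (\<forall>v. Ck_on k S (\<lambda>x. frechet_derivative f (at x) v))"

text \<open>Only used for open sets \<open>S\<close>.\<close>

definition smooth_on :: "'a::euclidean_space set \<Rightarrow> ('a \<Rightarrow> 'b::euclidean_space) \<Rightarrow> bool" where
  "smooth_on S f \<longleftrightarrow> (\<forall>k. Ck_on k S f)"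

text \<open>
  The points of a manifold are the elements of a type \<open>'m\<close>; the charts are indexed by a
  type \<open>'i\<close> and take values in the Euclidean space \<open>'a\<close>. The atlas need not be maximal.
\<close>

type_synonym ('i, 'm, 'a) atlas = "'i \<Rightarrow> 'm set \<times> ('m \<Rightarrow> 'a)"

definition chart_dom :: "('i, 'm, 'a) atlas \<Rightarrow> 'i \<Rightarrow> 'm set" where
  "chart_dom A i = fst (A i)"

definition chart_map :: "('i, 'm, 'a) atlas \<Rightarrow> 'i \<Rightarrow> 'm \<Rightarrow> 'a" where
  "chart_map A i = snd (A i)"

definition chart_inv :: "('i, 'm, 'a) atlas \<Rightarrow> 'i \<Rightarrow> 'a \<Rightarrow> 'm" where
  "chart_inv A i = inv_into (chart_dom A i) (chart_map A i)"

definition chart_at :: "('i, 'm, 'a) atlas \<Rightarrow> 'm \<Rightarrow> 'i" where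
  "chart_at A p = (SOME i. p \<in> chart_dom A i)"

definition smooth_manifold ::
  "('i, 'm::{t2_space, second_countable_topology}, 'a::euclidean_space) atlas \<Rightarrow> bool" where
  "smooth_manifold A \<longleftrightarrow>
     (\<Union>i. chart_dom A i) = UNIV \<and>
     (\<forall>i. open (chart_dom A i) \<and> open (chart_map A i ` chart_dom A i) \<and>
          homeomorphism (chart_dom A i) (chart_map A i ` chart_dom A i)
            (chart_map A i) (chart_inv A i)) \<and>
     (\<forall>i j. smooth_on (chart_map A i ` (chart_dom A i \<inter> chart_dom A j))
              (chart_map A j \<circ> chart_inv A i))"

text \<open>
  The derivative at \<open>p\<close> of a map on the manifold, read in chart \<open>i\<close>. In particular
  \<open>chart_deriv A i (chart_map A j) p\<close> is the Jacobian of the transition from chart \<open>i\<close> to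
  chart \<open>j\<close>.
\<close>

definition chart_deriv ::
  "('i, 'm, 'a::euclidean_space) atlas \<Rightarrow> 'i \<Rightarrow> ('m \<Rightarrow> 'v::euclidean_space) \<Rightarrow> 'm \<Rightarrow> 'a \<Rightarrow> 'v" where
  "chart_deriv A i F p = frechet_derivative (F \<circ> chart_inv A i) (at (chart_map A i p))"

definition chart_smooth ::
  "('i, 'm, 'a::euclidean_space) atlas \<Rightarrow> 'm set \<Rightarrow> 'i \<Rightarrow> ('m \<Rightarrow> 'v::euclidean_space) \<Rightarrow> bool" where
  "chart_smooth A U i F \<longleftrightarrow>
     smooth_on (chart_map A i ` (U \<inter> chart_dom A i)) (F \<circ> chart_inv A i)"

definition smooth_fun :: "('i, 'm, 'a::euclidean_space) atlas \<Rightarrow> 'm set \<Rightarrow> ('m \<Rightarrow> real) \<Rightarrow> bool" where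
  "smooth_fun A U \<phi> \<longleftrightarrow> (\<forall>i. chart_smooth A U i \<phi>)"

section \<open>Tensor fields\<close>

text \<open>
  Tensor fields are given by their components in every chart, subject to the transformation
  law. A tangent vector \<open>\<Sum>\<^sub>k v\<^sup>k \<partial>\<^sub>k\<close> and a covector \<open>\<Sum>\<^sub>k a\<^sub>k dx\<^sup>k\<close> at \<open>p\<close> are represented in chart \<open>i\<close>
  by the elements of \<open>'a\<close> with these components, so that the inner product \<open>a \<bullet> v\<close> is the
  duality pairing. A field \<open>t\<close> has the value \<open>t i p\<close> in chart \<open>i\<close> at \<open>p\<close>; the value is
  irrelevant if \<open>p\<close> is outside the domain of chart \<open>i\<close> or outside the open set on which the
  field is considered.
\<close>

type_synonym ('i, 'm, 'a) field = "'i \<Rightarrow> 'm \<Rightarrow> 'a"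
type_synonym ('i, 'm, 'a) field2 = "'i \<Rightarrow> 'm \<Rightarrow> 'a \<Rightarrow> 'a \<Rightarrow> real"

definition one_form ::
  "('i, 'm, 'a::euclidean_space) atlas \<Rightarrow> 'm set \<Rightarrow> ('i, 'm, 'a) field \<Rightarrow> bool" where
  "one_form A U \<alpha> \<longleftrightarrow>
     (\<forall>i. chart_smooth A U i (\<alpha> i)) \<and>
     (\<forall>i j. \<forall>p \<in> U \<inter> chart_dom A i \<inter> chart_dom A j. \<forall>v.
        \<alpha> i p \<bullet> v = \<alpha> j p \<bullet> chart_deriv A i (chart_map A j) p v)"

definition field_eq_on ::
  "('i, 'm, 'a) atlas \<Rightarrow> 'm set \<Rightarrow> ('i, 'm, 'a) field \<Rightarrow> ('i, 'm, 'a) field \<Rightarrow> bool" where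
  "field_eq_on A U \<alpha> \<beta> \<longleftrightarrow> (\<forall>i. \<forall>p \<in> U \<inter> chart_dom A i. \<alpha> i p = \<beta> i p)"

text \<open>A metric acts on tangent vectors, a bivector field and a cometric act on covectors.\<close>

definition pseudo_riemannian_metric ::
  "('i, 'm, 'a::euclidean_space) atlas \<Rightarrow> ('i, 'm, 'a) field2 \<Rightarrow> bool" where
  "pseudo_riemannian_metric A g \<longleftrightarrow>
     (\<forall>i u v. chart_smooth A UNIV i (\<lambda>p. g i p u v)) \<and>
     (\<forall>i. \<forall>p \<in> chart_dom A i.
        bilinear (g i p) \<and> (\<forall>u v. g i p u v = g i p v u) \<and>
        (\<forall>u. (\<forall>v. g i p u v = 0) \<longrightarrow> u = 0)) \<and>
     (\<forall>i j. \<forall>p \<in> chart_dom A i \<inter> chart_dom A j. \<forall>u v.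
        g i p u v = g j p (chart_deriv A i (chart_map A j) p u) (chart_deriv A i (chart_map A j) p v))"

definition bivector_field ::
  "('i, 'm, 'a::euclidean_space) atlas \<Rightarrow> ('i, 'm, 'a) field2 \<Rightarrow> bool" where
  "bivector_field A P \<longleftrightarrow>
     (\<forall>i a b. chart_smooth A UNIV i (\<lambda>p. P i p a b)) \<and>
     (\<forall>i. \<forall>p \<in> chart_dom A i. bilinear (P i p) \<and> (\<forall>a b. P i p a b = - P i p b a)) \<and>
     (\<forall>i j. \<forall>p \<in> chart_dom A i \<inter> chart_dom A j. \<forall>a b.
        P j p a b = P i p (adjoint (chart_deriv A i (chart_map A j) p) a)
                          (adjoint (chart_deriv A i (chart_map A j) p) b))"

definition raise :: "('i, 'm, 'a::euclidean_space) field2 \<Rightarrow> 'i \<Rightarrow> 'm \<Rightarrow> 'a \<Rightarrow> 'a" where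
  "raise g i p a = (THE u. \<forall>v. g i p u v = a \<bullet> v)"

definition cometric :: "('i, 'm, 'a::euclidean_space) field2 \<Rightarrow> ('i, 'm, 'a) field2" where
  "cometric g i p a b = g i p (raise g i p a) (raise g i p b)"

definition field2_eval ::
  "('i, 'm, 'a) atlas \<Rightarrow> ('i, 'm, 'a) field2 \<Rightarrow> ('i, 'm, 'a) field \<Rightarrow> ('i, 'm, 'a) field \<Rightarrow> 'm \<Rightarrow> real" where
  "field2_eval A t \<alpha> \<beta> p = t (chart_at A p) p (\<alpha> (chart_at A p) p) (\<beta> (chart_at A p) p)"

definition scale_field :: "('m \<Rightarrow> real) \<Rightarrow> ('i, 'm, 'a::real_vector) field \<Rightarrow> ('i, 'm, 'a) field" where
  "scale_field \<phi> \<alpha> i p = \<phi> p *\<^sub>R \<alpha> i p"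

definition differential ::
  "('i, 'm, 'a::euclidean_space) atlas \<Rightarrow> ('m \<Rightarrow> real) \<Rightarrow> ('i, 'm, 'a) field" where
  "differential A \<phi> i p = (\<Sum>b\<in>Basis. chart_deriv A i \<phi> p b *\<^sub>R b)"

definition derive_along ::
  "('i, 'm, 'a::euclidean_space) atlas \<Rightarrow> ('i, 'm, 'a) field \<Rightarrow> ('m \<Rightarrow> real) \<Rightarrow> 'm \<Rightarrow> real" where
  "derive_along A X \<phi> p = chart_deriv A (chart_at A p) \<phi> p (X (chart_at A p) p)"

text \<open>\<open>(\<L>\<^sub>X \<beta>)\<^sub>k = X\<^sup>j \<partial>\<^sub>j \<beta>\<^sub>k + \<beta>\<^sub>j \<partial>\<^sub>k X\<^sup>j\<close>\<close>

definition lie_derivative ::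
  "('i, 'm, 'a::euclidean_space) atlas \<Rightarrow> ('i, 'm, 'a) field \<Rightarrow> ('i, 'm, 'a) field \<Rightarrow> ('i, 'm, 'a) field" where
  "lie_derivative A X \<beta> i p =
     (\<Sum>b\<in>Basis. (chart_deriv A i (\<beta> i) p (X i p) \<bullet> b + \<beta> i p \<bullet> chart_deriv A i (X i) p b) *\<^sub>R b)"

section \<open>Contravariant connections\<close>

text \<open>The \<open>k\<close>-th component of the vector field \<open>\<sharp>\<^sub>P(\<alpha>)\<close> is \<open>dx\<^sup>k(\<sharp>\<^sub>P(\<alpha>)) = P(\<alpha>, dx\<^sup>k)\<close>.\<close>

definition anchor ::
  "('i, 'm, 'a::euclidean_space) field2 \<Rightarrow> ('i, 'm, 'a) field \<Rightarrow> ('i, 'm, 'a) field" where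
  "anchor P \<alpha> i p = (\<Sum>b\<in>Basis. P i p (\<alpha> i p) b *\<^sub>R b)"

definition koszul_bracket ::
  "('i, 'm, 'a::euclidean_space) atlas \<Rightarrow> ('i, 'm, 'a) field2 \<Rightarrow>
     ('i, 'm, 'a) field \<Rightarrow> ('i, 'm, 'a) field \<Rightarrow> ('i, 'm, 'a) field" where
  "koszul_bracket A P \<alpha> \<beta> i p =
     lie_derivative A (anchor P \<alpha>) \<beta> i p - lie_derivative A (anchor P \<beta>) \<alpha> i p
       - differential A (field2_eval A P \<alpha> \<beta>) i p"

text \<open>
  A contravariant connection is a local operator, hence acts on forms over any open subset, as
  is needed to apply it to local frames. Accordingly \<open>D\<close> is required to be a contravariant
  connection over every open set \<open>U\<close>, the choice \<open>U = UNIV\<close> giving the global forms.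
  Homogeneity over the reals is the case of constant \<open>\<phi>\<close>, and independence of the values of the
  arguments outside \<open>U\<close> is the case of \<open>\<phi>\<close> vanishing on \<open>U\<close>.
\<close>

definition contravariant_connection ::
  "('i, 'm::topological_space, 'a::euclidean_space) atlas \<Rightarrow> ('i, 'm, 'a) field2 \<Rightarrow>
     (('i, 'm, 'a) field \<Rightarrow> ('i, 'm, 'a) field \<Rightarrow> ('i, 'm, 'a) field) \<Rightarrow> bool" where
  "contravariant_connection A P D \<longleftrightarrow>
     (\<forall>U. open U \<longrightarrow>
       (\<forall>\<alpha> \<beta>. one_form A U \<alpha> \<and> one_form A U \<beta> \<longrightarrow> one_form A U (D \<alpha> \<beta>)) \<and>
       (\<forall>\<alpha> \<beta> \<gamma>. one_form A U \<alpha> \<and> one_form A U \<beta> \<and> one_form A U \<gamma> \<longrightarrow>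
          field_eq_on A U (D (\<lambda>i p. \<alpha> i p + \<beta> i p) \<gamma>) (\<lambda>i p. D \<alpha> \<gamma> i p + D \<beta> \<gamma> i p) \<and>
          field_eq_on A U (D \<alpha> (\<lambda>i p. \<beta> i p + \<gamma> i p)) (\<lambda>i p. D \<alpha> \<beta> i p + D \<alpha> \<gamma> i p)) \<and>
       (\<forall>\<phi> \<alpha> \<beta>. smooth_fun A U \<phi> \<and> one_form A U \<alpha> \<and> one_form A U \<beta> \<longrightarrow>
          field_eq_on A U (D (scale_field \<phi> \<alpha>) \<beta>) (scale_field \<phi> (D \<alpha> \<beta>)) \<and>
          field_eq_on A U (D \<alpha> (scale_field \<phi> \<beta>))
            (\<lambda>i p. \<phi> p *\<^sub>R D \<alpha> \<beta> i p + derive_along A (anchor P \<alpha>) \<phi> p *\<^sub>R \<beta> i p)))"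

definition levi_civita_connection ::
  "('i, 'm::topological_space, 'a::euclidean_space) atlas \<Rightarrow> ('i, 'm, 'a) field2 \<Rightarrow>
     ('i, 'm, 'a) field2 \<Rightarrow>
     (('i, 'm, 'a) field \<Rightarrow> ('i, 'm, 'a) field \<Rightarrow> ('i, 'm, 'a) field) \<Rightarrow> bool" where
  "levi_civita_connection A g P D \<longleftrightarrow>
     contravariant_connection A P D \<and>
     (\<forall>U. open U \<longrightarrow>
       (\<forall>\<alpha> \<beta> \<gamma>. one_form A U \<alpha> \<and> one_form A U \<beta> \<and> one_form A U \<gamma> \<longrightarrow>
          (\<forall>p\<in>U. derive_along A (anchor P \<alpha>) (field2_eval A g \<beta> \<gamma>) p =
                   field2_eval A g (D \<alpha> \<beta>) \<gamma> p + field2_eval A g \<beta> (D \<alpha> \<gamma>) p)) \<and>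
       (\<forall>\<alpha> \<beta>. one_form A U \<alpha> \<and> one_form A U \<beta> \<longrightarrow>
          field_eq_on A U (\<lambda>i p. D \<alpha> \<beta> i p - D \<beta> \<alpha> i p) (koszul_bracket A P \<alpha> \<beta>)))"

definition curvature ::
  "('i, 'm, 'a::euclidean_space) atlas \<Rightarrow> ('i, 'm, 'a) field2 \<Rightarrow>
     (('i, 'm, 'a) field \<Rightarrow> ('i, 'm, 'a) field \<Rightarrow> ('i, 'm, 'a) field) \<Rightarrow>
     ('i, 'm, 'a) field \<Rightarrow> ('i, 'm, 'a) field \<Rightarrow> ('i, 'm, 'a) field \<Rightarrow> ('i, 'm, 'a) field" where
  "curvature A P D \<alpha> \<beta> \<gamma> i p =
     D \<alpha> (D \<beta> \<gamma>) i p - D \<beta> (D \<alpha> \<gamma>) i p - D (koszul_bracket A P \<alpha> \<beta>) \<gamma> i p"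

text \<open>
  The frame is \<open>e 0, \<dots>, e (DIM('a) - 1)\<close>; being orthonormal, these forms are pointwise linearly
  independent and hence a basis.
\<close>

definition orthonormal_frame ::
  "('i, 'm, 'a::euclidean_space) atlas \<Rightarrow> ('i, 'm, 'a) field2 \<Rightarrow> 'm set \<Rightarrow>
     (nat \<Rightarrow> ('i, 'm, 'a) field) \<Rightarrow> bool" where
  "orthonormal_frame A g U e \<longleftrightarrow>
     (\<forall>k<DIM('a). one_form A U (e k)) \<and>
     (\<forall>p\<in>U. \<forall>k<DIM('a). field2_eval A g (e k) (e k) p \<in> {1, - 1}) \<and>
     (\<forall>p\<in>U. \<forall>k<DIM('a). \<forall>l<DIM('a). k \<noteq> l \<longrightarrow> field2_eval A g (e k) (e l) p = 0)"

text \<open>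
  Unless \<open>P\<close> is Poisson, the curvature is not tensorial in its third argument, and the scalar
  curvature depends on the frame.
\<close>

definition scalar_curvature ::
  "('i, 'm, 'a::euclidean_space) atlas \<Rightarrow> ('i, 'm, 'a) field2 \<Rightarrow> ('i, 'm, 'a) field2 \<Rightarrow>
     (('i, 'm, 'a) field \<Rightarrow> ('i, 'm, 'a) field \<Rightarrow> ('i, 'm, 'a) field) \<Rightarrow>
     (nat \<Rightarrow> ('i, 'm, 'a) field) \<Rightarrow> 'm \<Rightarrow> real" where
  "scalar_curvature A g P D e p =
     (\<Sum>k<DIM('a). \<Sum>l<DIM('a). field2_eval A g (e k) (e k) p * field2_eval A g (e l) (e l) p *
        field2_eval A g (curvature A P D (e k) (e l) (e l)) (e k) p)"

section \<open>The endomorphism field and traces\<close>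

definition J_endo ::
  "('i, 'm, 'a::euclidean_space) field2 \<Rightarrow> ('i, 'm, 'a) field2 \<Rightarrow> 'i \<Rightarrow> 'm \<Rightarrow> 'a \<Rightarrow> 'a" where
  "J_endo g P i p a = (THE c. \<forall>b. g i p c b = P i p a b)"

definition J_form ::
  "('i, 'm, 'a::euclidean_space) field2 \<Rightarrow> ('i, 'm, 'a) field2 \<Rightarrow>
     ('i, 'm, 'a) field \<Rightarrow> ('i, 'm, 'a) field" where
  "J_form g P \<alpha> i p = J_endo g P i p (\<alpha> i p)"

definition endo_trace :: "('a::euclidean_space \<Rightarrow> 'a) \<Rightarrow> real" where
  "endo_trace L = (\<Sum>b\<in>Basis. L b \<bullet> b)"

definition J_norm_sq ::
  "('i, 'm, 'a::euclidean_space) atlas \<Rightarrow> ('i, 'm, 'a) field2 \<Rightarrow> ('i, 'm, 'a) field2 \<Rightarrow> 'm \<Rightarrow> real" where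
  "J_norm_sq A g P p =
     - endo_trace (J_endo g P (chart_at A p) p \<circ> J_endo g P (chart_at A p) p)"

text \<open>
  The value of \<open>D \<alpha> \<omega>\<close> at \<open>p\<close> depends only on that of \<open>\<alpha>\<close> at \<open>p\<close>, so that \<open>\<alpha> \<mapsto> D \<alpha> \<omega>\<close> defines an
  endomorphism of the cotangent space at \<open>p\<close>.
\<close>

definition connection_endo ::
  "('i, 'm::topological_space, 'a::euclidean_space) atlas \<Rightarrow>
     (('i, 'm, 'a) field \<Rightarrow> ('i, 'm, 'a) field \<Rightarrow> ('i, 'm, 'a) field) \<Rightarrow>
     ('i, 'm, 'a) field \<Rightarrow> 'i \<Rightarrow> 'm \<Rightarrow> 'a \<Rightarrow> 'a" where
  "connection_endo A D \<omega> i p =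
     (THE E. linear E \<and>
        (\<forall>U \<alpha>. open U \<and> p \<in> U \<and> one_form A U \<alpha> \<longrightarrow> D \<alpha> \<omega> i p = E (\<alpha> i p)))"

definition triangle_op ::
  "('i, 'm::topological_space, 'a::euclidean_space) atlas \<Rightarrow> ('i, 'm, 'a) field2 \<Rightarrow>
     ('i, 'm, 'a) field2 \<Rightarrow>
     (('i, 'm, 'a) field \<Rightarrow> ('i, 'm, 'a) field \<Rightarrow> ('i, 'm, 'a) field) \<Rightarrow> ('m \<Rightarrow> real) \<Rightarrow> 'm \<Rightarrow> real" where
  "triangle_op A g P D f p =
     endo_trace (connection_endo A D (J_form g P (differential A f)) (chart_at A p) p)"

section \<open>Products\<close>

definition prod_atlas ::
  "('i, 'm, 'a) atlas \<Rightarrow> ('j, 'n, 'b) atlas \<Rightarrow> ('i \<times> 'j, 'm \<times> 'n, 'a \<times> 'b) atlas" where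
  "prod_atlas A1 A2 =
     (\<lambda>(i, j). (chart_dom A1 i \<times> chart_dom A2 j, map_prod (chart_map A1 i) (chart_map A2 j)))"

definition pullback ::
  "('i, 'm, 'a::euclidean_space) atlas \<Rightarrow> ('j, 'n, 'b::euclidean_space) atlas \<Rightarrow> ('m \<Rightarrow> 'n) \<Rightarrow>
     ('j, 'n, 'b) field \<Rightarrow> ('i, 'm, 'a) field" where
  "pullback A B \<sigma> \<omega> i p =
     adjoint (chart_deriv A i (chart_map B (chart_at B (\<sigma> p)) \<circ> \<sigma>) p) (\<omega> (chart_at B (\<sigma> p)) (\<sigma> p))"

abbreviation lift_h ::
  "('i, 'm, 'a::euclidean_space) atlas \<Rightarrow> ('j, 'n, 'b::euclidean_space) atlas \<Rightarrow>
     ('i, 'm, 'a) field \<Rightarrow> ('i \<times> 'j, 'm \<times> 'n, 'a \<times> 'b) field" where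
  "lift_h A1 A2 \<equiv> pullback (prod_atlas A1 A2) A1 fst"

abbreviation lift_v ::
  "('i, 'm, 'a::euclidean_space) atlas \<Rightarrow> ('j, 'n, 'b::euclidean_space) atlas \<Rightarrow>
     ('j, 'n, 'b) field \<Rightarrow> ('i \<times> 'j, 'm \<times> 'n, 'a \<times> 'b) field" where
  "lift_v A1 A2 \<equiv> pullback (prod_atlas A1 A2) A2 snd"

text \<open>
  In a product chart the covector \<open>\<alpha>\<^sup>h + \<beta>\<^sup>v\<close> has the components \<open>(a, b)\<close>, where \<open>a\<close> and \<open>b\<close> are
  those of \<open>\<alpha>\<close> and \<open>\<beta>\<close>. Both the warped bivector field (with \<open>w = \<mu>\<close>) and the contravariant
  warped metric (with \<open>w = f\<close>) are of the following form; the equations determining them are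
  verified at the end of this theory.
\<close>

definition warped ::
  "('m \<Rightarrow> real) \<Rightarrow> ('i, 'm, 'a) field2 \<Rightarrow> ('j, 'n, 'b) field2 \<Rightarrow> ('i \<times> 'j, 'm \<times> 'n, 'a \<times> 'b) field2" where
  "warped w t1 t2 = (\<lambda>(i, j) (p, q) (a1, a2) (b1, b2). t1 i p a1 b1 + w p * t2 j q a2 b2)"

definition warped_frame ::
  "('i, 'm, 'a::euclidean_space) atlas \<Rightarrow> ('j, 'n, 'b::euclidean_space) atlas \<Rightarrow> ('m \<Rightarrow> real) \<Rightarrow>
     (nat \<Rightarrow> ('i, 'm, 'a) field) \<Rightarrow> (nat \<Rightarrow> ('j, 'n, 'b) field) \<Rightarrow>
     nat \<Rightarrow> ('i \<times> 'j, 'm \<times> 'n, 'a \<times> 'b) field" where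
  "warped_frame A1 A2 f \<theta> \<eta> k =
     (if k < DIM('a) then lift_h A1 A2 (\<theta> k)
      else scale_field (\<lambda>(p, q). 1 / sqrt (f p)) (lift_v A1 A2 (\<eta> (k - DIM('a)))))"

subsection \<open>The lifts determine the warped tensor fields\<close>

lemma prod_atlas_simps:
  "chart_dom (prod_atlas A1 A2) (i, j) = chart_dom A1 i \<times> chart_dom A2 j"
  "chart_map (prod_atlas A1 A2) (i, j) = map_prod (chart_map A1 i) (chart_map A2 j)"
  by (simp_all add: prod_atlas_def chart_dom_def chart_map_def)

lemma chart_at_in:
  assumes "smooth_manifold A"
  shows "p \<in> chart_dom A (chart_at A p)"
proof -
  have "\<exists>i. p \<in> chart_dom A i"
    using assms by (auto simp: smooth_manifold_def)
  then show ?thesis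
    unfolding chart_at_def by (rule someI_ex)
qed

lemma chart_inv_map:
  assumes "smooth_manifold A" "p \<in> chart_dom A i"
  shows "chart_inv A i (chart_map A i p) = p"
  using assms by (auto simp: smooth_manifold_def homeomorphism_def)

lemma chart_inj:
  assumes "smooth_manifold A"
  shows "inj_on (chart_map A i) (chart_dom A i)"
  using chart_inv_map[OF assms] by (metis inj_onI)

lemma chart_inv_prod:
  assumes "smooth_manifold A1" "smooth_manifold A2"
    and "x \<in> chart_map A1 i ` chart_dom A1 i" "y \<in> chart_map A2 j ` chart_dom A2 j"
  shows "chart_inv (prod_atlas A1 A2) (i, j) (x, y) = (chart_inv A1 i x, chart_inv A2 j y)"
proof -
  obtain p q where pq: "p \<in> chart_dom A1 i" "x = chart_map A1 i p"
      "q \<in> chart_dom A2 j" "y = chart_map A2 j q"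
    using assms(3,4) by auto
  have inj: "inj_on (map_prod (chart_map A1 i) (chart_map A2 j)) (chart_dom A1 i \<times> chart_dom A2 j)"
    by (intro map_prod_inj_on chart_inj assms)
  have "inv_into (chart_dom A1 i \<times> chart_dom A2 j) (map_prod (chart_map A1 i) (chart_map A2 j)) (x, y)
          = (p, q)"
    by (rule inv_into_f_eq[OF inj]) (use pq in auto)
  then show ?thesis
    using pq chart_inv_map[OF assms(1) pq(1)] chart_inv_map[OF assms(2) pq(3)]
    unfolding chart_inv_def[of "prod_atlas A1 A2"] prod_atlas_simps by simp
qed

lemma open_chart_image:
  assumes "smooth_manifold A" "open U"
  shows "open (chart_map A i ` (U \<inter> chart_dom A i))"
proof -
  let ?V = "chart_map A i ` chart_dom A i"
  have h: "homeomorphism (chart_dom A i) ?V (chart_map A i) (chart_inv A i)" "open ?V"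
    using assms(1) by (auto simp: smooth_manifold_def)
  have "openin (top_of_set (chart_dom A i)) (U \<inter> chart_dom A i)"
    using openin_open_Int[OF assms(2), of "chart_dom A i"] by (simp only: Int_commute)
  then have "openin (top_of_set ?V) (chart_map A i ` (U \<inter> chart_dom A i))"
    by (rule homeomorphism_imp_open_map[OF h(1)])
  then show ?thesis
    using h(2) by (rule openin_open_trans)
qed

lemma transition_has_derivative:
  assumes "smooth_manifold A" "p \<in> chart_dom A i" "p \<in> chart_dom A k"
  shows "(chart_map A k \<circ> chart_inv A i has_derivative chart_deriv A i (chart_map A k) p)
           (at (chart_map A i p))"
proof -
  let ?S = "chart_map A i ` (chart_dom A i \<inter> chart_dom A k)"
  have "smooth_on ?S (chart_map A k \<circ> chart_inv A i)"
    using assms(1) by (auto simp: smooth_manifold_def)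
  then have "Ck_on (Suc 0) ?S (chart_map A k \<circ> chart_inv A i)"
    unfolding smooth_on_def by blast
  then have "(chart_map A k \<circ> chart_inv A i) differentiable_on ?S"
    by simp
  moreover have "open (chart_dom A k)"
    using assms(1) by (simp add: smooth_manifold_def)
  then have "open ?S"
    using open_chart_image[OF assms(1), of "chart_dom A k" i] by (simp add: Int_commute)
  moreover have "chart_map A i p \<in> ?S"
    using assms by blast
  ultimately have "(chart_map A k \<circ> chart_inv A i) differentiable (at (chart_map A i p))"
    by (metis differentiable_on_eq_differentiable_at)
  then show ?thesis
    unfolding chart_deriv_def frechet_derivative_works .
qed

lemma one_form_adjoint:
  assumes "smooth_manifold A" "one_form A U \<alpha>" "p \<in> U" "p \<in> chart_dom A i" "p \<in> chart_dom A k"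
  shows "adjoint (chart_deriv A i (chart_map A k) p) (\<alpha> k p) = \<alpha> i p"
proof -
  have lin: "linear (chart_deriv A i (chart_map A k) p)"
    using transition_has_derivative[OF assms(1,4,5)] by (rule has_derivative_linear)
  let ?T = "chart_deriv A i (chart_map A k) p"
  have "adjoint ?T (\<alpha> k p) \<bullet> v = \<alpha> i p \<bullet> v" for v
  proof -
    have "\<alpha> i p \<bullet> v = \<alpha> k p \<bullet> ?T v"
      using assms(2-5) unfolding one_form_def by blast
    also have "\<dots> = ?T v \<bullet> \<alpha> k p"
      by (rule inner_commute)
    also have "\<dots> = v \<bullet> adjoint ?T (\<alpha> k p)"
      using adjoint_works[OF lin] by simp
    also have "\<dots> = adjoint ?T (\<alpha> k p) \<bullet> v"
      by (rule inner_commute)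
    finally show ?thesis ..
  qed
  then show ?thesis
    using vector_eq_rdot by blast
qed

lemma lift_h_components:
  fixes A1 :: "('i, 'm::{t2_space, second_countable_topology}, 'a::euclidean_space) atlas"
    and A2 :: "('j, 'n::{t2_space, second_countable_topology}, 'b::euclidean_space) atlas"
  assumes M: "smooth_manifold A1" "smooth_manifold A2"
    and \<alpha>: "one_form A1 U \<alpha>" "p \<in> U" and pq: "p \<in> chart_dom A1 i" "q \<in> chart_dom A2 j"
  shows "lift_h A1 A2 \<alpha> (i, j) (p, q) = (\<alpha> i p, 0)"
proof -
  define k where "k = chart_at A1 p"
  define T where "T = chart_deriv A1 i (chart_map A1 k) p"
  have k: "p \<in> chart_dom A1 k"
    using chart_at_in[OF M(1)] by (simp add: k_def)
  have T: "(chart_map A1 k \<circ> chart_inv A1 i has_derivative T) (at (chart_map A1 i p))"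
    unfolding T_def by (rule transition_has_derivative[OF M(1) pq(1) k])
  let ?x = "(chart_map A1 i p, chart_map A2 j q)"
  let ?V = "chart_map A1 i ` chart_dom A1 i \<times> chart_map A2 j ` chart_dom A2 j"
  have T': "(chart_map A1 k \<circ> chart_inv A1 i has_derivative T) (at (fst ?x))"
    using T by (simp only: prod.sel)
  let ?F = "(chart_map A1 k \<circ> fst) \<circ> chart_inv (prod_atlas A1 A2) (i, j)"
  have "((\<lambda>z. (chart_map A1 k \<circ> chart_inv A1 i) (fst z)) has_derivative (\<lambda>z. T (fst z))) (at ?x)"
    by (rule has_derivative_compose[OF has_derivative_fst[OF has_derivative_ident] T'])
  moreover have "open ?V"
    using M by (intro open_Times) (auto simp: smooth_manifold_def)
  moreover have "?x \<in> ?V"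
    using pq by auto
  moreover have "(chart_map A1 k \<circ> chart_inv A1 i) (fst z) = ?F z" if "z \<in> ?V" for z
    using that chart_inv_prod[OF M] by (cases z) auto
  ultimately have "(?F has_derivative (\<lambda>z. T (fst z))) (at ?x)"
    by (rule has_derivative_transform_within_open)
  then have "chart_deriv (prod_atlas A1 A2) (i, j) (chart_map A1 k \<circ> fst) (p, q) = (\<lambda>z. T (fst z))"
    unfolding chart_deriv_def prod_atlas_simps by (simp add: frechet_derivative_at[symmetric])
  moreover have "adjoint (\<lambda>z::'a \<times> 'b. T (fst z)) = (\<lambda>a. (adjoint T a, 0))"
    using adjoint_works[OF has_derivative_linear[OF T]]
    by (intro adjoint_unique) (auto simp: inner_Pair)
  ultimately show ?thesis
    using one_form_adjoint[OF M(1) \<alpha> pq(1) k] by (simp add: pullback_def k_def T_def)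
qed

lemma lift_v_components:
  fixes A1 :: "('i, 'm::{t2_space, second_countable_topology}, 'a::euclidean_space) atlas"
    and A2 :: "('j, 'n::{t2_space, second_countable_topology}, 'b::euclidean_space) atlas"
  assumes M: "smooth_manifold A1" "smooth_manifold A2"
    and \<beta>: "one_form A2 U \<beta>" "q \<in> U" and pq: "p \<in> chart_dom A1 i" "q \<in> chart_dom A2 j"
  shows "lift_v A1 A2 \<beta> (i, j) (p, q) = (0, \<beta> j q)"
proof -
  define k where "k = chart_at A2 q"
  define T where "T = chart_deriv A2 j (chart_map A2 k) q"
  have k: "q \<in> chart_dom A2 k"
    using chart_at_in[OF M(2)] by (simp add: k_def)
  have T: "(chart_map A2 k \<circ> chart_inv A2 j has_derivative T) (at (chart_map A2 j q))"
    unfolding T_def by (rule transition_has_derivative[OF M(2) pq(2) k])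
  let ?x = "(chart_map A1 i p, chart_map A2 j q)"
  let ?V = "chart_map A1 i ` chart_dom A1 i \<times> chart_map A2 j ` chart_dom A2 j"
  have T': "(chart_map A2 k \<circ> chart_inv A2 j has_derivative T) (at (snd ?x))"
    using T by (simp only: prod.sel)
  let ?F = "(chart_map A2 k \<circ> snd) \<circ> chart_inv (prod_atlas A1 A2) (i, j)"
  have "((\<lambda>z. (chart_map A2 k \<circ> chart_inv A2 j) (snd z)) has_derivative (\<lambda>z. T (snd z))) (at ?x)"
    by (rule has_derivative_compose[OF has_derivative_snd[OF has_derivative_ident] T'])
  moreover have "open ?V"
    using M by (intro open_Times) (auto simp: smooth_manifold_def)
  moreover have "?x \<in> ?V"
    using pq by auto
  moreover have "(chart_map A2 k \<circ> chart_inv A2 j) (snd z) = ?F z" if "z \<in> ?V" for z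
    using that chart_inv_prod[OF M] by (cases z) auto
  ultimately have "(?F has_derivative (\<lambda>z. T (snd z))) (at ?x)"
    by (rule has_derivative_transform_within_open)
  then have "chart_deriv (prod_atlas A1 A2) (i, j) (chart_map A2 k \<circ> snd) (p, q) = (\<lambda>z. T (snd z))"
    unfolding chart_deriv_def prod_atlas_simps by (simp add: frechet_derivative_at[symmetric])
  moreover have "adjoint (\<lambda>z::'a \<times> 'b. T (snd z)) = (\<lambda>a. (0, adjoint T a))"
    using adjoint_works[OF has_derivative_linear[OF T]]
    by (intro adjoint_unique) (auto simp: inner_Pair)
  ultimately show ?thesis
    using one_form_adjoint[OF M(2) \<beta> pq(2) k] by (simp add: pullback_def k_def T_def)
qed

lemma warped_determined:
  fixes w :: "'m::{t2_space, second_countable_topology} \<Rightarrow> real"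
  assumes M: "smooth_manifold A1" "smooth_manifold A2"
    and pq: "p \<in> U1" "q \<in> U2" "p \<in> chart_dom A1 i" "q \<in> chart_dom A2 j"
    and forms: "one_form A1 U1 \<alpha>1" "one_form A1 U1 \<beta>1" "one_form A2 U2 \<alpha>2" "one_form A2 U2 \<beta>2"
    and bil: "bilinear (t1 i p)" "bilinear (t2 j q)"
  defines "t \<equiv> warped w t1 t2 (i, j) (p, q)"
  shows "t (lift_h A1 A2 \<alpha>1 (i, j) (p, q)) (lift_h A1 A2 \<beta>1 (i, j) (p, q)) = t1 i p (\<alpha>1 i p) (\<beta>1 i p)"
    and "t (lift_v A1 A2 \<alpha>2 (i, j) (p, q)) (lift_v A1 A2 \<beta>2 (i, j) (p, q))
           = w p * t2 j q (\<alpha>2 j q) (\<beta>2 j q)"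
    and "t (lift_h A1 A2 \<alpha>1 (i, j) (p, q)) (lift_v A1 A2 \<beta>2 (i, j) (p, q)) = 0"
    and "t (lift_v A1 A2 \<alpha>2 (i, j) (p, q)) (lift_h A1 A2 \<beta>1 (i, j) (p, q)) = 0"
  using lift_h_components[OF M forms(1) pq(1,3,4)] lift_h_components[OF M forms(2) pq(1,3,4)]
    lift_v_components[OF M forms(3) pq(2,3,4)] lift_v_components[OF M forms(4) pq(2,3,4)]
  by (simp_all add: t_def warped_def bilinear_lzero bilinear_rzero bil)

end

theory Submission
  imports Defs
begin

text \<open>
  In an orthonormal frame \<open>e\<close> with \<open>g(e\<^sub>a, e\<^sub>a) = \<epsilon>\<^sub>a\<close>, the Levi-Civita contravariant connection is
  determined by the bracket coefficients \<open>C\<^sub>a\<^sub>b\<^sub>c = g([e\<^sub>a, e\<^sub>b], e\<^sub>c)\<close>, namely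
  \<open>\<Gamma>\<^sub>a\<^sub>b\<^sub>c = g(D\<^sub>a e\<^sub>b, e\<^sub>c) = (C\<^sub>a\<^sub>b\<^sub>c - C\<^sub>b\<^sub>c\<^sub>a + C\<^sub>c\<^sub>a\<^sub>b) / 2\<close>, and \<open>g(R(e\<^sub>a, e\<^sub>b) e\<^sub>b, e\<^sub>a)\<close> is an
  expression in the functions \<open>\<Gamma>\<close> and their derivatives along the frame. On the warped product
  \<open>[\<alpha>\<^sup>h, \<beta>\<^sup>h] = [\<alpha>, \<beta>]\<^sup>h\<close>, \<open>[\<alpha>\<^sup>h, \<beta>\<^sup>v] = 0\<close> and
  \<open>[\<alpha>\<^sup>v, \<beta>\<^sup>v] = \<mu> [\<alpha>, \<beta>]\<^sup>v + \<Pi>\<^sub>2(\<alpha>, \<beta>) d\<mu>\<^sup>h\<close>. For the frame \<open>\<theta>\<^sub>k\<^sup>h\<close>, \<open>f\<^bsup>-1/2\<^esup> \<eta>\<^sub>i\<^sup>v\<close> this gives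
  all \<open>\<Gamma>\<close> explicitly, and the formula follows by summation.
\<close>

section \<open>Calculus of smooth maps\<close>

text \<open>Without a Poisson hypothesis the curvature is not tensorial in its last argument and the
  scalar curvature depends on the frame. Every curvature is therefore computed in the given frame,
  from metric compatibility and vanishing torsion, and one locale \<open>contravariant_frame\<close>
  is instantiated for both factors and for the product. The sum over pairs of frame forms splits
  into blocks; the mixed block is computed once and counted twice. With \<open>n = DIM('b)\<close>,
  the squared norm of \<open>J df\<close> over \<open>4 f^2\<close> enters with \<open>2 n\<close>
  from the mixed blocks and with \<open>- n (n - 1)\<close> from the vertical one, in total
  \<open>- n (n - 3)\<close>. The squared norm of \<open>d\<mu>\<close> times that of
  \<open>J\<close>, over \<open>4 f^2\<close>, enters with \<open>2\<close> and \<open>- 3\<close>,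
  in total \<open>- 1\<close>. A preliminary obstacle is that metrics are given on tangent vectors,
  so that smoothness of a cometric means smooth dependence of the inverse of a bilinear form on a
  parameter.\<close>

lemma Ck_on_SucD:
  assumes "open S" "Ck_on (Suc k) S f" "x \<in> S"
  shows "(f has_derivative frechet_derivative f (at x)) (at x)"
  using assms differentiable_on_eq_differentiable_at[OF assms(1), of f]
  by (simp flip: frechet_derivative_works)

text \<open>Openness makes the derivatives at points of \<open>S\<close> depend only on the values
  on \<open>S\<close>; the induction then passes to the directional derivatives.\<close>

lemma Ck_on_cong:
  assumes "open S" "\<And>x. x \<in> S \<Longrightarrow> f x = g x" "Ck_on k S f"
  shows "Ck_on k S g"
  using assms(2,3)
proof (induction k arbitrary: f g)
  case 0
  then show ?case
    using continuous_on_eq[of S f g] by auto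
next
  case (Suc k)
  have g: "(g has_derivative frechet_derivative f (at x)) (at x)" if "x \<in> S" for x
    using has_derivative_transform_within_open[OF Ck_on_SucD[OF assms(1) Suc.prems(2) that] assms(1) that]
      Suc.prems(1) by simp
  then have "frechet_derivative g (at x) = frechet_derivative f (at x)" if "x \<in> S" for x
    using frechet_derivative_at[OF g[OF that]] by simp
  then have "Ck_on k S (\<lambda>x. frechet_derivative g (at x) v)" for v
    using Suc.prems(2) Suc.IH[of "\<lambda>x. frechet_derivative f (at x) v"
        "\<lambda>x. frechet_derivative g (at x) v"] by simp
  moreover have "g differentiable_on S"
    using g unfolding differentiable_on_def differentiable_def
    by (blast intro: has_derivative_at_withinI)
  ultimately show ?case
    by simp
qed

text \<open>The induction step of most closure lemmas below: an explicit derivative replaces the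
  chosen \<open>frechet_derivative\<close>, so that each closure property reduces to a
  differentiation rule.\<close>

lemma Ck_on_derivI:
  assumes "open S" "\<And>x. x \<in> S \<Longrightarrow> (f has_derivative f' x) (at x)"
    and "\<And>v. Ck_on k S (\<lambda>x. f' x v)"
  shows "Ck_on (Suc k) S f"
proof -
  have "frechet_derivative f (at x) = f' x" if "x \<in> S" for x
    using frechet_derivative_at[OF assms(2)[OF that]] by simp
  then have "Ck_on k S (\<lambda>x. frechet_derivative f (at x) v)" for v
    using Ck_on_cong[OF assms(1) _ assms(3)[of v]] by simp
  moreover have "f differentiable_on S"
    using assms(2) unfolding differentiable_on_def differentiable_def
    by (blast intro: has_derivative_at_withinI)
  ultimately show ?thesis
    by simp
qed

lemma Ck_on_subset: "Ck_on k S f \<Longrightarrow> T \<subseteq> S \<Longrightarrow> Ck_on k T f"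
proof (induction k arbitrary: f)
  case 0
  then show ?case
    using continuous_on_subset by auto
next
  case (Suc k)
  then show ?case
    using differentiable_on_subset[of f S T] by simp
qed

text \<open>Differentiating a product or a composition leaves some factors undifferentiated, and
  these have to be lowered by one order in the induction steps.\<close>

lemma Ck_on_pred: "Ck_on (Suc k) S f \<Longrightarrow> Ck_on k S f"
proof (induction k arbitrary: f)
  case 0
  then show ?case
    using differentiable_imp_continuous_on by auto
next
  case (Suc k)
  then show ?case
    by simp
qed

lemma Ck_on_const: "open S \<Longrightarrow> Ck_on k S (\<lambda>x. c)"
proof (induction k arbitrary: c)
  case (Suc k)
  then show ?case
    by (intro Ck_on_derivI[where f' = "\<lambda>_ _. 0"]) auto
qed simp

lemma Ck_on_linear:
  assumes "open S" "bounded_linear L" "Ck_on k S f"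
  shows "Ck_on k S (\<lambda>x. L (f x))"
  using assms(3)
proof (induction k arbitrary: f)
  case 0
  then show ?case
    using bounded_linear.continuous_on[OF assms(2)] by simp
next
  case (Suc k)
  show ?case
  proof (rule Ck_on_derivI[OF assms(1)])
    show "((\<lambda>x. L (f x)) has_derivative (\<lambda>v. L (frechet_derivative f (at x) v))) (at x)"
      if "x \<in> S" for x
      using bounded_linear.has_derivative[OF assms(2) Ck_on_SucD[OF assms(1) Suc.prems that]] .
  qed (use Suc assms(1) in auto)
qed

lemma Ck_on_ident: "open S \<Longrightarrow> Ck_on k S (\<lambda>x. x)"
proof (cases k)
  case (Suc n)
  assume "open S"
  then show ?thesis
    unfolding Suc
    by (intro Ck_on_derivI[where f' = "\<lambda>_ v. v"] Ck_on_const) auto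
qed simp

lemma Ck_on_add:
  assumes "open S" "Ck_on k S f" "Ck_on k S g"
  shows "Ck_on k S (\<lambda>x. f x + g x)"
  using assms(2,3)
proof (induction k arbitrary: f g)
  case 0
  then show ?case
    by (simp add: continuous_on_add)
next
  case (Suc k)
  show ?case
  proof (rule Ck_on_derivI[OF assms(1)])
    show "((\<lambda>x. f x + g x) has_derivative
        (\<lambda>v. frechet_derivative f (at x) v + frechet_derivative g (at x) v)) (at x)"
      if "x \<in> S" for x
      using has_derivative_add[OF Ck_on_SucD[OF assms(1) Suc.prems(1) that]
          Ck_on_SucD[OF assms(1) Suc.prems(2) that]] .
  qed (use Suc assms(1) in auto)
qed

lemma Ck_on_bilinear:
  assumes "open S" "bounded_bilinear h" "Ck_on k S f" "Ck_on k S g"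
  shows "Ck_on k S (\<lambda>x. h (f x) (g x))"
  using assms(3,4)
proof (induction k arbitrary: f g)
  case 0
  then show ?case
    using bounded_bilinear.continuous_on[OF assms(2)] by auto
next
  case (Suc k)
  show ?case
  proof (rule Ck_on_derivI[OF assms(1)])
    show "((\<lambda>x. h (f x) (g x)) has_derivative
        (\<lambda>v. h (f x) (frechet_derivative g (at x) v) + h (frechet_derivative f (at x) v) (g x))) (at x)"
      if "x \<in> S" for x
      using bounded_bilinear.FDERIV[OF assms(2) Ck_on_SucD[OF assms(1) Suc.prems(1) that]
          Ck_on_SucD[OF assms(1) Suc.prems(2) that]] .
    show "Ck_on k S (\<lambda>x. h (f x) (frechet_derivative g (at x) v)
        + h (frechet_derivative f (at x) v) (g x))" for v
      using Suc.prems Ck_on_pred[OF Suc.prems(1)] Ck_on_pred[OF Suc.prems(2)]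
      by (intro Ck_on_add assms(1) Suc.IH) auto
  qed
qed

lemma Ck_on_sum:
  assumes "open S" "\<And>j. j \<in> J \<Longrightarrow> Ck_on k S (f j)"
  shows "Ck_on k S (\<lambda>x. \<Sum>j\<in>J. f j x)"
  using assms(2)
proof (induction J rule: infinite_finite_induct)
  case (insert j J)
  then have "Ck_on k S (\<lambda>x. f j x + (\<Sum>j\<in>J. f j x))"
    by (intro Ck_on_add assms(1)) auto
  then show ?case
    using insert by simp
qed (use assms(1) in \<open>simp_all add: Ck_on_const\<close>)

lemma Ck_on_compose:
  assumes "open S" "open T" "g ` S \<subseteq> T" "Ck_on k T f" "Ck_on k S g"
  shows "Ck_on k S (\<lambda>x. f (g x))"
  using assms(4,5)
proof (induction k arbitrary: f)
  case 0
  then show ?case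
    using continuous_on_compose2[of T f S g] assms(3) by auto
next
  case (Suc k)
  have gx: "g x \<in> T" if "x \<in> S" for x
    using assms(3) that by blast
  show ?case
  proof (rule Ck_on_derivI[OF assms(1)])
    fix x assume x: "x \<in> S"
    have "linear (frechet_derivative f (at (g x)))"
      using Ck_on_SucD[OF assms(2) Suc.prems(1) gx[OF x]] by (rule has_derivative_linear)
    \<comment> \<open>The chain rule feeds the derivative of \<open>f\<close> a direction that
      varies with the point, whereas \<open>Ck_on\<close> speaks of fixed directions only. Expansion
      in the basis leaves fixed directions with coefficients that depend on the point.\<close>
    then have expand: "frechet_derivative f (at (g x)) w =
        (\<Sum>b\<in>Basis. (w \<bullet> b) *\<^sub>R frechet_derivative f (at (g x)) b)" for w
      by (subst euclidean_representation[of w, symmetric]) (simp only: linear_sum linear_scale)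
    show "((\<lambda>x. f (g x)) has_derivative (\<lambda>v. \<Sum>b\<in>Basis.
        (frechet_derivative g (at x) v \<bullet> b) *\<^sub>R frechet_derivative f (at (g x)) b)) (at x)"
      unfolding expand[symmetric]
      by (rule has_derivative_compose[OF Ck_on_SucD[OF assms(1) Suc.prems(2) x]
          Ck_on_SucD[OF assms(2) Suc.prems(1) gx[OF x]]])
  next
    fix v
    have "Ck_on k S (\<lambda>x. frechet_derivative f (at (g x)) b)" for b
    proof (rule Suc.IH[where f = "\<lambda>y. frechet_derivative f (at y) b"])
      show "Ck_on k T (\<lambda>y. frechet_derivative f (at y) b)"
        using Suc.prems(1) by simp
    qed (rule Ck_on_pred[OF Suc.prems(2)])
    moreover have "Ck_on k S (\<lambda>x. frechet_derivative g (at x) v \<bullet> b)" for b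
      using Suc.prems(2) by (intro Ck_on_linear[OF assms(1) bounded_linear_inner_left]) simp
    ultimately show "Ck_on k S (\<lambda>x. \<Sum>b\<in>Basis.
        (frechet_derivative g (at x) v \<bullet> b) *\<^sub>R frechet_derivative f (at (g x)) b)"
      by (intro Ck_on_sum Ck_on_bilinear[OF _ bounded_bilinear_scaleR] assms(1))
  qed
qed

text \<open>The exponent is generalised because differentiation lowers it. The exponents that occur
  later are \<open>- 1 / 2\<close> and \<open>- 1\<close>.\<close>

lemma Ck_on_powr: "Ck_on k {0<..} (\<lambda>x::real. x powr a)"
proof (induction k arbitrary: a)
  case 0
  then show ?case
    by (auto intro!: continuous_intros)
next
  case (Suc k)
  show ?case
  proof (rule Ck_on_derivI)
    show "((\<lambda>x. x powr a) has_derivative (\<lambda>v. (a * v) *\<^sub>R x powr (a - 1))) (at x)"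
      if "x \<in> {0<..}" for x
    proof -
      have "((\<lambda>x. x powr a) has_real_derivative a * x powr (a - 1)) (at x)"
        using that by (intro has_real_derivative_powr) auto
      then show ?thesis
        unfolding has_field_derivative_def by (rule has_derivative_eq_rhs) (simp add: fun_eq_iff)
    qed
    show "Ck_on k {0<..} (\<lambda>x. (a * v) *\<^sub>R x powr (a - 1))" for v
      by (intro Ck_on_linear[OF _ bounded_linear_scaleR_right] Suc) auto
  qed auto
qed

section \<open>Closure properties of smooth maps\<close>

lemma smooth_on_cong:
  "open S \<Longrightarrow> (\<And>x. x \<in> S \<Longrightarrow> f x = g x) \<Longrightarrow> smooth_on S f \<Longrightarrow> smooth_on S g"
  unfolding smooth_on_def using Ck_on_cong by blast

lemma smooth_on_subset: "smooth_on S f \<Longrightarrow> T \<subseteq> S \<Longrightarrow> smooth_on T f"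
  unfolding smooth_on_def using Ck_on_subset by blast

lemma smooth_on_const: "open S \<Longrightarrow> smooth_on S (\<lambda>x. c)"
  unfolding smooth_on_def using Ck_on_const by blast

lemma smooth_on_ident: "open S \<Longrightarrow> smooth_on S (\<lambda>x. x)"
  unfolding smooth_on_def using Ck_on_ident by blast

lemma smooth_on_linear:
  "open S \<Longrightarrow> bounded_linear L \<Longrightarrow> smooth_on S f \<Longrightarrow> smooth_on S (\<lambda>x. L (f x))"
  unfolding smooth_on_def using Ck_on_linear by blast

lemma smooth_on_add:
  "open S \<Longrightarrow> smooth_on S f \<Longrightarrow> smooth_on S g \<Longrightarrow> smooth_on S (\<lambda>x. f x + g x)"
  unfolding smooth_on_def using Ck_on_add by blast

lemma smooth_on_bilinear:
  "open S \<Longrightarrow> bounded_bilinear h \<Longrightarrow> smooth_on S f \<Longrightarrow> smooth_on S g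
    \<Longrightarrow> smooth_on S (\<lambda>x. h (f x) (g x))"
  unfolding smooth_on_def using Ck_on_bilinear by blast

lemma smooth_on_sum:
  "open S \<Longrightarrow> (\<And>j. j \<in> J \<Longrightarrow> smooth_on S (f j)) \<Longrightarrow> smooth_on S (\<lambda>x. \<Sum>j\<in>J. f j x)"
  unfolding smooth_on_def by (simp add: Ck_on_sum)

lemma smooth_on_compose:
  assumes "open S" "open T" "g ` S \<subseteq> T" "smooth_on T f" "smooth_on S g"
  shows "smooth_on S (\<lambda>x. f (g x))"
  unfolding smooth_on_def
proof
  fix k
  show "Ck_on k S (\<lambda>x. f (g x))"
    using assms(4,5) unfolding smooth_on_def
    by (intro Ck_on_compose[where f = f and g = g, OF assms(1-3)]) simp_all
qed

lemma smooth_on_powr: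
  fixes f :: "'a::euclidean_space \<Rightarrow> real"
  assumes "open S" "smooth_on S f" "\<And>x. x \<in> S \<Longrightarrow> f x > 0"
  shows "smooth_on S (\<lambda>x. f x powr a)"
  using assms Ck_on_powr
  by (intro smooth_on_compose[of S "{0<..}" f "\<lambda>x. x powr a"]) (auto simp: smooth_on_def)

lemma smooth_on_has_derivative:
  "open S \<Longrightarrow> smooth_on S f \<Longrightarrow> x \<in> S \<Longrightarrow> (f has_derivative frechet_derivative f (at x)) (at x)"
  unfolding smooth_on_def by (rule Ck_on_SucD) auto

lemma smooth_on_frechet_derivative:
  "smooth_on S f \<Longrightarrow> smooth_on S (\<lambda>x. frechet_derivative f (at x) v)"
  unfolding smooth_on_def by (metis Ck_on.simps(2))

lemma smooth_on_fst: "open S \<Longrightarrow> smooth_on S fst"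
  using smooth_on_linear[OF _ bounded_linear_fst smooth_on_ident] .

lemma smooth_on_snd: "open S \<Longrightarrow> smooth_on S snd"
  using smooth_on_linear[OF _ bounded_linear_snd smooth_on_ident] .

lemma smooth_on_Pair:
  fixes f :: "'a::euclidean_space \<Rightarrow> 'b::euclidean_space"
    and g :: "'a \<Rightarrow> 'c::euclidean_space"
  assumes "open S" "smooth_on S f" "smooth_on S g"
  shows "smooth_on S (\<lambda>x. (f x, g x))"
proof -
  have "bounded_linear (\<lambda>x::'b. (x, 0::'c))" "bounded_linear (\<lambda>y::'c. (0::'b, y))"
    by (simp_all add: bounded_linear_Pair bounded_linear_ident bounded_linear_zero)
  from this[THEN smooth_on_linear[OF assms(1)]] have "smooth_on S (\<lambda>x. (f x, 0) + (0, g x))"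
    using assms by (intro smooth_on_add) auto
  then show ?thesis
    by simp
qed

text \<open>A product rule whose second factor is merely continuous, bought by a zero of the first
  factor. It is made for the inverse of a bilinear form: there the correction terms have
  coefficients vanishing at the base point, while the inverse itself is so far only known to be
  continuous.\<close>

lemma has_derivative_scaleR_vanishing:
  fixes h :: "'a::real_normed_vector \<Rightarrow> real" and r :: "'a \<Rightarrow> 'b::real_normed_vector"
  assumes h: "(h has_derivative h') (at x)" and "h x = 0" and r: "isCont r x"
  shows "((\<lambda>y. h y *\<^sub>R r y) has_derivative (\<lambda>v. h' v *\<^sub>R r x)) (at x)"
proof -
  have bl: "bounded_linear h'"
    using h by (rule has_derivative_bounded_linear)
  then obtain K where K: "K > 0" "\<And>v. norm (h' v) \<le> norm v * K"
    using bounded_linear.pos_bounded by blast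
  show ?thesis
    unfolding has_derivative_at_alt
  proof (intro conjI allI impI)
    show "bounded_linear (\<lambda>v. h' v *\<^sub>R r x)"
      using bl by (rule bounded_linear_scaleR_const)
    fix e :: real assume e: "e > 0"
    \<comment> \<open>These choices turn each of the two error terms into half of \<open>e\<close>
      times the norm of \<open>y - x\<close>; the added 1 keeps the denominator positive when
      \<open>r x = 0\<close>.\<close>
    define e1 where "e1 = e / (2 * (norm (r x) + 1))"
    define e2 where "e2 = e / (2 * (K + e1))"
    have rx: "norm (r x) + 1 > 0"
      by (smt (verit) norm_ge_zero)
    then have e1: "e1 > 0"
      using e by (simp add: e1_def)
    then have e2: "e2 > 0"
      using e K(1) by (simp add: e2_def)
    obtain d1 where d1: "d1 > 0"
      "\<And>y. norm (y - x) < d1 \<Longrightarrow> norm (h y - h x - h' (y - x)) \<le> e1 * norm (y - x)"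
      using h e1 unfolding has_derivative_at_alt by blast
    obtain d2 where d2: "d2 > 0" "\<And>y. dist y x < d2 \<Longrightarrow> dist (r y) (r x) < e2"
      using r e2 unfolding continuous_at_eps_delta by blast
    show "\<exists>d>0. \<forall>y. norm (y - x) < d \<longrightarrow>
        norm (h y *\<^sub>R r y - h x *\<^sub>R r x - h' (y - x) *\<^sub>R r x) \<le> e * norm (y - x)"
    proof (intro exI[of _ "min d1 d2"] conjI allI impI)
      fix y assume y: "norm (y - x) < min d1 d2"
      have 1: "\<bar>h y - h' (y - x)\<bar> \<le> e1 * norm (y - x)"
        using d1(2)[of y] y assms(2) by simp
      have 2: "norm (r y - r x) \<le> e2"
        using d2(2)[of y] y by (simp add: dist_norm)
      have 3: "\<bar>h y\<bar> \<le> (K + e1) * norm (y - x)"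
        using 1 K(2)[of "y - x"] by (simp add: algebra_simps)
      have "h y *\<^sub>R r y - h x *\<^sub>R r x - h' (y - x) *\<^sub>R r x
          = (h y - h' (y - x)) *\<^sub>R r x + h y *\<^sub>R (r y - r x)"
        using assms(2) by (simp add: algebra_simps)
      then have "norm (h y *\<^sub>R r y - h x *\<^sub>R r x - h' (y - x) *\<^sub>R r x)
          \<le> \<bar>h y - h' (y - x)\<bar> * norm (r x) + \<bar>h y\<bar> * norm (r y - r x)"
        by (metis norm_scaleR norm_triangle_ineq)
      also have "\<dots> \<le> e1 * norm (y - x) * (norm (r x) + 1) + (K + e1) * norm (y - x) * e2"
        using 1 2 3 K(1) e1 by (intro add_mono mult_mono) auto
      also have "\<dots> = (e1 * (norm (r x) + 1) + (K + e1) * e2) * norm (y - x)"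
        by (simp add: algebra_simps)
      also have "e1 * (norm (r x) + 1) = e / 2"
        unfolding e1_def using rx by (simp only: times_divide_eq_left) (simp add: field_simps)
      also have "(K + e1) * e2 = e / 2"
        unfolding e2_def using K(1) e1
        by (simp only: times_divide_eq_right) (simp add: field_simps)
      finally show "norm (h y *\<^sub>R r y - h x *\<^sub>R r x - h' (y - x) *\<^sub>R r x) \<le> e * norm (y - x)"
        by simp
    qed (use d1 d2 in auto)
  qed
qed

section \<open>Bilinear forms and their inverses\<close>

lemma bilinear_left_sum:
  assumes "bilinear B"
  shows "B (\<Sum>j\<in>J. c j *\<^sub>R u j) v = (\<Sum>j\<in>J. c j * B (u j) v)"
  using linear_sum[of "\<lambda>u. B u v" "\<lambda>j. c j *\<^sub>R u j" J] linear_scale[of "\<lambda>u. B u v"] assms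
  by (simp add: bilinear_def)

lemma bilinear_right_sum:
  assumes "bilinear B"
  shows "B u (\<Sum>j\<in>J. c j *\<^sub>R v j) = (\<Sum>j\<in>J. c j * B u (v j))"
  using linear_sum[of "B u" "\<lambda>j. c j *\<^sub>R v j" J] linear_scale[of "B u"] assms
  by (simp add: bilinear_def)

lemma bilinear_left_basis:
  fixes B :: "'a::euclidean_space \<Rightarrow> 'b::real_vector \<Rightarrow> real"
  shows "bilinear B \<Longrightarrow> B u v = (\<Sum>b\<in>Basis. (u \<bullet> b) * B b v)"
  by (subst euclidean_representation[of u, symmetric]) (rule bilinear_left_sum)

lemma bilinear_right_basis:
  fixes B :: "'a::real_vector \<Rightarrow> 'b::euclidean_space \<Rightarrow> real"
  shows "bilinear B \<Longrightarrow> B u v = (\<Sum>b\<in>Basis. (v \<bullet> b) * B u b)"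
  by (subst euclidean_representation[of v, symmetric]) (rule bilinear_right_sum)

lemma sum_Basis_inner:
  fixes x :: "'a::euclidean_space"
  shows "(\<Sum>b\<in>Basis. h b *\<^sub>R b) \<bullet> x = (\<Sum>b\<in>Basis. (x \<bullet> b) * h b)"
  by (simp add: inner_sum_left mult.commute inner_commute[of x])

text \<open>Differentials and Lie derivatives are defined by their components on
  \<open>Basis\<close>; linearity allows them to be paired with an arbitrary vector.\<close>

lemma linear_component_sum:
  fixes h :: "'a::euclidean_space \<Rightarrow> real"
  assumes "linear h"
  shows "(\<Sum>b\<in>Basis. h b *\<^sub>R b) \<bullet> v = h v"
proof -
  have "(\<Sum>b\<in>Basis. h b *\<^sub>R b) \<bullet> v = h (\<Sum>b\<in>Basis. (v \<bullet> b) *\<^sub>R b)"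
    unfolding sum_Basis_inner by (simp add: linear_sum[OF assms] linear_scale[OF assms])
  then show ?thesis
    by (simp add: euclidean_representation)
qed

text \<open>
  Writing \<open>w = R x\<^sub>0 a\<close>, the perturbation identity
  \<open>R x a = w - R x (G x w - G x\<^sub>0 w)\<close> yields in turn local boundedness, continuity and
  differentiability of \<open>R\<close>.
\<close>

lemma smooth_on_form_inverse:
  fixes G :: "'c::euclidean_space \<Rightarrow> 'a::euclidean_space \<Rightarrow> 'a \<Rightarrow> real" and R :: "'c \<Rightarrow> 'a \<Rightarrow> 'a"
  assumes S: "open S" and G: "\<And>u v. smooth_on S (\<lambda>x. G x u v)"
    and bil: "\<And>x. x \<in> S \<Longrightarrow> bilinear (G x)"
    and R: "\<And>x a v. x \<in> S \<Longrightarrow> G x (R x a) v = a \<bullet> v"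
    and nondeg: "\<And>x u. x \<in> S \<Longrightarrow> (\<And>v. G x u v = 0) \<Longrightarrow> u = 0"
  shows "smooth_on S (\<lambda>x. R x a)"
proof -
  define h where "h y a x b = G x (R y a) b - a \<bullet> b" for y a x b
  have pert: "R x a = R y a - (\<Sum>b\<in>Basis. h y a x b *\<^sub>R R x b)" if "x \<in> S" "y \<in> S" for x y a
  proof -
    let ?u = "R x a - R y a + (\<Sum>b\<in>Basis. h y a x b *\<^sub>R R x b)"
    have "G x ?u v = 0" for v
    proof -
      have "G x ?u v = a \<bullet> v - G x (R y a) v + (\<Sum>b\<in>Basis. h y a x b * (b \<bullet> v))"
        using bil[OF that(1)] by (simp add: bilinear_ladd bilinear_lsub bilinear_left_sum R that)
      also have "(\<Sum>b\<in>Basis. h y a x b * (b \<bullet> v))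
          = (\<Sum>b\<in>Basis. (v \<bullet> b) * G x (R y a) b) - (\<Sum>b\<in>Basis. (a \<bullet> b) * (v \<bullet> b))"
        by (simp add: h_def algebra_simps sum_subtractf inner_commute)
      also have "\<dots> = G x (R y a) v - a \<bullet> v"
        using bilinear_right_basis[OF bil[OF that(1)], of "R y a" v] euclidean_inner[of a v] by simp
      finally show ?thesis
        by simp
    qed
    then have "?u = 0"
      by (rule nondeg[OF that(1)])
    then show ?thesis
      by (simp add: algebra_simps)
  qed
  have h_deriv: "((\<lambda>x. h y a x b) has_derivative
      (\<lambda>v. \<Sum>c\<in>Basis. (R y a \<bullet> c) * frechet_derivative (\<lambda>x. G x c b) (at y) v)) (at y)"
    if "y \<in> S" for y a b
  proof (rule has_derivative_transform_within_open[OF _ S that])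
    show "((\<lambda>x. (\<Sum>c\<in>Basis. (R y a \<bullet> c) * G x c b) - a \<bullet> b) has_derivative
      (\<lambda>v. \<Sum>c\<in>Basis. (R y a \<bullet> c) * frechet_derivative (\<lambda>x. G x c b) (at y) v)) (at y)"
      using smooth_on_has_derivative[OF S G that]
      by (auto intro!: derivative_eq_intros)
    show "(\<Sum>c\<in>Basis. (R y a \<bullet> c) * G x c b) - a \<bullet> b = h y a x b" if "x \<in> S" for x
      unfolding h_def bilinear_left_basis[OF bil[OF that], of "R y a"] ..
  qed
  have h_zero: "h y a y b = 0" if "y \<in> S" for y a b
    by (simp add: h_def R that)
  have h_lim: "((\<lambda>x. h y a x b) \<longlongrightarrow> 0) (at y)" if "y \<in> S" for y a b
    using has_derivative_continuous[OF h_deriv[OF that, of a b]] h_zero[OF that]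
    by (simp add: continuous_at)
  have cont: "isCont (\<lambda>x. R x a) y" if y: "y \<in> S" for y a
  proof -
    \<comment> \<open>\<open>N\<close> controls all of \<open>R x\<close> and \<open>H\<close> the
      perturbation. As soon as \<open>H x < 1 / 2\<close>, the unknown \<open>N x\<close> on the
      right of the estimate is absorbed on the left, which leaves \<open>N x \<le> 2 * N y\<close>
      near \<open>y\<close>.\<close>
    define N where "N x = (\<Sum>b\<in>Basis. norm (R x b))" for x
    define H where "H x = (\<Sum>a\<in>Basis. \<Sum>b\<in>Basis. \<bar>h y a x b\<bar>)" for x
    have N0: "norm (R x b) \<le> N x" if "b \<in> Basis" for x b
      unfolding N_def using that by (intro member_le_sum) auto
    have diff: "norm (R x a - R y a) \<le> (\<Sum>b\<in>Basis. \<bar>h y a x b\<bar>) * N x" if "x \<in> S" for x a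
    proof -
      have "norm (R x a - R y a) = norm (\<Sum>b\<in>Basis. h y a x b *\<^sub>R R x b)"
        unfolding pert[OF that y, of a] by (simp add: norm_minus_commute)
      also have "\<dots> \<le> (\<Sum>b\<in>Basis. \<bar>h y a x b\<bar> * N x)"
        using N0 by (intro sum_norm_le) (simp add: mult_left_mono)
      finally show ?thesis
        by (simp add: sum_distrib_right)
    qed
    have N: "N x \<le> N y + H x * N x" if "x \<in> S" for x
    proof -
      have "norm (R x b) \<le> norm (R y b) + (\<Sum>c\<in>Basis. \<bar>h y b x c\<bar>) * N x" for b
        using diff[OF that, of b] norm_triangle_ineq2[of "R x b" "R y b"] by linarith
      then have "N x \<le> (\<Sum>b\<in>Basis. norm (R y b) + (\<Sum>c\<in>Basis. \<bar>h y b x c\<bar>) * N x)"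
        unfolding N_def[of x] by (intro sum_mono) (simp add: N_def)
      then show ?thesis
        by (simp add: sum.distrib N_def[of y] H_def sum_distrib_right)
    qed
    have "(H \<longlongrightarrow> 0) (at y)"
      unfolding H_def by (intro tendsto_null_sum tendsto_rabs_zero h_lim y)
    then have "\<forall>\<^sub>F x in at y. H x < 1 / 2"
      by (rule order_tendstoD) simp
    moreover have "\<forall>\<^sub>F x in at y. x \<in> S"
      using S y by (simp add: eventually_at_topological) blast
    ultimately have "\<forall>\<^sub>F x in at y. norm (R x a - R y a) \<le> (\<Sum>b\<in>Basis. \<bar>h y a x b\<bar>) * (2 * N y)"
    proof eventually_elim
      case (elim x)
      have "N x \<ge> 0"
        unfolding N_def by (intro sum_nonneg) auto
      then have "H x * N x \<le> 1 / 2 * N x"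
        using elim by (intro mult_right_mono) auto
      then have "N x \<le> 2 * N y"
        using N[OF elim(2)] by linarith
      then have "(\<Sum>b\<in>Basis. \<bar>h y a x b\<bar>) * N x \<le> (\<Sum>b\<in>Basis. \<bar>h y a x b\<bar>) * (2 * N y)"
        by (intro mult_left_mono sum_nonneg) auto
      then show ?case
        using diff[OF elim(2), of a] by linarith
    qed
    moreover have "((\<lambda>x. (\<Sum>b\<in>Basis. \<bar>h y a x b\<bar>) * (2 * N y)) \<longlongrightarrow> 0) (at y)"
      by (intro tendsto_mult_left_zero tendsto_null_sum tendsto_rabs_zero h_lim y)
    ultimately have "((\<lambda>x. R x a - R y a) \<longlongrightarrow> 0) (at y)"
      by (rule Lim_null_comparison)
    then show ?thesis
      unfolding isCont_def using LIM_zero_iff by blast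
  qed
  have "Ck_on k S (\<lambda>x. R x a)" for k a
  proof (induction k arbitrary: a)
    case 0
    then show ?case
      using cont by (simp add: continuous_at_imp_continuous_on)
  next
    case (Suc k)
    show ?case
    \<comment> \<open>The derivative is a polynomial in \<open>R\<close> and the derivatives of
      \<open>G\<close>, so that order \<open>k\<close> of \<open>R\<close> yields order
      \<open>Suc k\<close>.\<close>
    proof (rule Ck_on_derivI[OF S])
      fix y assume y: "y \<in> S"
      show "((\<lambda>x. R x a) has_derivative (\<lambda>v. - (\<Sum>b\<in>Basis. (\<Sum>c\<in>Basis. (R y a \<bullet> c) *
          frechet_derivative (\<lambda>x. G x c b) (at y) v) *\<^sub>R R y b))) (at y)"
      proof (rule has_derivative_transform_within_open[OF _ S y])
        show "((\<lambda>x. R y a - (\<Sum>b\<in>Basis. h y a x b *\<^sub>R R x b)) has_derivative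
            (\<lambda>v. - (\<Sum>b\<in>Basis. (\<Sum>c\<in>Basis. (R y a \<bullet> c) *
              frechet_derivative (\<lambda>x. G x c b) (at y) v) *\<^sub>R R y b))) (at y)"
          using has_derivative_diff[OF has_derivative_const has_derivative_sum[OF
              has_derivative_scaleR_vanishing[OF h_deriv[OF y] h_zero[OF y] cont[OF y]]]]
          by simp
      qed (rule pert[OF _ y, symmetric])
    next
      fix v
      have "Ck_on k S (\<lambda>x. frechet_derivative (\<lambda>x. G x c b) (at x) v)" for b c
        using smooth_on_frechet_derivative[OF G] unfolding smooth_on_def by blast
      then have "Ck_on k S (\<lambda>x. (\<Sum>b\<in>Basis. (\<Sum>c\<in>Basis. (R x a \<bullet> c) *
          frechet_derivative (\<lambda>x. G x c b) (at x) v) *\<^sub>R R x b))"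
        by (intro Ck_on_sum S Ck_on_bilinear[OF _ bounded_bilinear_scaleR]
            Ck_on_bilinear[OF _ bounded_bilinear_mult] Ck_on_linear[OF _ bounded_linear_inner_left] Suc)
      then show "Ck_on k S (\<lambda>x. - (\<Sum>b\<in>Basis. (\<Sum>c\<in>Basis. (R x a \<bullet> c) *
          frechet_derivative (\<lambda>x. G x c b) (at x) v) *\<^sub>R R x b))"
        by (rule Ck_on_linear[OF S bounded_linear_minus[OF bounded_linear_ident]])
    qed
  qed
  then show ?thesis
    unfolding smooth_on_def by blast
qed

text \<open>The map taking \<open>u\<close> to the vector that represents \<open>B u\<close> is
  injective, hence onto in finite dimension. This gives a value to the definite descriptions in
  \<open>raise\<close> and \<open>J_endo\<close>.\<close>

lemma nondegenerate_representation:
  fixes B :: "'a::euclidean_space \<Rightarrow> 'a \<Rightarrow> real"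
  assumes bil: "bilinear B" and nondeg: "\<And>u. (\<And>v. B u v = 0) \<Longrightarrow> u = 0" and L: "linear L"
  shows "\<exists>!u. \<forall>v. B u v = L v"
proof -
  define T where "T u = (\<Sum>b\<in>Basis. B u b *\<^sub>R b)" for u
  have T: "T u \<bullet> v = B u v" for u v
    using bilinear_right_basis[OF bil, of u v] by (simp add: T_def sum_Basis_inner)
  have "linear T"
    by (rule linearI; rule vector_eq_rdot[THEN iffD1])
      (simp_all add: inner_add_left T bilinear_ladd[OF bil] bilinear_lmul[OF bil])
  moreover have "u = u'" if "T u = T u'" for u u'
  proof -
    have "B (u - u') v = 0" for v
      using that T[of u v] T[of u' v] by (simp add: bilinear_lsub[OF bil])
    then show ?thesis
      using nondeg[of "u - u'"] by simp
  qed
  ultimately have "surj T" and inj: "inj T"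
    by (simp_all add: inj_def linear_injective_imp_surjective)
  then obtain u where u: "T u = (\<Sum>b\<in>Basis. L b *\<^sub>R b)"
    by (metis surj_def)
  have "B u v = L v" for v
    using T[of u v] linear_component_sum[OF L, of v] by (simp add: u)
  moreover have "w = u" if "\<forall>v. B w v = L v" for w
  proof -
    have "T w = T u"
      using that calculation by (intro vector_eq_rdot[THEN iffD1]) (simp add: T)
    then show ?thesis
      using inj by (simp add: inj_def)
  qed
  ultimately show ?thesis
    by blast
qed

section \<open>Smooth functions and one-forms on a manifold\<close>

lemma chart_deriv_eqI:
  "((F \<circ> chart_inv A i) has_derivative T) (at (chart_map A i p)) \<Longrightarrow> chart_deriv A i F p = T"
  unfolding chart_deriv_def by (rule frechet_derivative_at[symmetric])

lemma chart_smooth_subset: "chart_smooth A U i F \<Longrightarrow> V \<subseteq> U \<Longrightarrow> chart_smooth A V i F"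
  unfolding chart_smooth_def by (erule smooth_on_subset) blast

lemma one_form_subset:
  assumes "one_form A U \<alpha>" "V \<subseteq> U"
  shows "one_form A V \<alpha>"
proof -
  have "chart_smooth A V i (\<alpha> i)" for i
    using assms(1) chart_smooth_subset[OF _ assms(2), of A i "\<alpha> i"] by (simp add: one_form_def)
  then show ?thesis
    using assms unfolding one_form_def by (simp add: subset_iff)
qed

lemma smooth_fun_subset: "smooth_fun A U \<phi> \<Longrightarrow> V \<subseteq> U \<Longrightarrow> smooth_fun A V \<phi>"
  unfolding smooth_fun_def using chart_smooth_subset[of A U _ \<phi> V] by blast

lemma field_eq_onD: "field_eq_on A U \<alpha> \<beta> \<Longrightarrow> p \<in> U \<Longrightarrow> p \<in> chart_dom A i \<Longrightarrow> \<alpha> i p = \<beta> i p"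
  unfolding field_eq_on_def by blast

lemma one_form_smooth: "one_form A U \<alpha> \<Longrightarrow> chart_smooth A U i (\<alpha> i)"
  unfolding one_form_def by blast

lemma one_form_transform:
  "one_form A U \<alpha> \<Longrightarrow> p \<in> U \<Longrightarrow> p \<in> chart_dom A i \<Longrightarrow> p \<in> chart_dom A j \<Longrightarrow>
    \<alpha> i p \<bullet> v = \<alpha> j p \<bullet> chart_deriv A i (chart_map A j) p v"
  unfolding one_form_def by blast

lemma anchor_inner:
  fixes P :: "('i, 'm, 'a::euclidean_space) field2"
  shows "bilinear (P i p) \<Longrightarrow> anchor P \<alpha> i p \<bullet> b = P i p (\<alpha> i p) b"
  unfolding anchor_def sum_Basis_inner by (rule bilinear_right_basis[symmetric])

text \<open>The common core of cometrics, bivector fields and both warped fields. Leaving symmetry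
  aside lets evaluation, smoothness and lifting to the product be proved once for all of
  them.\<close>

definition cotensor2 :: "('i, 'm, 'a::euclidean_space) atlas \<Rightarrow> ('i, 'm, 'a) field2 \<Rightarrow> bool" where
  "cotensor2 A t \<longleftrightarrow>
     (\<forall>i a b. chart_smooth A UNIV i (\<lambda>p. t i p a b)) \<and>
     (\<forall>i. \<forall>p \<in> chart_dom A i. bilinear (t i p)) \<and>
     (\<forall>i j. \<forall>p \<in> chart_dom A i \<inter> chart_dom A j. \<forall>a b.
        t j p a b = t i p (adjoint (chart_deriv A i (chart_map A j) p) a)
                          (adjoint (chart_deriv A i (chart_map A j) p) b))"

lemma bivector_field_cotensor2: "bivector_field A P \<Longrightarrow> cotensor2 A P"
  unfolding bivector_field_def cotensor2_def by blast

lemma cotensor2_bilinear: "cotensor2 A t \<Longrightarrow> p \<in> chart_dom A i \<Longrightarrow> bilinear (t i p)"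
  unfolding cotensor2_def by blast

section \<open>Calculus in the charts of one atlas\<close>

locale smooth_atlas =
  fixes A :: "('i, 'm::{t2_space, second_countable_topology}, 'a::euclidean_space) atlas"
  assumes manifold: "smooth_manifold A"
begin

lemma open_chart_dom: "open (chart_dom A i)"
  using manifold by (simp add: smooth_manifold_def)

lemma chart_at_dom: "p \<in> chart_dom A (chart_at A p)"
  by (rule chart_at_in[OF manifold])

lemmas inv_map = chart_inv_map[OF manifold]
lemmas open_image = open_chart_image[OF manifold]

lemma has_derivative_chart_deriv:
  assumes "open U" "chart_smooth A U i F" "p \<in> U" "p \<in> chart_dom A i"
  shows "((F \<circ> chart_inv A i) has_derivative chart_deriv A i F p) (at (chart_map A i p))"
  using assms smooth_on_has_derivative[OF open_image[OF assms(1)]]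
  unfolding chart_smooth_def chart_deriv_def by blast

lemma linear_chart_deriv:
  assumes "open U" "chart_smooth A U i F" "p \<in> U" "p \<in> chart_dom A i"
  shows "linear (chart_deriv A i F p)"
  using has_derivative_chart_deriv[OF assms] by (rule has_derivative_linear)

lemma chart_deriv_cong:
  assumes "open U" "p \<in> U" "p \<in> chart_dom A i"
    and "\<And>q. q \<in> U \<Longrightarrow> q \<in> chart_dom A i \<Longrightarrow> F q = G q"
  shows "chart_deriv A i F p = chart_deriv A i G p"
proof -
  let ?S = "chart_map A i ` (U \<inter> chart_dom A i)"
  have x: "chart_map A i p \<in> ?S"
    using assms(2,3) by blast
  have eq: "(F \<circ> chart_inv A i) x = (G \<circ> chart_inv A i) x" if "x \<in> ?S" for x
    using that assms(4) inv_map by auto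
  \<comment> \<open>The equivalence holds for every candidate \<open>T\<close>, so the choice inside
    \<open>frechet_derivative\<close> falls on the same map for both functions, differentiable or
    not.\<close>
  have "((F \<circ> chart_inv A i) has_derivative T) (at (chart_map A i p))
      \<longleftrightarrow> ((G \<circ> chart_inv A i) has_derivative T) (at (chart_map A i p))" for T
    using has_derivative_transform_within_open[OF _ open_image[OF assms(1)] x] eq
    by (metis (no_types, lifting))
  then show ?thesis
    unfolding chart_deriv_def frechet_derivative_def by simp
qed

lemma chart_smooth_cong:
  assumes "open U" "chart_smooth A U i F"
    and "\<And>p. p \<in> U \<Longrightarrow> p \<in> chart_dom A i \<Longrightarrow> F p = G p"
  shows "chart_smooth A U i G"
  unfolding chart_smooth_def
proof (rule smooth_on_cong[OF open_image[OF assms(1)]])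
  show "smooth_on (chart_map A i ` (U \<inter> chart_dom A i)) (F \<circ> chart_inv A i)"
    using assms(2) unfolding chart_smooth_def .
qed (use assms(3) inv_map in auto)

lemma chart_smooth_const: "open U \<Longrightarrow> chart_smooth A U i (\<lambda>p. c)"
  unfolding chart_smooth_def comp_def by (intro smooth_on_const open_image)

lemma chart_smooth_linear:
  "open U \<Longrightarrow> bounded_linear L \<Longrightarrow> chart_smooth A U i F \<Longrightarrow> chart_smooth A U i (\<lambda>p. L (F p))"
  unfolding chart_smooth_def comp_def using smooth_on_linear[OF open_image] .

lemma chart_smooth_add:
  "open U \<Longrightarrow> chart_smooth A U i F \<Longrightarrow> chart_smooth A U i G
    \<Longrightarrow> chart_smooth A U i (\<lambda>p. F p + G p)"
  unfolding chart_smooth_def comp_def using smooth_on_add[OF open_image] .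

lemma chart_smooth_bilinear:
  "open U \<Longrightarrow> bounded_bilinear h \<Longrightarrow> chart_smooth A U i F \<Longrightarrow> chart_smooth A U i G
    \<Longrightarrow> chart_smooth A U i (\<lambda>p. h (F p) (G p))"
  unfolding chart_smooth_def comp_def using smooth_on_bilinear[OF open_image] .

lemma chart_smooth_sum:
  "open U \<Longrightarrow> (\<And>j. j \<in> J \<Longrightarrow> chart_smooth A U i (F j)) \<Longrightarrow> chart_smooth A U i (\<lambda>p. \<Sum>j\<in>J. F j p)"
  unfolding chart_smooth_def comp_def using smooth_on_sum[OF open_image] .

lemma chart_smooth_powr:
  fixes F :: "'m \<Rightarrow> real"
  assumes "open U" "chart_smooth A U i F" "\<And>p. F p > 0"
  shows "chart_smooth A U i (\<lambda>p. F p powr a)"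
  using assms unfolding chart_smooth_def comp_def by (intro smooth_on_powr open_image) auto

lemmas chart_smooth_scaleR = chart_smooth_bilinear[OF _ bounded_bilinear_scaleR]
lemmas chart_smooth_mult = chart_smooth_bilinear[OF _ bounded_bilinear_mult[where 'a = real]]
lemmas chart_smooth_inner = chart_smooth_bilinear[OF _ bounded_bilinear_inner]

lemma chart_smooth_chart_deriv:
  assumes "open U" "chart_smooth A U i F"
  shows "chart_smooth A U i (\<lambda>p. chart_deriv A i F p v)"
  unfolding chart_smooth_def
proof (rule smooth_on_cong[OF open_image[OF assms(1)]])
  show "smooth_on (chart_map A i ` (U \<inter> chart_dom A i))
      (\<lambda>x. frechet_derivative (F \<circ> chart_inv A i) (at x) v)"
    using assms(2) unfolding chart_smooth_def by (rule smooth_on_frechet_derivative)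
qed (auto simp: chart_deriv_def inv_map)

lemma chart_deriv_const: "chart_deriv A i (\<lambda>p. c) p = (\<lambda>v. 0)"
  by (rule chart_deriv_eqI) (simp add: comp_def)

lemma chart_deriv_linear:
  assumes "open U" "chart_smooth A U i F" "p \<in> U" "p \<in> chart_dom A i" "bounded_linear L"
  shows "chart_deriv A i (\<lambda>p. L (F p)) p = (\<lambda>v. L (chart_deriv A i F p v))"
  using bounded_linear.has_derivative[OF assms(5) has_derivative_chart_deriv[OF assms(1-4)]]
  by (intro chart_deriv_eqI) (simp add: comp_def)

lemma chart_deriv_bilinear:
  assumes "open U" "chart_smooth A U i F" "chart_smooth A U i G" "p \<in> U" "p \<in> chart_dom A i"
    and "bounded_bilinear h"
  shows "chart_deriv A i (\<lambda>p. h (F p) (G p)) p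
    = (\<lambda>v. h (F p) (chart_deriv A i G p v) + h (chart_deriv A i F p v) (G p))"
  using bounded_bilinear.FDERIV[OF assms(6) has_derivative_chart_deriv[OF assms(1,2,4,5)]
      has_derivative_chart_deriv[OF assms(1,3,4,5)]]
  by (intro chart_deriv_eqI) (simp add: comp_def inv_map assms)

lemma chart_deriv_transition:
  assumes "open U" "chart_smooth A U j F" "p \<in> U" "p \<in> chart_dom A i" "p \<in> chart_dom A j"
  shows "chart_deriv A i F p v = chart_deriv A j F p (chart_deriv A i (chart_map A j) p v)"
proof -
  let ?T = "chart_map A j \<circ> chart_inv A i"
  have "((F \<circ> chart_inv A j) has_derivative chart_deriv A j F p) (at (?T (chart_map A i p)))"
    using has_derivative_chart_deriv[OF assms(1-3,5)] inv_map[OF assms(4)] by simp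
  from has_derivative_compose[OF transition_has_derivative[OF manifold assms(4,5)] this]
  have "((\<lambda>x. (F \<circ> chart_inv A j) (?T x)) has_derivative
      (\<lambda>v. chart_deriv A j F p (chart_deriv A i (chart_map A j) p v))) (at (chart_map A i p))" .
  then have "((F \<circ> chart_inv A i) has_derivative
      (\<lambda>v. chart_deriv A j F p (chart_deriv A i (chart_map A j) p v))) (at (chart_map A i p))"
    by (rule has_derivative_transform_within_open[OF _ open_image[OF open_chart_dom[of j], of i]])
      (use assms inv_map in auto)
  then show ?thesis
    by (simp add: chart_deriv_eqI)
qed

lemma one_form_cong:
  assumes "open U" "one_form A U \<alpha>" "field_eq_on A U \<alpha> \<beta>"
  shows "one_form A U \<beta>"
proof -
  have "chart_smooth A U i (\<beta> i)" for i
    using one_form_smooth[OF assms(2)] field_eq_onD[OF assms(3)]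
    by (rule chart_smooth_cong[OF assms(1)])
  then show ?thesis
    using assms(2,3) unfolding one_form_def field_eq_on_def by simp
qed

lemma one_form_add:
  assumes "open U" "one_form A U \<alpha>" "one_form A U \<beta>"
  shows "one_form A U (\<lambda>i p. \<alpha> i p + \<beta> i p)"
  unfolding one_form_def
proof (intro conjI allI ballI)
  show "chart_smooth A U i (\<lambda>p. \<alpha> i p + \<beta> i p)" for i
    using assms by (intro chart_smooth_add one_form_smooth)
  show "(\<alpha> i p + \<beta> i p) \<bullet> v = (\<alpha> j p + \<beta> j p) \<bullet> chart_deriv A i (chart_map A j) p v"
    if "p \<in> U \<inter> chart_dom A i \<inter> chart_dom A j" for i j p v
    using one_form_transform[OF assms(2), of p i j v] one_form_transform[OF assms(3), of p i j v] that
    by (simp add: inner_add_left)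
qed

lemma one_form_scale:
  assumes "open U" "smooth_fun A U \<phi>" "one_form A U \<alpha>"
  shows "one_form A U (scale_field \<phi> \<alpha>)"
proof -
  have "chart_smooth A U i (scale_field \<phi> \<alpha> i)" for i
    using chart_smooth_scaleR[OF assms(1), of i \<phi> "\<alpha> i"] assms(2,3)
    unfolding smooth_fun_def one_form_def scale_field_def[abs_def] by blast
  then show ?thesis
    using assms(3) unfolding one_form_def by (simp add: scale_field_def)
qed

lemma smooth_fun_const: "open U \<Longrightarrow> smooth_fun A U (\<lambda>p. c)"
  unfolding smooth_fun_def using chart_smooth_const by blast

lemma smooth_fun_mult:
  "open U \<Longrightarrow> smooth_fun A U \<phi> \<Longrightarrow> smooth_fun A U \<psi> \<Longrightarrow> smooth_fun A U (\<lambda>p. \<phi> p * \<psi> p)"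
  unfolding smooth_fun_def using chart_smooth_mult by blast

lemma smooth_fun_powr:
  "open U \<Longrightarrow> smooth_fun A U \<phi> \<Longrightarrow> (\<And>p. \<phi> p > 0) \<Longrightarrow> smooth_fun A U (\<lambda>p. \<phi> p powr a)"
  unfolding smooth_fun_def using chart_smooth_powr by blast

lemma smooth_fun_cong:
  "open U \<Longrightarrow> smooth_fun A U \<phi> \<Longrightarrow> (\<And>p. p \<in> U \<Longrightarrow> \<phi> p = \<psi> p) \<Longrightarrow> smooth_fun A U \<psi>"
  unfolding smooth_fun_def using chart_smooth_cong by metis

lemma one_form_diff:
  assumes "open U" "one_form A U \<alpha>" "one_form A U \<beta>"
  shows "one_form A U (\<lambda>i p. \<alpha> i p - \<beta> i p)"
  using one_form_add[OF assms(1,2) one_form_scale[OF assms(1) smooth_fun_const[OF assms(1), of "-1"] assms(3)]]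
  by (simp add: scale_field_def)

lemma one_form_zero: "open U \<Longrightarrow> one_form A U (\<lambda>i p. 0)"
  unfolding one_form_def by (simp add: chart_smooth_const)

lemma one_form_sum:
  assumes "open U" "\<And>j. j \<in> J \<Longrightarrow> one_form A U (\<alpha> j)"
  shows "one_form A U (\<lambda>i p. \<Sum>j\<in>J. \<alpha> j i p)"
  using assms(2)
proof (induction J rule: infinite_finite_induct)
  case (insert j J)
  then show ?case
    using one_form_add[OF assms(1), of "\<alpha> j" "\<lambda>i p. \<Sum>j\<in>J. \<alpha> j i p"] by simp
qed (simp_all add: one_form_zero assms(1))

lemma differential_inner:
  assumes "open U" "smooth_fun A U \<phi>" "p \<in> U" "p \<in> chart_dom A i"
  shows "differential A \<phi> i p \<bullet> v = chart_deriv A i \<phi> p v"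
  unfolding differential_def using assms(2)
  by (intro linear_component_sum linear_chart_deriv[OF assms(1) _ assms(3,4)]) (simp add: smooth_fun_def)

lemma one_form_differential:
  assumes "open U" "smooth_fun A U \<phi>"
  shows "one_form A U (differential A \<phi>)"
proof -
  have "chart_smooth A U i (\<lambda>p. \<Sum>b\<in>Basis. chart_deriv A i \<phi> p b *\<^sub>R b)" for i
    using assms unfolding smooth_fun_def
    by (intro chart_smooth_sum chart_smooth_scaleR chart_smooth_chart_deriv chart_smooth_const) auto
  then have "chart_smooth A U i (differential A \<phi> i)" for i
    by (simp add: differential_def[abs_def])
  moreover have "differential A \<phi> i p \<bullet> v = differential A \<phi> j p \<bullet> chart_deriv A i (chart_map A j) p v"
    if "p \<in> U" "p \<in> chart_dom A i" "p \<in> chart_dom A j" for i j p v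
    unfolding differential_inner[OF assms that(1,2)] differential_inner[OF assms that(1,3)]
    using assms(2) by (intro chart_deriv_transition[OF assms(1) _ that]) (simp add: smooth_fun_def)
  ultimately show ?thesis
    unfolding one_form_def by blast
qed

text \<open>The transformation laws of the tensor and of the forms cancel, which frees
  \<open>field2_eval\<close> from its arbitrary chart. There are two sets because a form over a
  small open set is often paired with a frame form over a larger one.\<close>

lemma field2_eval_chart:
  assumes "cotensor2 A t" "one_form A U \<alpha>" "one_form A V \<beta>" "p \<in> U" "p \<in> V" "p \<in> chart_dom A i"
  shows "field2_eval A t \<alpha> \<beta> p = t i p (\<alpha> i p) (\<beta> i p)"
proof -
  let ?T = "adjoint (chart_deriv A i (chart_map A (chart_at A p)) p)"
  have "t (chart_at A p) p a b = t i p (?T a) (?T b)" for a b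
    using assms(1,6) chart_at_dom[of p] unfolding cotensor2_def by blast
  then show ?thesis
    unfolding field2_eval_def
    by (simp add: one_form_adjoint[OF manifold assms(2,4,6) chart_at_dom]
        one_form_adjoint[OF manifold assms(3,5,6) chart_at_dom])
qed

lemma smooth_fun_field2_eval:
  assumes "open U" "cotensor2 A t" "one_form A U \<alpha>" "one_form A U \<beta>"
  shows "smooth_fun A U (field2_eval A t \<alpha> \<beta>)"
  unfolding smooth_fun_def
proof
  fix i
  have "chart_smooth A U i (\<lambda>p. t i p a b)" for a b
    using assms(2) unfolding cotensor2_def by (meson chart_smooth_subset subset_UNIV)
  \<comment> \<open>\<open>cotensor2\<close> gives smoothness for fixed covectors only, so both
    arguments are expanded in the basis.\<close>
  then have "chart_smooth A U i (\<lambda>p. \<Sum>b\<in>Basis. (\<alpha> i p \<bullet> b) * (\<Sum>c\<in>Basis. (\<beta> i p \<bullet> c) * t i p b c))"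
    using one_form_smooth[OF assms(3)] one_form_smooth[OF assms(4)]
    by (intro chart_smooth_sum chart_smooth_mult chart_smooth_linear[OF _ bounded_linear_inner_left] assms(1))
  then show "chart_smooth A U i (field2_eval A t \<alpha> \<beta>)"
  proof (rule chart_smooth_cong[OF assms(1)])
    fix p assume p: "p \<in> U" "p \<in> chart_dom A i"
    note bil = cotensor2_bilinear[OF assms(2) p(2)]
    show "(\<Sum>b\<in>Basis. (\<alpha> i p \<bullet> b) * (\<Sum>c\<in>Basis. (\<beta> i p \<bullet> c) * t i p b c)) = field2_eval A t \<alpha> \<beta> p"
      unfolding field2_eval_chart[OF assms(2-4) p(1) p]
        bilinear_left_basis[OF bil, of "\<alpha> i p"]
      by (intro sum.cong refl arg_cong[where f = "(*) _"]) (rule bilinear_right_basis[OF bil, symmetric])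
  qed
qed

text \<open>This form displays the derivative as tensorial in \<open>\<alpha>\<close> and leads from
  derivatives of \<open>\<phi>\<close> to the components of \<open>J d\<phi>\<close>.\<close>

lemma derive_along_eq:
  assumes "cotensor2 A P" "open U" "smooth_fun A U \<phi>" "p \<in> U"
  shows "derive_along A (anchor P \<alpha>) \<phi> p = field2_eval A P \<alpha> (differential A \<phi>) p"
  unfolding derive_along_def field2_eval_def
    differential_inner[OF assms(2-4) chart_at_dom, symmetric]
  by (subst inner_commute)
    (rule anchor_inner[of P "chart_at A p" p \<alpha>, OF cotensor2_bilinear[OF assms(1) chart_at_dom]])

lemma derive_along_cong:
  assumes "open U" "p \<in> U" "\<And>q. q \<in> U \<Longrightarrow> \<phi> q = \<psi> q"
  shows "derive_along A X \<phi> p = derive_along A X \<psi> p"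
  unfolding derive_along_def using chart_deriv_cong[OF assms(1,2) chart_at_dom assms(3)] by simp

lemma derive_along_const: "derive_along A X (\<lambda>q. c) p = 0"
  by (simp add: derive_along_def chart_deriv_const)

lemma derive_along_mult:
  assumes "open U" "smooth_fun A U \<phi>" "smooth_fun A U \<psi>" "p \<in> U"
  shows "derive_along A X (\<lambda>q. \<phi> q * \<psi> q) p
    = derive_along A X \<phi> p * \<psi> p + \<phi> p * derive_along A X \<psi> p"
  using chart_deriv_bilinear[OF assms(1) _ _ assms(4) chart_at_dom bounded_bilinear_mult, of \<phi> \<psi>] assms(2,3)
  by (simp add: derive_along_def smooth_fun_def)

end

section \<open>Connections in an orthonormal frame\<close>

lemma metric_raise:
  assumes "pseudo_riemannian_metric A gt" "p \<in> chart_dom A i"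
  shows "gt i p (raise gt i p a) v = a \<bullet> v"
proof -
  have "\<exists>!u. \<forall>v. gt i p u v = a \<bullet> v"
    using assms unfolding pseudo_riemannian_metric_def
    by (intro nondegenerate_representation bounded_linear.linear[OF bounded_linear_inner_right]) blast+
  from theI'[OF this] show ?thesis
    unfolding raise_def by blast
qed

lemma cometric_inner:
  assumes "pseudo_riemannian_metric A gt" "p \<in> chart_dom A i"
  shows "cometric gt i p a b = a \<bullet> raise gt i p b"
  unfolding cometric_def by (rule metric_raise[OF assms])

lemma cometric_sym:
  assumes "pseudo_riemannian_metric A gt" "p \<in> chart_dom A i"
  shows "cometric gt i p a b = cometric gt i p b a"
  using assms unfolding cometric_def pseudo_riemannian_metric_def by blast

lemma cometric_bilinear:
  assumes "pseudo_riemannian_metric A gt" "p \<in> chart_dom A i"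
  shows "bilinear (cometric gt i p)"
proof -
  have 1: "linear (\<lambda>a. cometric gt i p a b)" for b
    unfolding cometric_inner[OF assms]
    by (rule bounded_linear.linear[OF bounded_linear_inner_left])
  moreover have "linear (cometric gt i p a)" for a
    using 1[of a] unfolding cometric_sym[OF assms, of _ a] .
  ultimately show ?thesis
    unfolding bilinear_def by blast
qed

context smooth_atlas
begin

lemma chart_smooth_raise:
  assumes "pseudo_riemannian_metric A gt"
  shows "chart_smooth A UNIV i (\<lambda>p. raise gt i p a)"
  unfolding chart_smooth_def comp_def
proof (rule smooth_on_form_inverse[where G = "\<lambda>x. gt i (chart_inv A i x)"])
  show "open (chart_map A i ` (UNIV \<inter> chart_dom A i))"
    by (rule open_image) simp
  show "smooth_on (chart_map A i ` (UNIV \<inter> chart_dom A i)) (\<lambda>x. gt i (chart_inv A i x) u v)" for u v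
    using assms unfolding pseudo_riemannian_metric_def chart_smooth_def comp_def by blast
  fix x assume "x \<in> chart_map A i ` (UNIV \<inter> chart_dom A i)"
  then have p: "chart_inv A i x \<in> chart_dom A i"
    using inv_map by auto
  show "bilinear (gt i (chart_inv A i x))"
    using assms p unfolding pseudo_riemannian_metric_def by blast
  show "gt i (chart_inv A i x) (raise gt i (chart_inv A i x) a) v = a \<bullet> v" for a v
    by (rule metric_raise[OF assms p])
  show "u = 0" if "\<And>v. gt i (chart_inv A i x) u v = 0" for u
    using assms p that unfolding pseudo_riemannian_metric_def by blast
qed

lemma cotensor2_cometric:
  assumes "pseudo_riemannian_metric A gt"
  shows "cotensor2 A (cometric gt)"
  unfolding cotensor2_def
proof (intro conjI allI ballI)
  fix i a b
  show "chart_smooth A UNIV i (\<lambda>p. cometric gt i p a b)"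
  proof (rule chart_smooth_cong)
    show "chart_smooth A UNIV i (\<lambda>p. a \<bullet> raise gt i p b)"
      by (intro chart_smooth_inner chart_smooth_const chart_smooth_raise assms open_UNIV)
  qed (simp_all add: cometric_inner[OF assms])
next
  fix i p assume "p \<in> chart_dom A i"
  then show "bilinear (cometric gt i p)"
    by (rule cometric_bilinear[OF assms])
next
  fix i j p a b
  assume "p \<in> chart_dom A i \<inter> chart_dom A j"
  then have p: "p \<in> chart_dom A i" "p \<in> chart_dom A j"
    by auto
  define T where "T = chart_deriv A i (chart_map A j) p"
  have lin: "linear T"
    unfolding T_def using transition_has_derivative[OF manifold p] by (rule has_derivative_linear)
  have gT: "gt i p u v = gt j p (T u) (T v)" for u v
    using assms p unfolding pseudo_riemannian_metric_def T_def by blast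
  \<comment> \<open>Nondegeneracy of the metric in chart \<open>i\<close> makes the Jacobian
    injective, hence onto.\<close>
  have "u = 0" if "T u = 0" for u
  proof -
    have "bilinear (gt j p)"
      using assms p unfolding pseudo_riemannian_metric_def by blast
    then have "gt i p u v = 0" for v
      by (simp add: gT that bilinear_lzero)
    then show ?thesis
      using assms p unfolding pseudo_riemannian_metric_def by blast
  qed
  then have surj: "surj T"
    using lin linear_injective_0 linear_injective_imp_surjective by blast
  \<comment> \<open>Every test vector is some \<open>T w\<close>, and \<open>T\<close> is an
    isometry between the two representations of the metric. So the image of the vector raised in
    chart \<open>i\<close> has the property that defines \<open>raise gt j p b\<close>.\<close>
  have "gt j p (T (raise gt i p (adjoint T b))) v = b \<bullet> v" for v
  proof -
    obtain w where w: "v = T w"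
      using surj by (metis surj_def)
    show ?thesis
      unfolding w gT[symmetric] metric_raise[OF assms p(1)]
      by (simp add: adjoint_works[OF lin] inner_commute)
  qed
  moreover have "\<exists>!u. \<forall>v. gt j p u v = b \<bullet> v"
    using assms p unfolding pseudo_riemannian_metric_def
    by (intro nondegenerate_representation bounded_linear.linear[OF bounded_linear_inner_right]) blast+
  ultimately have "T (raise gt i p (adjoint T b)) = raise gt j p b"
    using metric_raise[OF assms p(2), of b] by blast
  then show "cometric gt j p a b = cometric gt i p
      (adjoint (chart_deriv A i (chart_map A j) p) a) (adjoint (chart_deriv A i (chart_map A j) p) b)"
    unfolding cometric_inner[OF assms p(1)] cometric_inner[OF assms p(2)] T_def[symmetric]
    by (simp add: adjoint_works[OF lin] inner_commute[of "adjoint T a"] inner_commute[of a])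
qed

end

text \<open>Pairwise orthogonal vectors with nonzero squares are independent, and
  \<open>DIM('a)\<close> of them span, also for an indefinite form. The coefficients come from
  pairing with \<open>v k\<close>, where the sign is its own inverse.\<close>

lemma orthonormal_expansion:
  fixes B :: "'a::euclidean_space \<Rightarrow> 'a \<Rightarrow> real" and v :: "nat \<Rightarrow> 'a"
  assumes bil: "bilinear B"
    and norm: "\<And>k. k < DIM('a) \<Longrightarrow> B (v k) (v k) \<in> {1, - 1}"
    and orth: "\<And>k l. k < DIM('a) \<Longrightarrow> l < DIM('a) \<Longrightarrow> k \<noteq> l \<Longrightarrow> B (v k) (v l) = 0"
  shows "a = (\<Sum>k<DIM('a). (B (v k) (v k) * B a (v k)) *\<^sub>R v k)"
proof -
  let ?n = "DIM('a)"
  let ?S = "v ` {..<?n}"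
  have inj: "inj_on v {..<?n}"
  proof (rule inj_onI)
    fix k l assume "k \<in> {..<?n}" "l \<in> {..<?n}" "v k = v l"
    then show "k = l"
      using orth[of k l] norm[of k] by (cases "k = l") auto
  qed
  have coeff: "B (\<Sum>k<?n. c k *\<^sub>R v k) (v l) = c l * B (v l) (v l)" if "l < ?n" for c l
  proof -
    have "B (\<Sum>k<?n. c k *\<^sub>R v k) (v l) = (\<Sum>k<?n. c k * B (v k) (v l))"
      by (rule bilinear_left_sum[OF bil])
    also have "\<dots> = (\<Sum>k<?n. if k = l then c l * B (v l) (v l) else 0)"
      using orth that by (intro sum.cong) auto
    finally show ?thesis
      using that by simp
  qed
  have "independent ?S"
  proof
    assume "dependent ?S"
    then obtain u where u: "\<exists>w\<in>?S. u w \<noteq> 0" "(\<Sum>w\<in>?S. u w *\<^sub>R w) = 0"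
      using dependent_finite[of ?S] by auto
    then obtain l where l: "l < ?n" "u (v l) \<noteq> 0"
      by auto
    have "(\<Sum>k<?n. u (v k) *\<^sub>R v k) = 0"
      using u(2) by (simp add: sum.reindex[OF inj])
    then have "u (v l) * B (v l) (v l) = 0"
      using coeff[OF l(1), of "\<lambda>k. u (v k)"] by (simp add: bilinear_lzero[OF bil])
    then show False
      using l norm[of l] by auto
  qed
  moreover have "card ?S = dim (UNIV :: 'a set)"
    by (simp add: card_image[OF inj])
  ultimately have "a \<in> span ?S"
    using card_eq_dim[of ?S UNIV] by auto
  then obtain u where "a = (\<Sum>w\<in>?S. u w *\<^sub>R w)"
    using span_finite[of ?S] by auto
  then have a: "a = (\<Sum>k<?n. u (v k) *\<^sub>R v k)"
    by (simp add: sum.reindex[OF inj])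
  have "B (v k) (v k) * B a (v k) = u (v k)" if "k < ?n" for k
    using coeff[OF that, of "\<lambda>k. u (v k)"] norm[OF that] by (subst a) auto
  then show ?thesis
    by (subst (1) a) simp
qed

text \<open>The assumptions on \<open>g\<close> and \<open>P\<close> are stated on covectors, so
  that the warped fields on the product satisfy them directly, without a metric on tangent vectors.
  Nondegeneracy of \<open>g\<close> over \<open>U\<close> is recovered from the frame in
  \<open>covector_eqI\<close>.\<close>

locale contravariant_frame = smooth_atlas A
  for A :: "('i, 'm::{t2_space, second_countable_topology}, 'a::euclidean_space) atlas" +
  fixes g P :: "('i, 'm, 'a) field2"
    and D :: "('i, 'm, 'a) field \<Rightarrow> ('i, 'm, 'a) field \<Rightarrow> ('i, 'm, 'a) field"
    and U :: "'m set" and e :: "nat \<Rightarrow> ('i, 'm, 'a) field"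
  assumes g: "cotensor2 A g" and P: "cotensor2 A P"
    and g_sym: "\<And>i p a b. p \<in> chart_dom A i \<Longrightarrow> g i p a b = g i p b a"
    and P_skew: "\<And>i p a b. p \<in> chart_dom A i \<Longrightarrow> P i p a b = - P i p b a"
    and levi_civita: "levi_civita_connection A g P D"
    and open_U: "open U" and frame: "orthonormal_frame A g U e"
begin

section \<open>Coefficients with respect to the frame\<close>

definition G :: "('i, 'm, 'a) field \<Rightarrow> ('i, 'm, 'a) field \<Rightarrow> 'm \<Rightarrow> real" where
  "G = field2_eval A g"

definition eps :: "nat \<Rightarrow> 'm \<Rightarrow> real" where
  "eps k = G (e k) (e k)"

definition along :: "nat \<Rightarrow> ('m \<Rightarrow> real) \<Rightarrow> 'm \<Rightarrow> real" where
  "along k = derive_along A (anchor P (e k))"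

definition Gam :: "nat \<Rightarrow> nat \<Rightarrow> nat \<Rightarrow> 'm \<Rightarrow> real" where
  "Gam a b c = G (D (e a) (e b)) (e c)"

definition Br :: "nat \<Rightarrow> nat \<Rightarrow> nat \<Rightarrow> 'm \<Rightarrow> real" where
  "Br a b c = G (koszul_bracket A P (e a) (e b)) (e c)"

lemma e_form: "k < DIM('a) \<Longrightarrow> V \<subseteq> U \<Longrightarrow> one_form A V (e k)"
  using frame one_form_subset unfolding orthonormal_frame_def by blast

lemma eps_cases: "p \<in> U \<Longrightarrow> k < DIM('a) \<Longrightarrow> eps k p = 1 \<or> eps k p = - 1"
  using frame unfolding orthonormal_frame_def eps_def G_def by blast

lemma eps_square: "p \<in> U \<Longrightarrow> k < DIM('a) \<Longrightarrow> eps k p * eps k p = 1"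
  using eps_cases[of p k] by auto

lemma G_orth: "p \<in> U \<Longrightarrow> k < DIM('a) \<Longrightarrow> l < DIM('a) \<Longrightarrow> k \<noteq> l \<Longrightarrow> G (e k) (e l) p = 0"
  using frame unfolding orthonormal_frame_def G_def by blast

lemma G_sym: "G \<alpha> \<beta> p = G \<beta> \<alpha> p"
  unfolding G_def field2_eval_def by (rule g_sym[OF chart_at_dom])

lemma g_frame_chart:
  assumes "p \<in> U" "p \<in> chart_dom A i" "k < DIM('a)" "l < DIM('a)"
  shows "g i p (e k i p) (e l i p) = G (e k) (e l) p"
  unfolding G_def
  using field2_eval_chart[OF g e_form[OF assms(3) subset_refl] e_form[OF assms(4) subset_refl] assms(1,1,2)] ..

lemma covector_expansion:
  assumes "p \<in> U" "p \<in> chart_dom A i"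
  shows "a = (\<Sum>k<DIM('a). (eps k p * g i p a (e k i p)) *\<^sub>R e k i p)"
proof -
  have "a = (\<Sum>k<DIM('a). (g i p (e k i p) (e k i p) * g i p a (e k i p)) *\<^sub>R e k i p)"
    using eps_cases[OF assms(1)] G_orth[OF assms(1)]
    by (intro orthonormal_expansion cotensor2_bilinear[OF g assms(2)])
      (auto simp: g_frame_chart[OF assms] simp flip: eps_def)
  then show ?thesis
    by (simp add: g_frame_chart[OF assms] eps_def)
qed

lemma covector_eqI:
  assumes "p \<in> U" "p \<in> chart_dom A i" "\<And>k. k < DIM('a) \<Longrightarrow> g i p a (e k i p) = g i p b (e k i p)"
  shows "a = b"
  by (subst covector_expansion[OF assms(1,2), of a], subst covector_expansion[OF assms(1,2), of b])
    (simp add: assms(3))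

lemma bilinear_parseval:
  assumes "p \<in> U" "p \<in> chart_dom A i" "bilinear B"
  shows "B a b = (\<Sum>k<DIM('a). eps k p * g i p a (e k i p) * B (e k i p) b)"
  by (subst covector_expansion[OF assms(1,2), of a]) (simp add: bilinear_left_sum[OF assms(3)])

lemma G_parseval:
  assumes "p \<in> U"
  shows "G \<alpha> \<beta> p = (\<Sum>k<DIM('a). eps k p * (G \<alpha> (e k) p * G \<beta> (e k) p))"
proof -
  let ?i = "chart_at A p"
  have "g ?i p (\<alpha> ?i p) (\<beta> ?i p) = (\<Sum>k<DIM('a). eps k p * g ?i p (\<alpha> ?i p) (e k ?i p) * g ?i p (e k ?i p) (\<beta> ?i p))"
    by (rule bilinear_parseval[OF assms chart_at_dom cotensor2_bilinear[OF g chart_at_dom]])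
  then show ?thesis
    unfolding G_def field2_eval_def g_sym[OF chart_at_dom, of p _ "\<beta> ?i p"] by (simp add: mult.assoc)
qed

section \<open>The axioms of the connection and locality in the first argument\<close>

lemma D_form:
  assumes "open V" "one_form A V \<alpha>" "one_form A V \<beta>"
  shows "one_form A V (D \<alpha> \<beta>)"
  using levi_civita[unfolded levi_civita_connection_def contravariant_connection_def, THEN conjunct1,
      THEN spec[of _ V], THEN mp, OF assms(1), THEN conjunct1]
    assms by blast

lemma D_add_left:
  assumes "open V" "one_form A V \<alpha>" "one_form A V \<beta>" "one_form A V \<gamma>"
  shows "field_eq_on A V (D (\<lambda>i p. \<alpha> i p + \<beta> i p) \<gamma>) (\<lambda>i p. D \<alpha> \<gamma> i p + D \<beta> \<gamma> i p)"
  using levi_civita[unfolded levi_civita_connection_def contravariant_connection_def, THEN conjunct1,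
      THEN spec[of _ V], THEN mp, OF assms(1), THEN conjunct2, THEN conjunct1]
    assms by blast

lemma D_scale_left:
  assumes "open V" "smooth_fun A V \<phi>" "one_form A V \<alpha>" "one_form A V \<beta>"
  shows "field_eq_on A V (D (scale_field \<phi> \<alpha>) \<beta>) (scale_field \<phi> (D \<alpha> \<beta>))"
  using levi_civita[unfolded levi_civita_connection_def contravariant_connection_def, THEN conjunct1,
      THEN spec[of _ V], THEN mp, OF assms(1), THEN conjunct2, THEN conjunct2]
    assms by blast

lemma D_scale_right:
  assumes "open V" "smooth_fun A V \<phi>" "one_form A V \<alpha>" "one_form A V \<beta>"
  shows "field_eq_on A V (D \<alpha> (scale_field \<phi> \<beta>))
    (\<lambda>i p. \<phi> p *\<^sub>R D \<alpha> \<beta> i p + derive_along A (anchor P \<alpha>) \<phi> p *\<^sub>R \<beta> i p)"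
  using levi_civita[unfolded levi_civita_connection_def contravariant_connection_def, THEN conjunct1,
      THEN spec[of _ V], THEN mp, OF assms(1), THEN conjunct2, THEN conjunct2]
    assms by blast

lemma metric_compatible:
  assumes "open V" "one_form A V \<alpha>" "one_form A V \<beta>" "one_form A V \<gamma>" "p \<in> V"
  shows "derive_along A (anchor P \<alpha>) (G \<beta> \<gamma>) p = G (D \<alpha> \<beta>) \<gamma> p + G \<beta> (D \<alpha> \<gamma>) p"
  using levi_civita[unfolded levi_civita_connection_def, THEN conjunct2, THEN spec[of _ V], THEN mp, OF assms(1), THEN conjunct1]
    assms unfolding G_def by blast

lemma torsion_free:
  assumes "open V" "one_form A V \<alpha>" "one_form A V \<beta>"
  shows "field_eq_on A V (\<lambda>i p. D \<alpha> \<beta> i p - D \<beta> \<alpha> i p) (koszul_bracket A P \<alpha> \<beta>)"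
  using levi_civita[unfolded levi_civita_connection_def, THEN conjunct2, THEN spec[of _ V], THEN mp, OF assms(1), THEN conjunct2]
    assms by blast

lemma koszul_form:
  assumes "open V" "one_form A V \<alpha>" "one_form A V \<beta>"
  shows "one_form A V (koszul_bracket A P \<alpha> \<beta>)"
  using one_form_cong[OF assms(1) one_form_diff torsion_free] D_form assms by blast

lemma G_add_left: "G (\<lambda>i p. \<alpha> i p + \<beta> i p) \<gamma> p = G \<alpha> \<gamma> p + G \<beta> \<gamma> p"
  unfolding G_def field2_eval_def by (rule bilinear_ladd[OF cotensor2_bilinear[OF g chart_at_dom]])

lemma G_diff_left: "G (\<lambda>i p. \<alpha> i p - \<beta> i p) \<gamma> p = G \<alpha> \<gamma> p - G \<beta> \<gamma> p"
  unfolding G_def field2_eval_def by (rule bilinear_lsub[OF cotensor2_bilinear[OF g chart_at_dom]])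

lemma G_sum_left: "G (\<lambda>i p. \<Sum>j\<in>J. c j p *\<^sub>R \<alpha> j i p) \<beta> p = (\<Sum>j\<in>J. c j p * G (\<alpha> j) \<beta> p)"
  unfolding G_def field2_eval_def by (rule bilinear_left_sum[OF cotensor2_bilinear[OF g chart_at_dom]])

lemma G_cong_left:
  assumes "field_eq_on A V \<alpha> \<beta>" "p \<in> V"
  shows "G \<alpha> \<gamma> p = G \<beta> \<gamma> p"
  unfolding G_def field2_eval_def by (simp add: field_eq_onD[OF assms chart_at_dom])

lemma smooth_G: "open V \<Longrightarrow> one_form A V \<alpha> \<Longrightarrow> one_form A V \<beta> \<Longrightarrow> smooth_fun A V (G \<alpha> \<beta>)"
  unfolding G_def by (rule smooth_fun_field2_eval[OF _ g])

lemma field_eqI: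
  assumes "V \<subseteq> U" "one_form A V \<alpha>" "one_form A V \<beta>"
    and "\<And>k p. k < DIM('a) \<Longrightarrow> p \<in> V \<Longrightarrow> G \<alpha> (e k) p = G \<beta> (e k) p"
  shows "field_eq_on A V \<alpha> \<beta>"
  unfolding field_eq_on_def
proof (intro allI ballI)
  fix i p assume "p \<in> V \<inter> chart_dom A i"
  then have p: "p \<in> U" "p \<in> V" "p \<in> chart_dom A i"
    using assms(1) by auto
  show "\<alpha> i p = \<beta> i p"
  proof (rule covector_eqI[OF p(1,3)])
    fix k assume k: "k < DIM('a)"
    show "g i p (\<alpha> i p) (e k i p) = g i p (\<beta> i p) (e k i p)"
      using assms(4)[OF k p(2)] unfolding G_def
      by (simp add: field2_eval_chart[OF g _ e_form[OF k subset_refl] p(2,1,3)] assms(2,3))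
  qed
qed

text \<open>Vanishing on an open set passes to the anchor, to the pairing with
  \<open>\<beta>\<close> and to all chart derivatives. The derivative of \<open>\<beta>\<close> that
  remains is taken in the direction 0, whence linearity is needed.\<close>

lemma koszul_bracket_null:
  assumes V: "open V" and \<delta>: "field_eq_on A V \<delta> (\<lambda>i p. 0)" and \<beta>: "one_form A V \<beta>"
    and p: "p \<in> V" "p \<in> chart_dom A i"
  shows "koszul_bracket A P \<delta> \<beta> i p = 0"
proof -
  have \<delta>0: "\<delta> j q = 0" if "q \<in> V" "q \<in> chart_dom A j" for j q
    using field_eq_onD[OF \<delta> that] .
  have anchor0: "anchor P \<delta> j q = 0" if "q \<in> V" "q \<in> chart_dom A j" for j q
    unfolding anchor_def \<delta>0[OF that] bilinear_lzero[OF cotensor2_bilinear[OF P that(2)]] by simp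
  have "chart_deriv A i (\<delta> i) p = (\<lambda>v. 0)" "chart_deriv A i (anchor P \<delta> i) p = (\<lambda>v. 0)"
    using chart_deriv_cong[OF V p, of "\<delta> i" "\<lambda>_. 0"] \<delta>0
      chart_deriv_cong[OF V p, of "anchor P \<delta> i" "\<lambda>_. 0"] anchor0
    by (simp_all add: chart_deriv_const)
  moreover have "chart_deriv A i (field2_eval A P \<delta> \<beta>) p = chart_deriv A i (\<lambda>q. 0) p"
    by (rule chart_deriv_cong[OF V p])
      (simp add: field2_eval_def \<delta>0 chart_at_dom bilinear_lzero[OF cotensor2_bilinear[OF P chart_at_dom]])
  moreover have "chart_deriv A i (\<beta> i) p 0 = 0"
    using linear_chart_deriv[OF V one_form_smooth[OF \<beta>] p] by (rule linear_0)
  ultimately show ?thesis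
    unfolding koszul_bracket_def lie_derivative_def differential_def
    by (simp add: \<delta>0[OF p] anchor0[OF p] chart_deriv_const)
qed

text \<open>
  The axioms do not say directly that \<open>D \<alpha> \<beta>\<close> is independent of the irrelevant values of
  \<open>\<alpha>\<close>. If \<open>\<delta>\<close> vanishes on \<open>V\<close>, then \<open>D \<beta> \<delta>\<close> does so by compatibility with the metric, and
  \<open>D \<delta> \<beta>\<close> by vanishing of the torsion.
\<close>

lemma D_null_left:
  assumes V: "open V" "V \<subseteq> U" and \<delta>: "one_form A V \<delta>" "field_eq_on A V \<delta> (\<lambda>i p. 0)"
    and \<beta>: "one_form A V \<beta>"
  shows "field_eq_on A V (D \<delta> \<beta>) (\<lambda>i p. 0)"
proof -
  have G0: "G \<delta> \<gamma> p = 0" if "p \<in> V" for \<gamma> p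
    using G_cong_left[OF \<delta>(2) that, of \<gamma>] G_sum_left[of "\<lambda>_ _. 0" _ "{}" \<gamma> p] by simp
  have z: "G (\<lambda>i p. 0) \<gamma> p = 0" for \<gamma> p
    using G_sum_left[of "\<lambda>_ _. 0" _ "{}" \<gamma> p] by simp
  have "G (D \<beta> \<delta>) (e k) p = 0" if k: "k < DIM('a)" and p: "p \<in> V" for k p
  proof -
    have "derive_along A (anchor P \<beta>) (G \<delta> (e k)) p = 0"
      using derive_along_cong[OF V(1) p, of "G \<delta> (e k)" "\<lambda>q. 0"] G0 by (simp add: derive_along_const)
    then show ?thesis
      using metric_compatible[OF V(1) \<beta> \<delta>(1) e_form[OF k V(2)] p] G0[OF p] by simp
  qed
  then have "field_eq_on A V (D \<beta> \<delta>) (\<lambda>i p. 0)"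
    by (intro field_eqI V D_form \<beta> \<delta> one_form_zero) (simp add: z)
  then show ?thesis
    using torsion_free[OF V(1) \<delta>(1) \<beta>] koszul_bracket_null[OF V(1) \<delta>(2) \<beta>]
    unfolding field_eq_on_def by simp
qed

lemma D_cong_left:
  assumes V: "open V" "V \<subseteq> U" and \<alpha>: "one_form A V \<alpha>" "field_eq_on A V \<alpha> \<alpha>'"
    and \<beta>: "one_form A V \<beta>"
  shows "field_eq_on A V (D \<alpha> \<beta>) (D \<alpha>' \<beta>)"
proof -
  let ?\<delta> = "\<lambda>i p. \<alpha>' i p - \<alpha> i p"
  have \<delta>: "one_form A V ?\<delta>"
    by (intro one_form_diff V one_form_cong[OF V(1) \<alpha>] \<alpha>(1))
  moreover have "field_eq_on A V ?\<delta> (\<lambda>i p. 0)"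
    using \<alpha>(2) unfolding field_eq_on_def by simp
  ultimately have "field_eq_on A V (D ?\<delta> \<beta>) (\<lambda>i p. 0)"
    by (intro D_null_left V \<beta>)
  \<comment> \<open>\<open>\<alpha>\<close> plus the difference is \<open>\<alpha>'\<close> as a
    function, at irrelevant charts and points too, so additivity applies literally.\<close>
  moreover have "field_eq_on A V (D \<alpha>' \<beta>) (\<lambda>i p. D \<alpha> \<beta> i p + D ?\<delta> \<beta> i p)"
    using D_add_left[OF V(1) \<alpha>(1) \<delta> \<beta>] by simp
  ultimately show ?thesis
    unfolding field_eq_on_def by simp
qed

lemma D_sum_left:
  assumes V: "open V" "V \<subseteq> U" and s: "\<And>j. j \<in> J \<Longrightarrow> smooth_fun A V (s j)"
    and \<alpha>: "\<And>j. j \<in> J \<Longrightarrow> one_form A V (\<alpha> j)" and \<beta>: "one_form A V \<beta>"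
  shows "field_eq_on A V (D (\<lambda>i p. \<Sum>j\<in>J. s j p *\<^sub>R \<alpha> j i p) \<beta>)
    (\<lambda>i p. \<Sum>j\<in>J. s j p *\<^sub>R D (\<alpha> j) \<beta> i p)"
  using s \<alpha>
proof (induction J rule: infinite_finite_induct)
  case (insert j J)
  let ?r = "\<lambda>i p. \<Sum>j\<in>J. s j p *\<^sub>R \<alpha> j i p"
  have r: "one_form A V ?r"
    using one_form_sum[OF V(1), of J "\<lambda>j. scale_field (s j) (\<alpha> j)"] one_form_scale[OF V(1)] insert.prems
    by (simp add: scale_field_def)
  have "field_eq_on A V (D (\<lambda>i p. scale_field (s j) (\<alpha> j) i p + ?r i p) \<beta>)
      (\<lambda>i p. D (scale_field (s j) (\<alpha> j)) \<beta> i p + D ?r \<beta> i p)"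
    using insert.prems by (intro D_add_left one_form_scale V r \<beta>) auto
  moreover have "field_eq_on A V (D (scale_field (s j) (\<alpha> j)) \<beta>) (scale_field (s j) (D (\<alpha> j) \<beta>))"
    using insert.prems by (intro D_scale_left V \<beta>) auto
  moreover have "(\<lambda>i p. scale_field (s j) (\<alpha> j) i p + ?r i p) = (\<lambda>i p. \<Sum>j\<in>insert j J. s j p *\<^sub>R \<alpha> j i p)"
    using insert.hyps by (simp add: scale_field_def)
  ultimately show ?case
    using insert unfolding field_eq_on_def by (simp add: scale_field_def)
\<comment> \<open>The empty sum is the zero form, which \<open>D_null_left\<close> handles.\<close>
qed (use D_null_left[OF V one_form_zero _ \<beta>] V in \<open>simp_all add: field_eq_on_def\<close>)

lemma form_expansion:
  assumes "V \<subseteq> U" "one_form A V \<alpha>"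
  shows "field_eq_on A V \<alpha> (\<lambda>i p. \<Sum>k<DIM('a). (eps k p * G \<alpha> (e k) p) *\<^sub>R e k i p)"
  unfolding field_eq_on_def
proof (intro allI ballI)
  fix i p assume "p \<in> V \<inter> chart_dom A i"
  then have p: "p \<in> U" "p \<in> V" "p \<in> chart_dom A i"
    using assms(1) by auto
  show "\<alpha> i p = (\<Sum>k<DIM('a). (eps k p * G \<alpha> (e k) p) *\<^sub>R e k i p)"
    by (subst covector_expansion[OF p(1,3)])
      (simp add: G_def field2_eval_chart[OF g assms(2) e_form[OF _ subset_refl] p(2,1,3)])
qed

lemma smooth_eps: "V \<subseteq> U \<Longrightarrow> open V \<Longrightarrow> k < DIM('a) \<Longrightarrow> smooth_fun A V (eps k)"
  unfolding eps_def by (intro smooth_G e_form)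

text \<open>Tensoriality in the first argument. It is needed for \<open>D\<close> along a bracket of
  frame forms, known only through its components, and for the endomorphism whose trace is
  \<open>triangle_op\<close>.\<close>

lemma D_expansion:
  assumes V: "open V" "V \<subseteq> U" and "one_form A V \<alpha>" "one_form A V \<beta>"
  shows "field_eq_on A V (D \<alpha> \<beta>)
    (\<lambda>i p. \<Sum>k<DIM('a). (eps k p * G \<alpha> (e k) p) *\<^sub>R D (e k) \<beta> i p)"
proof -
  have "field_eq_on A V (D \<alpha> \<beta>)
      (D (\<lambda>i p. \<Sum>k<DIM('a). (eps k p * G \<alpha> (e k) p) *\<^sub>R e k i p) \<beta>)"
    by (intro D_cong_left form_expansion assms)
  moreover have "field_eq_on A V
      (D (\<lambda>i p. \<Sum>k<DIM('a). (eps k p * G \<alpha> (e k) p) *\<^sub>R e k i p) \<beta>)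
      (\<lambda>i p. \<Sum>k<DIM('a). (eps k p * G \<alpha> (e k) p) *\<^sub>R D (e k) \<beta> i p)"
    by (intro D_sum_left smooth_fun_mult smooth_eps smooth_G e_form assms) auto
  ultimately show ?thesis
    unfolding field_eq_on_def by simp
qed

text \<open>The sign is a smooth function of square 1; differentiating the square shows that it is
  locally constant without an argument about connected components.\<close>

lemma along_eps:
  assumes "p \<in> U" "k < DIM('a)"
  shows "derive_along A X (eps k) p = 0"
proof -
  have "derive_along A X (\<lambda>q. eps k q * eps k q) p = derive_along A X (\<lambda>q. 1) p"
    using eps_square assms(2) by (intro derive_along_cong[OF open_U assms(1)]) auto
  then have "2 * (eps k p * derive_along A X (eps k) p) = 0"
    using derive_along_mult[OF open_U smooth_eps smooth_eps, of k k p X] open_U assms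
    by (simp add: derive_along_const)
  then show ?thesis
    using eps_cases[OF assms] by auto
qed

section \<open>Connection coefficients and curvature\<close>

lemma smooth_Gam:
  assumes "a < DIM('a)" "b < DIM('a)" "c < DIM('a)"
  shows "smooth_fun A U (Gam a b c)"
  unfolding Gam_def by (intro smooth_G D_form e_form assms open_U subset_refl)

lemma Gam_skew:
  assumes "p \<in> U" "a < DIM('a)" "b < DIM('a)" "c < DIM('a)"
  shows "Gam a b c p = - Gam a c b p"
proof -
  have "derive_along A (anchor P (e a)) (G (e b) (e c)) p = 0"
  proof (cases "b = c")
    case True
    then show ?thesis
      using along_eps[OF assms(1,3)] by (simp add: eps_def)
  next
    case False
    then show ?thesis
      using derive_along_cong[OF open_U assms(1), of "G (e b) (e c)" "\<lambda>q. 0"] G_orth assms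
      by (simp add: derive_along_const)
  qed
  then show ?thesis
    using metric_compatible[OF open_U e_form[OF assms(2)] e_form[OF assms(3)] e_form[OF assms(4)] assms(1)]
    by (simp add: Gam_def G_sym[of "e b"])
qed

lemma Gam_torsion:
  assumes "p \<in> U" "a < DIM('a)" "b < DIM('a)"
  shows "Gam a b c p - Gam b a c p = Br a b c p"
  unfolding Gam_def Br_def G_diff_left[symmetric]
  using G_cong_left[OF torsion_free[OF open_U e_form[OF assms(2)] e_form[OF assms(3)]] assms(1)] by simp

text \<open>Three torsion identities, cyclic in the indices, and three skew-symmetries determine the
  six coefficients with indices \<open>a\<close>, \<open>b\<close>, \<open>c\<close>. This is
  uniqueness of the Levi-Civita connection in frame form.\<close>

lemma Gam_koszul:
  assumes "p \<in> U" "a < DIM('a)" "b < DIM('a)" "c < DIM('a)"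
  shows "Gam a b c p = (Br a b c p - Br b c a p + Br c a b p) / 2"
  using Gam_torsion[OF assms(1,2,3), of c] Gam_torsion[OF assms(1,3,4), of a]
    Gam_torsion[OF assms(1,4,2), of b] Gam_skew[OF assms(1,2,3,4)]
    Gam_skew[OF assms(1,3,4,2)] Gam_skew[OF assms(1,4,2,3)]
  by (simp add: field_simps)

text \<open>The numerator of the contravariant sectional curvature of the plane spanned by
  \<open>e a\<close> and \<open>e b\<close>, see \<open>curvature_Sec\<close>.\<close>

definition Sec :: "nat \<Rightarrow> nat \<Rightarrow> 'm \<Rightarrow> real" where
  "Sec a b p = along a (Gam b b a) p - along b (Gam a b a) p
     + (\<Sum>c<DIM('a). eps c p * (Gam a b c p * Gam b a c p - Gam b b c p * Gam a a c p
         - Br a b c p * Gam c b a p))"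

lemma curvature_Sec:
  assumes "p \<in> U" "a < DIM('a)" "b < DIM('a)"
  shows "G (curvature A P D (e a) (e b) (e b)) (e a) p = Sec a b p"
proof -
  note ea = e_form[OF assms(2) subset_refl] and eb = e_form[OF assms(3) subset_refl]
  note form = D_form[OF open_U] koszul_form[OF open_U]
  \<comment> \<open>Compatibility with the metric moves the outer derivative from
    \<open>\<beta>\<close> to \<open>e l\<close>. Thus \<open>\<beta>\<close>, itself a covariant
    derivative in the applications, enters only through its frame components.\<close>
  have DD: "G (D (e k) \<beta>) (e l) p = along k (G \<beta> (e l)) p
      - (\<Sum>c<DIM('a). eps c p * (G \<beta> (e c) p * Gam k l c p))"
    if "one_form A U \<beta>" "k < DIM('a)" "l < DIM('a)" for \<beta> k l
    using metric_compatible[OF open_U e_form[OF that(2)] that(1) e_form[OF that(3)] assms(1)]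
      G_parseval[OF assms(1), of \<beta> "D (e k) (e l)"]
    by (simp add: along_def Gam_def)
  have "G (D (koszul_bracket A P (e a) (e b)) (e b)) (e a) p
      = (\<Sum>c<DIM('a). eps c p * (Br a b c p * Gam c b a p))"
    using G_cong_left[OF D_expansion[OF open_U subset_refl form(2)[OF ea eb] eb] assms(1), of "e a"]
    unfolding G_sum_left by (simp add: Br_def Gam_def mult.assoc)
  moreover have "G (D (e a) (D (e b) (e b))) (e a) p = along a (Gam b b a) p
      - (\<Sum>c<DIM('a). eps c p * (Gam b b c p * Gam a a c p))"
    using DD[OF form(1)[OF eb eb] assms(2,2)] by (simp add: Gam_def)
  moreover have "G (D (e b) (D (e a) (e b))) (e a) p = along b (Gam a b a) p
      - (\<Sum>c<DIM('a). eps c p * (Gam a b c p * Gam b a c p))"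
    using DD[OF form(1)[OF ea eb] assms(3,2)] by (simp add: Gam_def)
  ultimately show ?thesis
    unfolding curvature_def[abs_def] G_diff_left Sec_def
    by (simp add: right_diff_distrib sum_subtractf)
qed

lemma scalar_curvature_Sec:
  assumes "p \<in> U"
  shows "scalar_curvature A g P D e p = (\<Sum>a<DIM('a). \<Sum>b<DIM('a). eps a p * eps b p * Sec a b p)"
  unfolding scalar_curvature_def
  by (intro sum.cong refl) (simp add: curvature_Sec[OF assms, unfolded G_def] eps_def G_def)

section \<open>The endomorphism \<open>J\<close>, traces and \<open>triangle_op\<close> in the
  frame\<close>

lemma J_endo_unique:
  assumes "p \<in> U" "p \<in> chart_dom A i"
  shows "\<exists>!c. \<forall>b. g i p c b = P i p a b"
proof (rule nondegenerate_representation)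
  show "bilinear (g i p)"
    by (rule cotensor2_bilinear[OF g assms(2)])
  show "u = 0" if "\<And>v. g i p u v = 0" for u
    using covector_eqI[OF assms, of u 0] that bilinear_lzero[OF cotensor2_bilinear[OF g assms(2)]]
    by simp
  show "linear (P i p a)"
    using cotensor2_bilinear[OF P assms(2)] unfolding bilinear_def by blast
qed

lemma J_endo_inner:
  assumes "p \<in> U" "p \<in> chart_dom A i"
  shows "g i p (J_endo g P i p a) b = P i p a b"
  using theI'[OF J_endo_unique[OF assms, of a]] unfolding J_endo_def by blast

lemma linear_J_endo:
  assumes "p \<in> U" "p \<in> chart_dom A i"
  shows "linear (J_endo g P i p)"
proof -
  note bil = cotensor2_bilinear[OF g assms(2)] cotensor2_bilinear[OF P assms(2)]
  show ?thesis
    by (rule linearI; rule covector_eqI[OF assms])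
      (simp_all add: bil[THEN bilinear_ladd] bil[THEN bilinear_lmul] J_endo_inner[OF assms])
qed

text \<open>\<open>endo_trace\<close> refers to the Euclidean basis of a chart, which is unrelated
  to \<open>g\<close>. Each basis vector is expanded in the frame, and the order of summation is
  exchanged.\<close>

lemma endo_trace_frame:
  assumes "p \<in> U" "p \<in> chart_dom A i" "linear L"
  shows "endo_trace L = (\<Sum>k<DIM('a). eps k p * g i p (L (e k i p)) (e k i p))"
proof -
  note bil = cotensor2_bilinear[OF g assms(2)]
  have L: "L b \<bullet> b = (\<Sum>k<DIM('a). eps k p * ((L (e k i p) \<bullet> b) * g i p b (e k i p)))" for b
  proof -
    have "L b = L (\<Sum>k<DIM('a). (eps k p * g i p b (e k i p)) *\<^sub>R e k i p)"
      using covector_expansion[OF assms(1,2), of b] by simp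
    also have "\<dots> = (\<Sum>k<DIM('a). (eps k p * g i p b (e k i p)) *\<^sub>R L (e k i p))"
      by (simp add: linear_sum[OF assms(3)] linear_scale[OF assms(3)])
    finally show ?thesis
      by (simp add: inner_sum_left mult.assoc mult.commute[of _ "_ \<bullet> _"] mult.left_commute)
  qed
  have "endo_trace L = (\<Sum>k<DIM('a). eps k p * (\<Sum>b\<in>Basis. (L (e k i p) \<bullet> b) * g i p b (e k i p)))"
    unfolding endo_trace_def L by (subst sum.swap) (simp add: sum_distrib_left)
  then show ?thesis
    by (simp flip: bilinear_left_basis[OF bil])
qed

definition Bv :: "nat \<Rightarrow> nat \<Rightarrow> 'm \<Rightarrow> real" where
  "Bv k l = field2_eval A P (e k) (e l)"

lemma Bv_skew: "Bv k l p = - Bv l k p"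
  unfolding Bv_def field2_eval_def by (rule P_skew[OF chart_at_dom])

text \<open>Skewness of \<open>P\<close> makes the trace of the square of \<open>J\<close> minus a
  signed sum of squares, and the sign in the definition of \<open>J_norm_sq\<close> undoes
  this.\<close>

lemma J_norm_sq_frame:
  assumes p: "p \<in> U"
  shows "J_norm_sq A g P p
    = (\<Sum>k<DIM('a). \<Sum>l<DIM('a). eps k p * eps l p * (Bv k l p)\<^sup>2)"
proof -
  define i where "i = chart_at A p"
  have i: "p \<in> chart_dom A i"
    unfolding i_def by (rule chart_at_dom)
  let ?J = "J_endo g P i p"
  have Bv: "P i p (e k i p) (e l i p) = Bv k l p" for k l
    by (simp add: Bv_def field2_eval_def i_def)
  have "g i p (?J (?J (e k i p))) (e k i p) = - (\<Sum>l<DIM('a). eps l p * (Bv k l p)\<^sup>2)"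
    if k: "k < DIM('a)" for k
  proof -
    have "g i p (?J (?J (e k i p))) (e k i p) = P i p (?J (e k i p)) (e k i p)"
      by (rule J_endo_inner[OF p i])
    also have "\<dots> = (\<Sum>l<DIM('a). eps l p * g i p (?J (e k i p)) (e l i p) * P i p (e l i p) (e k i p))"
      by (rule bilinear_parseval[OF p i cotensor2_bilinear[OF P i]])
    also have "\<dots> = (\<Sum>l<DIM('a). eps l p * Bv k l p * Bv l k p)"
      by (simp add: J_endo_inner[OF p i] Bv)
    also have "\<dots> = (\<Sum>l<DIM('a). - (eps l p * (Bv k l p)\<^sup>2))"
      using Bv_skew[of _ k p] by (intro sum.cong) (simp_all add: power2_eq_square)
    finally show ?thesis
      by (simp add: sum_negf)
  qed
  then have "endo_trace (?J \<circ> ?J) = - (\<Sum>k<DIM('a). eps k p * (\<Sum>l<DIM('a). eps l p * (Bv k l p)\<^sup>2))"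
    by (subst endo_trace_frame[OF p i linear_compose[OF linear_J_endo[OF p i] linear_J_endo[OF p i]]])
      (simp add: sum_negf)
  then show ?thesis
    unfolding J_norm_sq_def i_def[symmetric] by (simp add: sum_distrib_left mult.assoc)
qed

definition Jd :: "('m \<Rightarrow> real) \<Rightarrow> ('i, 'm, 'a) field" where
  "Jd \<phi> = J_form g P (differential A \<phi>)"

lemma along_field2_eval:
  assumes "smooth_fun A U \<phi>" "p \<in> U"
  shows "along k \<phi> p = field2_eval A P (e k) (differential A \<phi>) p"
  unfolding along_def by (rule derive_along_eq[OF P open_U assms])

lemma smooth_along:
  assumes "smooth_fun A U \<phi>" "k < DIM('a)"
  shows "smooth_fun A U (along k \<phi>)"
proof (rule smooth_fun_cong[OF open_U])
  show "smooth_fun A U (field2_eval A P (e k) (differential A \<phi>))"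
    by (intro smooth_fun_field2_eval open_U P e_form one_form_differential assms subset_refl)
qed (rule along_field2_eval[OF assms(1), symmetric])

text \<open>The sign arises because \<open>J\<close> puts \<open>d\<phi>\<close> into the first slot
  of \<open>P\<close>, whereas differentiating \<open>\<phi>\<close> along the anchor of
  \<open>e k\<close> puts it into the second.\<close>

lemma Jd_frame_chart:
  assumes "smooth_fun A U \<phi>" "p \<in> U" "p \<in> chart_dom A i" "k < DIM('a)"
  shows "g i p (Jd \<phi> i p) (e k i p) = - along k \<phi> p"
proof -
  have "g i p (Jd \<phi> i p) (e k i p) = P i p (differential A \<phi> i p) (e k i p)"
    unfolding Jd_def J_form_def by (rule J_endo_inner[OF assms(2,3)])
  also have "\<dots> = - P i p (e k i p) (differential A \<phi> i p)"
    by (rule P_skew[OF assms(3)])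
  also have "P i p (e k i p) (differential A \<phi> i p) = along k \<phi> p"
    unfolding along_field2_eval[OF assms(1,2)]
    by (rule field2_eval_chart[OF P e_form[OF assms(4) subset_refl]
          one_form_differential[OF open_U assms(1)] assms(2,2,3), symmetric])
  finally show ?thesis .
qed

text \<open>Smoothness is hidden by the definite description in \<open>J_endo\<close>; it becomes
  visible in the frame expansion, whose coefficients are derivatives of \<open>\<phi>\<close> up to
  sign.\<close>

lemma Jd_form:
  assumes "smooth_fun A U \<phi>"
  shows "one_form A U (Jd \<phi>)"
proof (rule one_form_cong[OF open_U])
  have "one_form A U (scale_field (\<lambda>p. eps k p * ((- 1) * along k \<phi> p)) (e k))"
    if "k < DIM('a)" for k
    by (intro one_form_scale smooth_fun_mult smooth_fun_const smooth_eps smooth_along assms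
        e_form open_U subset_refl that)
  then show "one_form A U (\<lambda>i p. \<Sum>k<DIM('a). scale_field (\<lambda>p. eps k p * ((- 1) * along k \<phi> p)) (e k) i p)"
    by (intro one_form_sum open_U) auto
  have "Jd \<phi> i p = (\<Sum>k<DIM('a). (eps k p * (- along k \<phi> p)) *\<^sub>R e k i p)"
    if "p \<in> U" "p \<in> chart_dom A i" for i p
    by (subst covector_expansion[OF that]) (simp add: Jd_frame_chart[OF assms that])
  then show "field_eq_on A U (\<lambda>i p. \<Sum>k<DIM('a). scale_field (\<lambda>p. eps k p * ((- 1) * along k \<phi> p)) (e k) i p) (Jd \<phi>)"
    unfolding field_eq_on_def scale_field_def by simp
qed

lemma Jd_frame:
  assumes "smooth_fun A U \<phi>" "p \<in> U" "k < DIM('a)"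
  shows "G (Jd \<phi>) (e k) p = - along k \<phi> p"
  using Jd_frame_chart[OF assms(1,2) chart_at_dom assms(3)] by (simp add: G_def field2_eval_def)

lemma Jd_norm:
  assumes "smooth_fun A U \<phi>" "p \<in> U"
  shows "G (Jd \<phi>) (Jd \<phi>) p = (\<Sum>k<DIM('a). eps k p * (along k \<phi> p)\<^sup>2)"
  by (subst G_parseval[OF assms(2)]) (simp add: Jd_frame[OF assms] power2_eq_square)

text \<open>The description in \<open>connection_endo\<close> ranges over forms on arbitrary
  neighbourhoods of \<open>p\<close>. Existence is checked after restriction to the intersection
  with \<open>U\<close>, where \<open>D_expansion\<close> is available.\<close>

lemma connection_endo_frame:
  assumes p: "p \<in> U" "p \<in> chart_dom A i" and \<omega>: "one_form A U \<omega>"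
  shows "connection_endo A D \<omega> i p
    = (\<lambda>a. \<Sum>k<DIM('a). (eps k p * g i p a (e k i p)) *\<^sub>R D (e k) \<omega> i p)" (is "_ = ?E")
  unfolding connection_endo_def
proof (rule the_equality)
  note bil = cotensor2_bilinear[OF g p(2)]
  have lin: "linear ?E"
    by (rule linearI)
      (simp_all add: bilinear_ladd[OF bil] bilinear_lmul[OF bil] algebra_simps sum.distrib scaleR_sum_right)
  have E: "D \<alpha> \<omega> i p = ?E (\<alpha> i p)" if "open V" "p \<in> V" "one_form A V \<alpha>" for V \<alpha>
  proof -
    let ?V = "V \<inter> U"
    have V: "open ?V" "?V \<subseteq> U" "p \<in> ?V" and forms: "one_form A ?V \<alpha>" "one_form A ?V \<omega>"
      using that p open_U one_form_subset[OF that(3), of ?V] one_form_subset[OF \<omega>, of ?V] by auto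
    have "G \<alpha> (e k) p = g i p (\<alpha> i p) (e k i p)" if "k < DIM('a)" for k
      unfolding G_def
      by (rule field2_eval_chart[OF g forms(1) e_form[OF that subset_refl] V(3) p])
    then show ?thesis
      using field_eq_onD[OF D_expansion[OF V(1,2) forms] V(3) p(2)] by simp
  qed
  show "linear ?E \<and> (\<forall>V \<alpha>. open V \<and> p \<in> V \<and> one_form A V \<alpha> \<longrightarrow> D \<alpha> \<omega> i p = ?E (\<alpha> i p))"
    using lin E by blast
  fix F assume F: "linear F \<and> (\<forall>V \<alpha>. open V \<and> p \<in> V \<and> one_form A V \<alpha> \<longrightarrow> D \<alpha> \<omega> i p = F (\<alpha> i p))"
  show "F = ?E"
  proof
    fix a
    \<comment> \<open>For uniqueness, each covector \<open>a\<close> at \<open>p\<close> has to be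
      the value of some form near \<open>p\<close>: a combination of the frame with constant
      coefficients serves.\<close>
    define c where "c k = eps k p * g i p a (e k i p)" for k
    define \<alpha> where "\<alpha> = (\<lambda>j q. \<Sum>k<DIM('a). scale_field (\<lambda>_. c k) (e k) j q)"
    have \<alpha>: "one_form A U \<alpha>"
      unfolding \<alpha>_def by (intro one_form_sum one_form_scale smooth_fun_const e_form open_U) auto
    have "\<alpha> i p = a"
      using covector_expansion[OF p, of a] by (simp add: \<alpha>_def c_def scale_field_def)
    moreover have "D \<alpha> \<omega> i p = F (\<alpha> i p)"
      using conjunct2[OF F, THEN spec, THEN spec, THEN mp, OF conjI[OF open_U conjI[OF p(1) \<alpha>]]] .
    ultimately show "F a = ?E a"
      using E[OF open_U p(1) \<alpha>] by simp
  qed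
qed

text \<open>Up to the sign inherited from \<open>Jd_frame\<close>, this is the trace of the second
  contravariant derivative of \<open>\<phi>\<close>; the inner sum is the derivative of
  \<open>\<phi>\<close> along \<open>D (e k) (e k)\<close>.\<close>

lemma triangle_op_frame:
  assumes \<phi>: "smooth_fun A U \<phi>" and p: "p \<in> U"
  shows "triangle_op A g P D \<phi> p = - (\<Sum>k<DIM('a). eps k p *
    (along k (along k \<phi>) p - (\<Sum>c<DIM('a). eps c p * (along c \<phi> p * Gam k k c p))))"
proof -
  define i where "i = chart_at A p"
  have i: "p \<in> chart_dom A i"
    unfolding i_def by (rule chart_at_dom)
  note bil = cotensor2_bilinear[OF g i]
  have orth: "g i p (e l i p) (e k i p) = (if l = k then eps k p else 0)"
    if "k < DIM('a)" "l < DIM('a)" for k l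
    using that by (simp add: g_frame_chart[OF p i] G_orth[OF p] eps_def)
  have diag: "G (D (e k) (Jd \<phi>)) (e k) p =
      - (along k (along k \<phi>) p - (\<Sum>c<DIM('a). eps c p * (along c \<phi> p * Gam k k c p)))"
    if k: "k < DIM('a)" for k
  proof -
    note ek = e_form[OF k subset_refl]
    have "derive_along A (anchor P (e k)) (G (Jd \<phi>) (e k)) p
        = derive_along A (anchor P (e k)) (\<lambda>q. (- 1) * along k \<phi> q) p"
      using Jd_frame[OF \<phi> _ k] by (intro derive_along_cong[OF open_U p]) simp
    also have "\<dots> = - along k (along k \<phi>) p"
      using derive_along_mult[OF open_U smooth_fun_const[OF open_U] smooth_along[OF \<phi> k] p, of _ "-1"]
      by (simp add: derive_along_const along_def)
    finally have "derive_along A (anchor P (e k)) (G (Jd \<phi>) (e k)) p = - along k (along k \<phi>) p" .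
    moreover have "G (Jd \<phi>) (D (e k) (e k)) p = - (\<Sum>c<DIM('a). eps c p * (along c \<phi> p * Gam k k c p))"
      by (subst G_parseval[OF p]) (simp add: Jd_frame[OF \<phi> p] Gam_def flip: sum_negf)
    ultimately show ?thesis
      using metric_compatible[OF open_U ek Jd_form[OF \<phi>] ek p] by simp
  qed
  let ?E = "\<lambda>a. \<Sum>k<DIM('a). (eps k p * g i p a (e k i p)) *\<^sub>R D (e k) (Jd \<phi>) i p"
  have "linear ?E"
    by (rule linearI)
      (simp_all add: bilinear_ladd[OF bil] bilinear_lmul[OF bil] algebra_simps sum.distrib scaleR_sum_right)
  moreover have "?E (e l i p) = D (e l) (Jd \<phi>) i p" if l: "l < DIM('a)" for l
  proof -
    have "?E (e l i p) = (\<Sum>k<DIM('a). if k = l then D (e l) (Jd \<phi>) i p else 0)"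
      using l eps_square[OF p] by (intro sum.cong) (auto simp: orth)
    then show ?thesis
      using l by simp
  qed
  ultimately have "endo_trace ?E = (\<Sum>k<DIM('a). eps k p * G (D (e k) (Jd \<phi>)) (e k) p)"
    by (simp add: endo_trace_frame[OF p i] G_def field2_eval_def i_def)
  then show ?thesis
    unfolding triangle_op_def connection_endo_frame[OF p i Jd_form[OF \<phi>], unfolded i_def Jd_def]
    by (simp add: diag[unfolded Jd_def] i_def Jd_def right_diff_distrib flip: sum_negf)
qed

end

section \<open>Product manifolds\<close>

context smooth_atlas
begin

lemma chart_smooth_anchor:
  assumes "open V" "cotensor2 A P" "one_form A V \<alpha>"
  shows "chart_smooth A V i (anchor P \<alpha> i)"
proof -
  have "chart_smooth A V i (\<lambda>p. P i p c b)" for c b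
    using assms(2) chart_smooth_subset[of A UNIV i "\<lambda>p. P i p c b" V] unfolding cotensor2_def by blast
  then have "chart_smooth A V i (\<lambda>p. \<Sum>b\<in>Basis. (\<Sum>c\<in>Basis. (\<alpha> i p \<bullet> c) * P i p c b) *\<^sub>R b)"
    using one_form_smooth[OF assms(3)]
    by (intro chart_smooth_sum chart_smooth_scaleR chart_smooth_mult chart_smooth_const assms(1)
        chart_smooth_linear[OF _ bounded_linear_inner_left])
  then show ?thesis
  proof (rule chart_smooth_cong[OF assms(1)])
    fix p assume "p \<in> chart_dom A i"
    from cotensor2_bilinear[OF assms(2) this]
    show "(\<Sum>b\<in>Basis. (\<Sum>c\<in>Basis. (\<alpha> i p \<bullet> c) * P i p c b) *\<^sub>R b) = anchor P \<alpha> i p"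
      unfolding anchor_def by (simp flip: bilinear_left_basis)
  qed
qed

lemma lie_derivative_inner:
  assumes "open V" "chart_smooth A V i (X i)" "p \<in> V" "p \<in> chart_dom A i"
  shows "lie_derivative A X \<beta> i p \<bullet> v
    = chart_deriv A i (\<beta> i) p (X i p) \<bullet> v + \<beta> i p \<bullet> chart_deriv A i (X i) p v"
  unfolding lie_derivative_def
proof (rule linear_component_sum)
  note lin = linear_chart_deriv[OF assms]
  show "linear (\<lambda>v. chart_deriv A i (\<beta> i) p (X i p) \<bullet> v + \<beta> i p \<bullet> chart_deriv A i (X i) p v)"
    by (rule linearI) (simp_all add: linear_add[OF lin] linear_scale[OF lin] inner_add_right algebra_simps)
qed

text \<open>Paired with a vector, the bracket consists of chart derivatives only, and these split
  into two components on a product.\<close>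

lemma koszul_bracket_inner:
  assumes V: "open V" and P: "cotensor2 A P" and forms: "one_form A V \<alpha>" "one_form A V \<beta>"
    and p: "p \<in> V" "p \<in> chart_dom A i"
  shows "koszul_bracket A P \<alpha> \<beta> i p \<bullet> v =
    chart_deriv A i (\<beta> i) p (anchor P \<alpha> i p) \<bullet> v + \<beta> i p \<bullet> chart_deriv A i (anchor P \<alpha> i) p v
    - (chart_deriv A i (\<alpha> i) p (anchor P \<beta> i p) \<bullet> v + \<alpha> i p \<bullet> chart_deriv A i (anchor P \<beta> i) p v)
    - chart_deriv A i (field2_eval A P \<alpha> \<beta>) p v"
  unfolding koszul_bracket_def inner_diff_left
    differential_inner[OF V smooth_fun_field2_eval[OF V P forms] p]
    lie_derivative_inner[where X = "anchor P \<alpha>", OF V chart_smooth_anchor[OF V P forms(1)] p]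
    lie_derivative_inner[where X = "anchor P \<beta>", OF V chart_smooth_anchor[OF V P forms(2)] p] ..

end

locale product_atlas = M1: smooth_atlas A1 + M2: smooth_atlas A2
  for A1 :: "('i, 'm::{t2_space, second_countable_topology}, 'a::euclidean_space) atlas"
    and A2 :: "('j, 'n::{t2_space, second_countable_topology}, 'b::euclidean_space) atlas"
begin

abbreviation "PA \<equiv> prod_atlas A1 A2"

lemma prod_image:
  "chart_map PA (i, j) ` ((U \<times> V) \<inter> chart_dom PA (i, j))
    = (chart_map A1 i ` (U \<inter> chart_dom A1 i)) \<times> (chart_map A2 j ` (V \<inter> chart_dom A2 j))"
  by (force simp: prod_atlas_simps)

lemma inv_prod:
  assumes "x \<in> chart_map A1 i ` (U \<inter> chart_dom A1 i)" "y \<in> chart_map A2 j ` (V \<inter> chart_dom A2 j)"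
  shows "chart_inv PA (i, j) (x, y) = (chart_inv A1 i x, chart_inv A2 j y)"
  using assms by (intro chart_inv_prod M1.manifold M2.manifold) auto

lemma smooth_manifold_prod: "smooth_manifold PA"
  unfolding smooth_manifold_def
proof (intro conjI allI)
  show "(\<Union>k. chart_dom PA k) = UNIV"
  proof -
    have "(p, q) \<in> chart_dom PA (chart_at A1 p, chart_at A2 q)" for p q
      by (simp add: prod_atlas_simps M1.chart_at_dom M2.chart_at_dom)
    then show ?thesis
      by fastforce
  qed
next
  fix k :: "'i \<times> 'j"
  obtain i j where k: "k = (i, j)"
    by (cases k)
  note image = prod_image[of i j UNIV UNIV, simplified]
  show "open (chart_dom PA k)"
    unfolding k prod_atlas_simps by (intro open_Times M1.open_chart_dom M2.open_chart_dom)
  have open1: "open (chart_map A1 i ` chart_dom A1 i)" "open (chart_map A2 j ` chart_dom A2 j)"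
    using M1.manifold M2.manifold by (simp_all add: smooth_manifold_def)
  show "open (chart_map PA k ` chart_dom PA k)"
    unfolding k image by (intro open_Times open1)
  have hom: "homeomorphism (chart_dom A1 i) (chart_map A1 i ` chart_dom A1 i) (chart_map A1 i) (chart_inv A1 i)"
    "homeomorphism (chart_dom A2 j) (chart_map A2 j ` chart_dom A2 j) (chart_map A2 j) (chart_inv A2 j)"
    using M1.manifold M2.manifold by (simp_all add: smooth_manifold_def)
  show "homeomorphism (chart_dom PA k) (chart_map PA k ` chart_dom PA k) (chart_map PA k) (chart_inv PA k)"
    unfolding k image unfolding prod_atlas_simps
  proof (rule homeomorphismI)
    show "continuous_on (chart_dom A1 i \<times> chart_dom A2 j) (map_prod (chart_map A1 i) (chart_map A2 j))"
      unfolding map_prod_def using homeomorphism_cont1[OF hom(1)] homeomorphism_cont1[OF hom(2)]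
      by (auto simp: case_prod_beta intro!: continuous_on_Pair continuous_on_compose2[OF _ continuous_on_fst[OF continuous_on_id]]
          continuous_on_compose2[OF _ continuous_on_snd[OF continuous_on_id]])
    let ?W = "chart_map A1 i ` chart_dom A1 i \<times> chart_map A2 j ` chart_dom A2 j"
    have "continuous_on ?W (\<lambda>z. (chart_inv A1 i (fst z), chart_inv A2 j (snd z)))"
      using homeomorphism_cont2[OF hom(1)] homeomorphism_cont2[OF hom(2)]
      by (auto intro!: continuous_on_Pair continuous_on_compose2[OF _ continuous_on_fst[OF continuous_on_id]]
          continuous_on_compose2[OF _ continuous_on_snd[OF continuous_on_id]])
    then show "continuous_on ?W (chart_inv PA (i, j))"
      by (rule continuous_on_eq) (use inv_prod[of _ i UNIV _ j UNIV] in auto)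
    show "chart_inv PA (i, j) ` ?W \<subseteq> chart_dom A1 i \<times> chart_dom A2 j"
      using inv_prod[of _ i UNIV _ j UNIV] M1.inv_map M2.inv_map by auto
    show "chart_inv PA (i, j) (map_prod (chart_map A1 i) (chart_map A2 j) x) = x"
      if "x \<in> chart_dom A1 i \<times> chart_dom A2 j" for x
      using that inv_prod[of _ i UNIV _ j UNIV] M1.inv_map M2.inv_map by auto
    show "map_prod (chart_map A1 i) (chart_map A2 j) (chart_inv PA (i, j) y) = y" if "y \<in> ?W" for y
      using that inv_prod[of _ i UNIV _ j UNIV] M1.inv_map M2.inv_map by auto
  qed auto
next
  fix k k' :: "'i \<times> 'j"
  obtain i j i' j' where k: "k = (i, j)" "k' = (i', j')"
    by (cases k, cases k')
  let ?S1 = "chart_map A1 i ` (chart_dom A1 i' \<inter> chart_dom A1 i)"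
  let ?S2 = "chart_map A2 j ` (chart_dom A2 j' \<inter> chart_dom A2 j)"
  have S: "chart_map PA (i, j) ` (chart_dom PA (i, j) \<inter> chart_dom PA (i', j')) = ?S1 \<times> ?S2"
    unfolding prod_image[symmetric] prod_atlas_simps by (rule arg_cong[where f = "\<lambda>S. _ ` S"]) auto
  have op: "open ?S1" "open ?S2" "open (?S1 \<times> ?S2)"
    by (intro open_Times M1.open_image M1.open_chart_dom M2.open_image M2.open_chart_dom)+
  have sm: "smooth_on ?S1 (chart_map A1 i' \<circ> chart_inv A1 i)" "smooth_on ?S2 (chart_map A2 j' \<circ> chart_inv A2 j)"
    using M1.manifold M2.manifold unfolding smooth_manifold_def by (metis Int_commute)+
  have "smooth_on (?S1 \<times> ?S2) (\<lambda>z. ((chart_map A1 i' \<circ> chart_inv A1 i) (fst z),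
      (chart_map A2 j' \<circ> chart_inv A2 j) (snd z)))"
    by (intro smooth_on_Pair op smooth_on_compose[OF op(3) op(1) _ sm(1)]
        smooth_on_compose[OF op(3) op(2) _ sm(2)] smooth_on_fst smooth_on_snd) auto
  then show "smooth_on (chart_map PA k ` (chart_dom PA k \<inter> chart_dom PA k')) (chart_map PA k' \<circ> chart_inv PA k)"
    unfolding k S
  proof (rule smooth_on_cong[OF op(3), rotated])
    show "((chart_map A1 i' \<circ> chart_inv A1 i) (fst z), (chart_map A2 j' \<circ> chart_inv A2 j) (snd z)) =
        (chart_map PA (i', j') \<circ> chart_inv PA (i, j)) z" if "z \<in> ?S1 \<times> ?S2" for z
      using that inv_prod[of "fst z" i UNIV "snd z" j UNIV] by (cases z) (auto simp: prod_atlas_simps)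
  qed
qed

sublocale M: smooth_atlas PA
  by unfold_locales (rule smooth_manifold_prod)

section \<open>Smoothness, derivatives and lifts on the product\<close>

lemma chart_smooth_fst:
  assumes "open U" "open V" "chart_smooth A1 U i F"
  shows "chart_smooth PA (U \<times> V) (i, j) (\<lambda>z. F (fst z))"
  unfolding chart_smooth_def prod_image
proof (rule smooth_on_cong)
  note op = M1.open_image[OF assms(1), of i] M2.open_image[OF assms(2), of j]
  let ?W = "(chart_map A1 i ` (U \<inter> chart_dom A1 i)) \<times> (chart_map A2 j ` (V \<inter> chart_dom A2 j))"
  show W: "open ?W"
    by (intro open_Times op)
  show "smooth_on ?W (\<lambda>z. (F \<circ> chart_inv A1 i) (fst z))"
    using assms(3) unfolding chart_smooth_def
    by (intro smooth_on_compose[OF W op(1), of fst "F \<circ> chart_inv A1 i"] smooth_on_fst W) auto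
  show "(F \<circ> chart_inv A1 i) (fst z) = ((\<lambda>z. F (fst z)) \<circ> chart_inv PA (i, j)) z" if "z \<in> ?W" for z
    using that inv_prod[of "fst z" i U "snd z" j V] by (cases z) auto
qed

lemma chart_smooth_snd:
  assumes "open U" "open V" "chart_smooth A2 V j F"
  shows "chart_smooth PA (U \<times> V) (i, j) (\<lambda>z. F (snd z))"
  unfolding chart_smooth_def prod_image
proof (rule smooth_on_cong)
  note op = M1.open_image[OF assms(1), of i] M2.open_image[OF assms(2), of j]
  let ?W = "(chart_map A1 i ` (U \<inter> chart_dom A1 i)) \<times> (chart_map A2 j ` (V \<inter> chart_dom A2 j))"
  show W: "open ?W"
    by (intro open_Times op)
  show "smooth_on ?W (\<lambda>z. (F \<circ> chart_inv A2 j) (snd z))"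
    using assms(3) unfolding chart_smooth_def
    by (intro smooth_on_compose[OF W op(2), of snd "F \<circ> chart_inv A2 j"] smooth_on_snd W) auto
  show "(F \<circ> chart_inv A2 j) (snd z) = ((\<lambda>z. F (snd z)) \<circ> chart_inv PA (i, j)) z" if "z \<in> ?W" for z
    using that inv_prod[of "fst z" i U "snd z" j V] by (cases z) auto
qed

text \<open>Phrased with \<open>has_derivative\<close> because it serves smooth functions and the
  transition maps of the factors alike.\<close>

lemma has_derivative_fst_transform:
  assumes "(F \<circ> chart_inv A1 i has_derivative T) (at (chart_map A1 i p))"
    and "p \<in> chart_dom A1 i" "q \<in> chart_dom A2 j"
  shows "((\<lambda>z. F (fst z)) \<circ> chart_inv PA (i, j) has_derivative (\<lambda>w. T (fst w))) (at (chart_map PA (i, j) (p, q)))"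
proof -
  let ?x = "chart_map PA (i, j) (p, q)"
  let ?W = "chart_map A1 i ` (UNIV \<inter> chart_dom A1 i) \<times> chart_map A2 j ` (UNIV \<inter> chart_dom A2 j)"
  have "((\<lambda>z. (F \<circ> chart_inv A1 i) (fst z)) has_derivative (\<lambda>w. T (fst w))) (at ?x)"
    using assms(1)
    by (intro has_derivative_compose[OF has_derivative_fst[OF has_derivative_ident]])
      (simp only: prod_atlas_simps map_prod_simp prod.sel)
  moreover have "open ?W"
    by (intro open_Times M1.open_image M2.open_image open_UNIV)
  moreover have "?x \<in> ?W"
    using assms(2,3) by (auto simp: prod_atlas_simps)
  moreover have "(F \<circ> chart_inv A1 i) (fst z) = ((\<lambda>z. F (fst z)) \<circ> chart_inv PA (i, j)) z"
    if "z \<in> ?W" for z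
    using that inv_prod[of "fst z" i UNIV "snd z" j UNIV] by (cases z) auto
  ultimately show ?thesis
    by (rule has_derivative_transform_within_open)
qed

lemma has_derivative_snd_transform:
  assumes "(F \<circ> chart_inv A2 j has_derivative T) (at (chart_map A2 j q))"
    and "p \<in> chart_dom A1 i" "q \<in> chart_dom A2 j"
  shows "((\<lambda>z. F (snd z)) \<circ> chart_inv PA (i, j) has_derivative (\<lambda>w. T (snd w))) (at (chart_map PA (i, j) (p, q)))"
proof -
  let ?x = "chart_map PA (i, j) (p, q)"
  let ?W = "chart_map A1 i ` (UNIV \<inter> chart_dom A1 i) \<times> chart_map A2 j ` (UNIV \<inter> chart_dom A2 j)"
  have "((\<lambda>z. (F \<circ> chart_inv A2 j) (snd z)) has_derivative (\<lambda>w. T (snd w))) (at ?x)"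
    using assms(1)
    by (intro has_derivative_compose[OF has_derivative_snd[OF has_derivative_ident]])
      (simp only: prod_atlas_simps map_prod_simp prod.sel)
  moreover have "open ?W"
    by (intro open_Times M1.open_image M2.open_image open_UNIV)
  moreover have "?x \<in> ?W"
    using assms(2,3) by (auto simp: prod_atlas_simps)
  moreover have "(F \<circ> chart_inv A2 j) (snd z) = ((\<lambda>z. F (snd z)) \<circ> chart_inv PA (i, j)) z"
    if "z \<in> ?W" for z
    using that inv_prod[of "fst z" i UNIV "snd z" j UNIV] by (cases z) auto
  ultimately show ?thesis
    by (rule has_derivative_transform_within_open)
qed

lemma chart_deriv_fst:
  assumes "open U" "chart_smooth A1 U i F" "p \<in> U" "p \<in> chart_dom A1 i" "q \<in> chart_dom A2 j"
  shows "chart_deriv PA (i, j) (\<lambda>z. F (fst z)) (p, q) = (\<lambda>w. chart_deriv A1 i F p (fst w))"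
  by (intro chart_deriv_eqI has_derivative_fst_transform M1.has_derivative_chart_deriv[OF assms(1-4)] assms)

lemma chart_deriv_snd:
  assumes "open V" "chart_smooth A2 V j F" "q \<in> V" "p \<in> chart_dom A1 i" "q \<in> chart_dom A2 j"
  shows "chart_deriv PA (i, j) (\<lambda>z. F (snd z)) (p, q) = (\<lambda>w. chart_deriv A2 j F q (snd w))"
  by (intro chart_deriv_eqI has_derivative_snd_transform M2.has_derivative_chart_deriv[OF assms(1-3,5)] assms)

lemma chart_deriv_transition_prod:
  assumes "p \<in> chart_dom A1 i" "p \<in> chart_dom A1 i'" "q \<in> chart_dom A2 j" "q \<in> chart_dom A2 j'"
  shows "chart_deriv PA (i, j) (chart_map PA (i', j')) (p, q) w =
    (chart_deriv A1 i (chart_map A1 i') p (fst w), chart_deriv A2 j (chart_map A2 j') q (snd w))"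
proof -
  have "(chart_map PA (i', j') \<circ> chart_inv PA (i, j) has_derivative
      (\<lambda>w. (chart_deriv A1 i (chart_map A1 i') p (fst w), chart_deriv A2 j (chart_map A2 j') q (snd w))))
      (at (chart_map PA (i, j) (p, q)))"
    using has_derivative_Pair[OF
        has_derivative_fst_transform[OF transition_has_derivative[OF M1.manifold assms(1,2)] assms(1,3)]
        has_derivative_snd_transform[OF transition_has_derivative[OF M2.manifold assms(3,4)] assms(1,3)]]
    by (simp add: comp_def prod_atlas_simps map_prod_def case_prod_beta)
  then show ?thesis
    by (simp add: chart_deriv_eqI)
qed

lemma adjoint_transition_prod:
  assumes "p \<in> chart_dom A1 i" "p \<in> chart_dom A1 i'" "q \<in> chart_dom A2 j" "q \<in> chart_dom A2 j'"
  shows "adjoint (chart_deriv PA (i, j) (chart_map PA (i', j')) (p, q)) =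
    (\<lambda>a. (adjoint (chart_deriv A1 i (chart_map A1 i') p) (fst a), adjoint (chart_deriv A2 j (chart_map A2 j') q) (snd a)))"
  using adjoint_works[OF has_derivative_linear[OF transition_has_derivative[OF M1.manifold assms(1,2)]]]
    adjoint_works[OF has_derivative_linear[OF transition_has_derivative[OF M2.manifold assms(3,4)]]]
  by (intro adjoint_unique) (auto simp: chart_deriv_transition_prod[OF assms] inner_Pair inner_prod_def)

lemma one_form_lift_h:
  assumes "open U" "open V" "one_form A1 U \<alpha>"
  shows "one_form PA (U \<times> V) (lift_h A1 A2 \<alpha>)"
proof -
  note comp = lift_h_components[OF M1.manifold M2.manifold assms(3)]
  have UV: "open (U \<times> V)"
    by (intro open_Times assms)
  have "chart_smooth PA (U \<times> V) (i, j) (\<lambda>z. (\<alpha> i (fst z), 0))" for i j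
    by (rule M.chart_smooth_linear[OF UV, of "\<lambda>x. (x, 0)"])
      (intro bounded_linear_Pair bounded_linear_ident bounded_linear_zero
        chart_smooth_fst assms one_form_smooth)+
  then have "chart_smooth PA (U \<times> V) (i, j) (lift_h A1 A2 \<alpha> (i, j))" for i j
    by (rule M.chart_smooth_cong[OF UV]) (auto simp: prod_atlas_simps comp)
  moreover have "lift_h A1 A2 \<alpha> (i, j) (p, q) \<bullet> w
      = lift_h A1 A2 \<alpha> (i', j') (p, q) \<bullet> chart_deriv PA (i, j) (chart_map PA (i', j')) (p, q) w"
    if "p \<in> U" "q \<in> V" "p \<in> chart_dom A1 i" "p \<in> chart_dom A1 i'" "q \<in> chart_dom A2 j" "q \<in> chart_dom A2 j'"
    for i j i' j' p q w
    using one_form_transform[OF assms(3), of p i i' "fst w"] that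
    by (simp add: comp chart_deriv_transition_prod inner_prod_def)
  ultimately show ?thesis
    unfolding one_form_def by (auto simp: prod_atlas_simps)
qed

lemma one_form_lift_v:
  assumes "open U" "open V" "one_form A2 V \<alpha>"
  shows "one_form PA (U \<times> V) (lift_v A1 A2 \<alpha>)"
proof -
  note comp = lift_v_components[OF M1.manifold M2.manifold assms(3)]
  have UV: "open (U \<times> V)"
    by (intro open_Times assms)
  have "chart_smooth PA (U \<times> V) (i, j) (\<lambda>z. (0, \<alpha> j (snd z)))" for i j
    by (rule M.chart_smooth_linear[OF UV, of "\<lambda>x. (0, x)"])
      (intro bounded_linear_Pair bounded_linear_ident bounded_linear_zero
        chart_smooth_snd assms one_form_smooth)+
  then have "chart_smooth PA (U \<times> V) (i, j) (lift_v A1 A2 \<alpha> (i, j))" for i j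
    by (rule M.chart_smooth_cong[OF UV]) (auto simp: prod_atlas_simps comp)
  moreover have "lift_v A1 A2 \<alpha> (i, j) (p, q) \<bullet> w
      = lift_v A1 A2 \<alpha> (i', j') (p, q) \<bullet> chart_deriv PA (i, j) (chart_map PA (i', j')) (p, q) w"
    if "p \<in> U" "q \<in> V" "p \<in> chart_dom A1 i" "p \<in> chart_dom A1 i'" "q \<in> chart_dom A2 j" "q \<in> chart_dom A2 j'"
    for i j i' j' p q w
    using one_form_transform[OF assms(3), of q j j' "snd w"] that
    by (simp add: comp chart_deriv_transition_prod inner_prod_def)
  ultimately show ?thesis
    unfolding one_form_def by (auto simp: prod_atlas_simps)
qed

lemma smooth_fun_fst:
  assumes "open U" "open V" "smooth_fun A1 U \<phi>"
  shows "smooth_fun PA (U \<times> V) (\<lambda>z. \<phi> (fst z))"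
  using chart_smooth_fst[OF assms(1,2), of _ \<phi>] assms(3) unfolding smooth_fun_def by auto

lemma smooth_fun_snd:
  assumes "open U" "open V" "smooth_fun A2 V \<phi>"
  shows "smooth_fun PA (U \<times> V) (\<lambda>z. \<phi> (snd z))"
  using chart_smooth_snd[OF assms(1,2), of _ \<phi>] assms(3) unfolding smooth_fun_def by auto

lemma warped_Pair:
  "warped w t1 t2 (i, j) (p, q) (a1, a2) (b1, b2) = t1 i p a1 b1 + w p * t2 j q a2 b2"
  by (simp add: warped_def)

lemma cotensor2_warped:
  assumes t1: "cotensor2 A1 t1" and t2: "cotensor2 A2 t2" and w: "smooth_fun A1 UNIV w"
  shows "cotensor2 PA (warped w t1 t2)"
  unfolding cotensor2_def
proof (intro conjI allI ballI)
  fix k :: "'i \<times> 'j" and a b :: "'a \<times> 'b"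
  obtain i j a1 a2 b1 b2 where eqs: "k = (i, j)" "a = (a1, a2)" "b = (b1, b2)"
    by (cases k, cases a, cases b)
  have "chart_smooth PA (UNIV \<times> UNIV) (i, j) (\<lambda>z. t1 i (fst z) a1 b1 + w (fst z) * t2 j (snd z) a2 b2)"
    using t1 t2 w unfolding cotensor2_def smooth_fun_def
    by (intro M.chart_smooth_add M.chart_smooth_mult chart_smooth_fst chart_smooth_snd open_Times open_UNIV) auto
  then show "chart_smooth PA UNIV k (\<lambda>z. warped w t1 t2 k z a b)"
    unfolding eqs by (simp add: warped_def case_prod_beta)
next
  fix k z assume z: "z \<in> chart_dom PA k"
  obtain i j p q where eqs: "k = (i, j)" "z = (p, q)"
    by (cases k, cases z)
  then have bil: "bilinear (t1 i p)" "bilinear (t2 j q)"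
    using z cotensor2_bilinear[OF t1] cotensor2_bilinear[OF t2] by (auto simp: prod_atlas_simps)
  show "bilinear (warped w t1 t2 k z)"
    unfolding eqs bilinear_def
    by (auto intro!: linearI simp: warped_def bil[THEN bilinear_ladd] bil[THEN bilinear_lmul]
        bil[THEN bilinear_radd] bil[THEN bilinear_rmul] algebra_simps)
next
  fix k k' :: "'i \<times> 'j" and z and a b :: "'a \<times> 'b"
  assume z: "z \<in> chart_dom PA k \<inter> chart_dom PA k'"
  obtain i j i' j' p q a1 a2 b1 b2 where eqs: "k = (i, j)" "k' = (i', j')" "z = (p, q)" "a = (a1, a2)" "b = (b1, b2)"
    by (cases k, cases k', cases z, cases a, cases b)
  then have dom: "p \<in> chart_dom A1 i" "p \<in> chart_dom A1 i'" "q \<in> chart_dom A2 j" "q \<in> chart_dom A2 j'"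
    using z by (auto simp: prod_atlas_simps)
  then have "t1 i' p a1 b1 = t1 i p (adjoint (chart_deriv A1 i (chart_map A1 i') p) a1) (adjoint (chart_deriv A1 i (chart_map A1 i') p) b1)"
    "t2 j' q a2 b2 = t2 j q (adjoint (chart_deriv A2 j (chart_map A2 j') q) a2) (adjoint (chart_deriv A2 j (chart_map A2 j') q) b2)"
    using t1 t2 unfolding cotensor2_def by blast+
  then show "warped w t1 t2 k' z a b =
      warped w t1 t2 k z (adjoint (chart_deriv PA k (chart_map PA k') z) a) (adjoint (chart_deriv PA k (chart_map PA k') z) b)"
    unfolding eqs adjoint_transition_prod[OF dom] by (simp only: warped_Pair fst_conv snd_conv)
qed

end

section \<open>Brackets of lifted forms\<close>

context smooth_atlas
begin

lemma derive_along_chart: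
  assumes "open V" "cotensor2 A P" "one_form A V \<alpha>" "smooth_fun A V \<phi>" "p \<in> V" "p \<in> chart_dom A i"
  shows "chart_deriv A i \<phi> p (anchor P \<alpha> i p) = derive_along A (anchor P \<alpha>) \<phi> p"
proof -
  have "chart_deriv A i \<phi> p (anchor P \<alpha> i p) = anchor P \<alpha> i p \<bullet> differential A \<phi> i p"
    by (simp add: differential_inner[OF assms(1,4,5,6), symmetric] inner_commute)
  also have "\<dots> = P i p (\<alpha> i p) (differential A \<phi> i p)"
    by (rule anchor_inner[of P i p \<alpha>, OF cotensor2_bilinear[OF assms(2,6)]])
  also have "\<dots> = field2_eval A P \<alpha> (differential A \<phi>) p"
    by (rule field2_eval_chart[OF assms(2,3) one_form_differential[OF assms(1,4)] assms(5,5,6), symmetric])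
  also have "\<dots> = derive_along A (anchor P \<alpha>) \<phi> p"
    by (rule derive_along_eq[OF assms(2,1,4,5), symmetric])
  finally show ?thesis .
qed

end

text \<open>Anchors and brackets of lifts involve the bivector fields alone; metrics and connections
  join in \<open>warped_connection\<close>.\<close>

locale warped_product = product_atlas A1 A2
  for A1 :: "('i, 'm::{t2_space, second_countable_topology}, 'a::euclidean_space) atlas"
    and A2 :: "('j, 'n::{t2_space, second_countable_topology}, 'b::euclidean_space) atlas" +
  fixes P1 :: "('i, 'm, 'a) field2" and P2 :: "('j, 'n, 'b) field2" and \<mu> :: "'m \<Rightarrow> real"
    and U :: "'m set" and V :: "'n set"
  assumes P1: "cotensor2 A1 P1" and P2: "cotensor2 A2 P2"
    and P2_skew: "\<And>j q a b. q \<in> chart_dom A2 j \<Longrightarrow> P2 j q a b = - P2 j q b a"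
    and smooth_\<mu>: "smooth_fun A1 UNIV \<mu>" and open_U: "open U" and open_V: "open V"
begin

abbreviation "PP \<equiv> warped \<mu> P1 P2"

lemma open_UV: "open (U \<times> V)"
  by (intro open_Times open_U open_V)

lemma cotensor2_PP: "cotensor2 PA PP"
  by (intro cotensor2_warped P1 P2 smooth_\<mu>)

lemmas h_comp = lift_h_components[OF M1.manifold M2.manifold]
lemmas v_comp = lift_v_components[OF M1.manifold M2.manifold]
lemmas h_form = one_form_lift_h[OF open_U open_V]
lemmas v_form = one_form_lift_v[OF open_U open_V]

lemma in_dom: "p \<in> chart_dom A1 i \<Longrightarrow> q \<in> chart_dom A2 j \<Longrightarrow> (p, q) \<in> chart_dom PA (i, j)"
  by (simp add: prod_atlas_simps)

lemma chart_at_prod: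
  obtains i j where "chart_at PA (p, q) = (i, j)" "p \<in> chart_dom A1 i" "q \<in> chart_dom A2 j"
proof (cases "chart_at PA (p, q)")
  case (Pair i j)
  then show ?thesis
    using that M.chart_at_dom[of "(p, q)"] by (simp add: prod_atlas_simps)
qed

text \<open>The tensors and the weight are kept general so that the evaluations apply to the warped
  bivector field, with weight \<open>\<mu>\<close>, and to the warped cometric, with weight
  \<open>f\<close>.\<close>

context
  fixes t1 t2 :: _ and w :: "'m \<Rightarrow> real"
  assumes t: "cotensor2 A1 t1" "cotensor2 A2 t2"
begin

lemma eval_hh:
  assumes "one_form A1 U \<alpha>" "one_form A1 U \<beta>" "p \<in> U"
  shows "field2_eval PA (warped w t1 t2) (lift_h A1 A2 \<alpha>) (lift_h A1 A2 \<beta>) (p, q) = field2_eval A1 t1 \<alpha> \<beta> p"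
proof -
  obtain i j where ij: "chart_at PA (p, q) = (i, j)" "p \<in> chart_dom A1 i" "q \<in> chart_dom A2 j"
    by (rule chart_at_prod)
  show ?thesis
    unfolding field2_eval_def[of PA] ij(1) h_comp[OF assms(1,3) ij(2,3)] h_comp[OF assms(2,3) ij(2,3)] warped_Pair
    by (simp add: bilinear_lzero[OF cotensor2_bilinear[OF t(2) ij(3)]]
        M1.field2_eval_chart[OF t(1) assms(1,2,3,3) ij(2)])
qed

lemma eval_vv:
  assumes "one_form A2 V \<alpha>" "one_form A2 V \<beta>" "q \<in> V"
  shows "field2_eval PA (warped w t1 t2) (lift_v A1 A2 \<alpha>) (lift_v A1 A2 \<beta>) (p, q) = w p * field2_eval A2 t2 \<alpha> \<beta> q"
proof -
  obtain i j where ij: "chart_at PA (p, q) = (i, j)" "p \<in> chart_dom A1 i" "q \<in> chart_dom A2 j"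
    by (rule chart_at_prod)
  show ?thesis
    unfolding field2_eval_def[of PA] ij(1) v_comp[OF assms(1,3) ij(2,3)] v_comp[OF assms(2,3) ij(2,3)] warped_Pair
    by (simp add: bilinear_lzero[OF cotensor2_bilinear[OF t(1) ij(2)]]
        M2.field2_eval_chart[OF t(2) assms(1,2,3,3) ij(3)])
qed

lemma eval_hv:
  assumes "one_form A1 U \<alpha>" "one_form A2 V \<beta>" "p \<in> U" "q \<in> V"
  shows "field2_eval PA (warped w t1 t2) (lift_h A1 A2 \<alpha>) (lift_v A1 A2 \<beta>) (p, q) = 0"
    "field2_eval PA (warped w t1 t2) (lift_v A1 A2 \<beta>) (lift_h A1 A2 \<alpha>) (p, q) = 0"
proof -
  obtain i j where ij: "chart_at PA (p, q) = (i, j)" "p \<in> chart_dom A1 i" "q \<in> chart_dom A2 j"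
    by (rule chart_at_prod)
  note bil = cotensor2_bilinear[OF t(1) ij(2)] cotensor2_bilinear[OF t(2) ij(3)]
  show "field2_eval PA (warped w t1 t2) (lift_h A1 A2 \<alpha>) (lift_v A1 A2 \<beta>) (p, q) = 0"
    "field2_eval PA (warped w t1 t2) (lift_v A1 A2 \<beta>) (lift_h A1 A2 \<alpha>) (p, q) = 0"
    unfolding field2_eval_def[of PA] ij(1) h_comp[OF assms(1,3) ij(2,3)] v_comp[OF assms(2,4) ij(2,3)] warped_Pair
    by (simp_all add: bil[THEN bilinear_lzero] bil[THEN bilinear_rzero])
qed

end

section \<open>Anchors and brackets of lifted forms\<close>

lemma anchor_h:
  assumes "one_form A1 U \<alpha>" "p \<in> U" "p \<in> chart_dom A1 i" "q \<in> chart_dom A2 j"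
  shows "anchor PP (lift_h A1 A2 \<alpha>) (i, j) (p, q) = (anchor P1 \<alpha> i p, 0)"
proof (rule vector_eq_rdot[THEN iffD1], rule allI)
  fix v :: "'a \<times> 'b"
  obtain v1 v2 where v: "v = (v1, v2)"
    by (cases v)
  have "anchor PP (lift_h A1 A2 \<alpha>) (i, j) (p, q) \<bullet> v = PP (i, j) (p, q) (lift_h A1 A2 \<alpha> (i, j) (p, q)) v"
    by (rule anchor_inner[of PP, OF cotensor2_bilinear[OF cotensor2_PP in_dom[OF assms(3,4)]]])
  also have "\<dots> = P1 i p (\<alpha> i p) v1"
    unfolding h_comp[OF assms] v warped_Pair
    by (simp add: bilinear_lzero[OF cotensor2_bilinear[OF P2 assms(4)]])
  also have "\<dots> = (anchor P1 \<alpha> i p, 0) \<bullet> v"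
    by (simp add: v inner_Pair anchor_inner[of P1 i p \<alpha>, OF cotensor2_bilinear[OF P1 assms(3)]])
  finally show "anchor PP (lift_h A1 A2 \<alpha>) (i, j) (p, q) \<bullet> v = (anchor P1 \<alpha> i p, 0) \<bullet> v" .
qed

lemma anchor_v:
  assumes "one_form A2 V \<alpha>" "q \<in> V" "p \<in> chart_dom A1 i" "q \<in> chart_dom A2 j"
  shows "anchor PP (lift_v A1 A2 \<alpha>) (i, j) (p, q) = (0, \<mu> p *\<^sub>R anchor P2 \<alpha> j q)"
proof (rule vector_eq_rdot[THEN iffD1], rule allI)
  fix v :: "'a \<times> 'b"
  obtain v1 v2 where v: "v = (v1, v2)"
    by (cases v)
  have "anchor PP (lift_v A1 A2 \<alpha>) (i, j) (p, q) \<bullet> v = PP (i, j) (p, q) (lift_v A1 A2 \<alpha> (i, j) (p, q)) v"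
    by (rule anchor_inner[of PP, OF cotensor2_bilinear[OF cotensor2_PP in_dom[OF assms(3,4)]]])
  also have "\<dots> = \<mu> p * P2 j q (\<alpha> j q) v2"
    unfolding v_comp[OF assms] v warped_Pair
    by (simp add: bilinear_lzero[OF cotensor2_bilinear[OF P1 assms(3)]])
  also have "\<dots> = (0, \<mu> p *\<^sub>R anchor P2 \<alpha> j q) \<bullet> v"
    by (simp add: v inner_Pair anchor_inner[of P2 j q \<alpha>, OF cotensor2_bilinear[OF P2 assms(4)]])
  finally show "anchor PP (lift_v A1 A2 \<alpha>) (i, j) (p, q) \<bullet> v = (0, \<mu> p *\<^sub>R anchor P2 \<alpha> j q) \<bullet> v" .
qed

lemma chart_deriv_h:
  fixes F :: "'m \<Rightarrow> 'c::euclidean_space" and H :: "'m \<times> 'n \<Rightarrow> 'c \<times> 'd::euclidean_space"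
  assumes "chart_smooth A1 U i F" "p \<in> U" "q \<in> V" "p \<in> chart_dom A1 i" "q \<in> chart_dom A2 j"
    and H: "\<And>p q. p \<in> U \<Longrightarrow> q \<in> V \<Longrightarrow> p \<in> chart_dom A1 i \<Longrightarrow> q \<in> chart_dom A2 j \<Longrightarrow> H (p, q) = (F p, 0)"
  shows "chart_deriv PA (i, j) H (p, q) = (\<lambda>w. (chart_deriv A1 i F p (fst w), 0))"
proof -
  have "chart_deriv PA (i, j) H (p, q) = chart_deriv PA (i, j) (\<lambda>z. (F (fst z), 0)) (p, q)"
    using assms H by (intro M.chart_deriv_cong[OF open_UV]) (auto simp: prod_atlas_simps)
  also have "\<dots> = (\<lambda>w. (chart_deriv PA (i, j) (\<lambda>z. F (fst z)) (p, q) w, 0))"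
    using assms by (intro M.chart_deriv_linear[OF open_UV chart_smooth_fst[OF open_U open_V]]
        bounded_linear_Pair bounded_linear_ident bounded_linear_zero) (auto simp: prod_atlas_simps)
  finally show ?thesis
    unfolding chart_deriv_fst[OF open_U assms(1,2,4,5)] .
qed

text \<open>The weight \<open>s\<close> is 1 for a lifted form and \<open>\<mu>\<close> for its
  anchor. The term with the derivative of \<open>s\<close> is the source of every
  \<open>d\<mu>\<close> in the result.\<close>

lemma chart_deriv_v:
  fixes F :: "'n \<Rightarrow> 'd::euclidean_space" and H :: "'m \<times> 'n \<Rightarrow> 'c::euclidean_space \<times> 'd"
  assumes s: "chart_smooth A1 UNIV i s" and F: "chart_smooth A2 V j F"
    and "p \<in> U" "q \<in> V" "p \<in> chart_dom A1 i" "q \<in> chart_dom A2 j"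
    and H: "\<And>p q. p \<in> U \<Longrightarrow> q \<in> V \<Longrightarrow> p \<in> chart_dom A1 i \<Longrightarrow> q \<in> chart_dom A2 j \<Longrightarrow> H (p, q) = (0, s p *\<^sub>R F q)"
  shows "chart_deriv PA (i, j) H (p, q)
    = (\<lambda>w. (0, s p *\<^sub>R chart_deriv A2 j F q (snd w) + chart_deriv A1 i s p (fst w) *\<^sub>R F q))"
proof -
  have sU: "chart_smooth A1 U i s"
    using s by (rule chart_smooth_subset) simp
  note sF = chart_smooth_fst[OF open_U open_V sU, of j] chart_smooth_snd[OF open_U open_V F, of i]
  have z: "(p, q) \<in> U \<times> V" "(p, q) \<in> chart_dom PA (i, j)"
    using assms by (auto simp: prod_atlas_simps)
  have "chart_deriv PA (i, j) H (p, q) = chart_deriv PA (i, j) (\<lambda>z. (0, s (fst z) *\<^sub>R F (snd z))) (p, q)"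
    using H by (intro M.chart_deriv_cong[OF open_UV z]) (auto simp: prod_atlas_simps)
  also have "\<dots> = (\<lambda>w. (0, chart_deriv PA (i, j) (\<lambda>z. s (fst z) *\<^sub>R F (snd z)) (p, q) w))"
    by (intro M.chart_deriv_linear[OF open_UV M.chart_smooth_scaleR[OF open_UV sF] z]
        bounded_linear_Pair bounded_linear_ident bounded_linear_zero)
  also have "\<dots> = (\<lambda>w. (0, s p *\<^sub>R chart_deriv A2 j F q (snd w) + chart_deriv A1 i s p (fst w) *\<^sub>R F q))"
    unfolding M.chart_deriv_bilinear[OF open_UV sF z bounded_bilinear_scaleR]
      chart_deriv_fst[OF open_U sU assms(3,5,6)] chart_deriv_snd[OF open_V F assms(4-6)] by simp
  finally show ?thesis .
qed

lemma \<mu>_chart: "chart_smooth A1 UNIV i \<mu>"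
  using smooth_\<mu> by (simp add: smooth_fun_def)

lemma deriv_lift_h:
  assumes "one_form A1 U \<alpha>" "p \<in> U" "q \<in> V" "p \<in> chart_dom A1 i" "q \<in> chart_dom A2 j"
  shows "chart_deriv PA (i, j) (lift_h A1 A2 \<alpha> (i, j)) (p, q) = (\<lambda>w. (chart_deriv A1 i (\<alpha> i) p (fst w), 0))"
    and "chart_deriv PA (i, j) (anchor PP (lift_h A1 A2 \<alpha>) (i, j)) (p, q)
      = (\<lambda>w. (chart_deriv A1 i (anchor P1 \<alpha> i) p (fst w), 0))"
  by (rule chart_deriv_h[OF one_form_smooth[OF assms(1)] assms(2-5) h_comp[OF assms(1)]]; assumption)
    (rule chart_deriv_h[OF M1.chart_smooth_anchor[OF open_U P1 assms(1)] assms(2-5) anchor_h[OF assms(1)]]; assumption)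

lemma deriv_lift_v:
  assumes "one_form A2 V \<alpha>" "p \<in> U" "q \<in> V" "p \<in> chart_dom A1 i" "q \<in> chart_dom A2 j"
  shows "chart_deriv PA (i, j) (lift_v A1 A2 \<alpha> (i, j)) (p, q) = (\<lambda>w. (0, chart_deriv A2 j (\<alpha> j) q (snd w)))"
    and "chart_deriv PA (i, j) (anchor PP (lift_v A1 A2 \<alpha>) (i, j)) (p, q)
      = (\<lambda>w. (0, \<mu> p *\<^sub>R chart_deriv A2 j (anchor P2 \<alpha> j) q (snd w)
          + chart_deriv A1 i \<mu> p (fst w) *\<^sub>R anchor P2 \<alpha> j q))"
proof -
  have "lift_v A1 A2 \<alpha> (i, j) (p, q) = (0, 1 *\<^sub>R \<alpha> j q)"
    if "q \<in> V" "p \<in> chart_dom A1 i" "q \<in> chart_dom A2 j" for p q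
    using v_comp[OF assms(1) that] by simp
  then show "chart_deriv PA (i, j) (lift_v A1 A2 \<alpha> (i, j)) (p, q) = (\<lambda>w. (0, chart_deriv A2 j (\<alpha> j) q (snd w)))"
    using chart_deriv_v[OF M1.chart_smooth_const[OF open_UNIV, of i 1] one_form_smooth[OF assms(1)] assms(2-5),
        of "lift_v A1 A2 \<alpha> (i, j)"] by (simp add: M1.chart_deriv_const)
  show "chart_deriv PA (i, j) (anchor PP (lift_v A1 A2 \<alpha>) (i, j)) (p, q)
      = (\<lambda>w. (0, \<mu> p *\<^sub>R chart_deriv A2 j (anchor P2 \<alpha> j) q (snd w)
          + chart_deriv A1 i \<mu> p (fst w) *\<^sub>R anchor P2 \<alpha> j q))"
    by (rule chart_deriv_v[OF \<mu>_chart M2.chart_smooth_anchor[OF open_V P2 assms(1)] assms(2-5)])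
      (rule anchor_v[OF assms(1)])
qed

lemma koszul_hh:
  assumes "one_form A1 U \<alpha>" "one_form A1 U \<beta>"
    and pq: "p \<in> U" "q \<in> V" "p \<in> chart_dom A1 i" "q \<in> chart_dom A2 j"
  shows "koszul_bracket PA PP (lift_h A1 A2 \<alpha>) (lift_h A1 A2 \<beta>) (i, j) (p, q) = (koszul_bracket A1 P1 \<alpha> \<beta> i p, 0)"
proof (rule vector_eq_rdot[THEN iffD1], rule allI)
  fix v :: "'a \<times> 'b"
  have z: "(p, q) \<in> U \<times> V" "(p, q) \<in> chart_dom PA (i, j)"
    using pq by (auto simp: prod_atlas_simps)
  have "chart_deriv PA (i, j) (field2_eval PA PP (lift_h A1 A2 \<alpha>) (lift_h A1 A2 \<beta>)) (p, q)
      = chart_deriv PA (i, j) (\<lambda>z. field2_eval A1 P1 \<alpha> \<beta> (fst z)) (p, q)"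
    by (rule M.chart_deriv_cong[OF open_UV z]) (auto simp: eval_hh[OF P1 P2 assms(1,2)])
  also have "\<dots> = (\<lambda>w. chart_deriv A1 i (field2_eval A1 P1 \<alpha> \<beta>) p (fst w))"
    using M1.smooth_fun_field2_eval[OF open_U P1 assms(1,2)]
    by (intro chart_deriv_fst[OF open_U _ pq(1,3,4)]) (simp add: smooth_fun_def)
  finally have F: "chart_deriv PA (i, j) (field2_eval PA PP (lift_h A1 A2 \<alpha>) (lift_h A1 A2 \<beta>)) (p, q)
      = (\<lambda>w. chart_deriv A1 i (field2_eval A1 P1 \<alpha> \<beta>) p (fst w))" .
  show "koszul_bracket PA PP (lift_h A1 A2 \<alpha>) (lift_h A1 A2 \<beta>) (i, j) (p, q) \<bullet> v
      = (koszul_bracket A1 P1 \<alpha> \<beta> i p, 0) \<bullet> v"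
    unfolding M.koszul_bracket_inner[OF open_UV cotensor2_PP h_form[OF assms(1)] h_form[OF assms(2)] z] F
      deriv_lift_h[OF assms(1) pq] deriv_lift_h[OF assms(2) pq]
      anchor_h[OF assms(1) pq(1,3,4)] anchor_h[OF assms(2) pq(1,3,4)]
      h_comp[OF assms(1) pq(1,3,4)] h_comp[OF assms(2) pq(1,3,4)]
    by (simp add: inner_prod_def M1.koszul_bracket_inner[OF open_U P1 assms(1,2) pq(1,3)])
qed

text \<open>The anchor of the vertical lift carries \<open>\<mu>\<close> and has a nonzero
  horizontal derivative, but that derivative is a vertical vector, which the horizontal lift of
  \<open>\<alpha>\<close> annihilates.\<close>

lemma koszul_hv:
  assumes "one_form A1 U \<alpha>" "one_form A2 V \<beta>"
    and pq: "p \<in> U" "q \<in> V" "p \<in> chart_dom A1 i" "q \<in> chart_dom A2 j"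
  shows "koszul_bracket PA PP (lift_h A1 A2 \<alpha>) (lift_v A1 A2 \<beta>) (i, j) (p, q) = 0"
proof (rule vector_eq_rdot[THEN iffD1], rule allI)
  fix v :: "'a \<times> 'b"
  have z: "(p, q) \<in> U \<times> V" "(p, q) \<in> chart_dom PA (i, j)"
    using pq by (auto simp: prod_atlas_simps)
  have F: "chart_deriv PA (i, j) (field2_eval PA PP (lift_h A1 A2 \<alpha>) (lift_v A1 A2 \<beta>)) (p, q)
      = chart_deriv PA (i, j) (\<lambda>z. 0) (p, q)"
    by (rule M.chart_deriv_cong[OF open_UV z]) (auto simp: eval_hv[OF P1 P2 assms(1,2)])
  have zero: "chart_deriv A1 i (\<alpha> i) p 0 = 0" "chart_deriv A2 j (\<beta> j) q 0 = 0"
    using linear_0[OF M1.linear_chart_deriv[OF open_U one_form_smooth[OF assms(1)] pq(1,3)]]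
      linear_0[OF M2.linear_chart_deriv[OF open_V one_form_smooth[OF assms(2)] pq(2,4)]] by auto
  show "koszul_bracket PA PP (lift_h A1 A2 \<alpha>) (lift_v A1 A2 \<beta>) (i, j) (p, q) \<bullet> v = 0 \<bullet> v"
    unfolding M.koszul_bracket_inner[OF open_UV cotensor2_PP h_form[OF assms(1)] v_form[OF assms(2)] z] F
      deriv_lift_h[OF assms(1) pq] deriv_lift_v[OF assms(2) pq]
      anchor_h[OF assms(1) pq(1,3,4)] anchor_v[OF assms(2) pq(2,3,4)]
      h_comp[OF assms(1) pq(1,3,4)] v_comp[OF assms(2) pq(2,3,4)]
    by (simp add: inner_prod_def M.chart_deriv_const zero)
qed

lemma koszul_vv:
  assumes "one_form A2 V \<alpha>" "one_form A2 V \<beta>"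
    and pq: "p \<in> U" "q \<in> V" "p \<in> chart_dom A1 i" "q \<in> chart_dom A2 j"
  shows "koszul_bracket PA PP (lift_v A1 A2 \<alpha>) (lift_v A1 A2 \<beta>) (i, j) (p, q)
    = (field2_eval A2 P2 \<alpha> \<beta> q *\<^sub>R differential A1 \<mu> i p, \<mu> p *\<^sub>R koszul_bracket A2 P2 \<alpha> \<beta> j q)"
proof (rule vector_eq_rdot[THEN iffD1], rule allI)
  fix v :: "'a \<times> 'b"
  have z: "(p, q) \<in> U \<times> V" "(p, q) \<in> chart_dom PA (i, j)"
    using pq by (auto simp: prod_atlas_simps)
  let ?E = "field2_eval A2 P2 \<alpha> \<beta>"
  have E: "chart_smooth A2 V j ?E"
    using M2.smooth_fun_field2_eval[OF open_V P2 assms(1,2)] by (simp add: smooth_fun_def)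
  have \<mu>U: "chart_smooth A1 U i \<mu>"
    using \<mu>_chart by (rule chart_smooth_subset) simp
  have "chart_deriv PA (i, j) (field2_eval PA PP (lift_v A1 A2 \<alpha>) (lift_v A1 A2 \<beta>)) (p, q)
      = chart_deriv PA (i, j) (\<lambda>z. \<mu> (fst z) * ?E (snd z)) (p, q)"
    by (rule M.chart_deriv_cong[OF open_UV z]) (auto simp: eval_vv[OF P1 P2 assms(1,2)])
  also have "\<dots> = (\<lambda>w. \<mu> p * chart_deriv A2 j ?E q (snd w) + chart_deriv A1 i \<mu> p (fst w) * ?E q)"
    unfolding M.chart_deriv_bilinear[OF open_UV chart_smooth_fst[OF open_U open_V \<mu>U]
        chart_smooth_snd[OF open_U open_V E] z bounded_bilinear_mult]
      chart_deriv_fst[OF open_U \<mu>U pq(1,3,4)] chart_deriv_snd[OF open_V E pq(2-4)] by simp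
  finally have F: "chart_deriv PA (i, j) (field2_eval PA PP (lift_v A1 A2 \<alpha>) (lift_v A1 A2 \<beta>)) (p, q)
      = (\<lambda>w. \<mu> p * chart_deriv A2 j ?E q (snd w) + chart_deriv A1 i \<mu> p (fst w) * ?E q)" .
  have lin: "linear (chart_deriv A2 j (\<alpha> j) q)" "linear (chart_deriv A2 j (\<beta> j) q)"
    using M2.linear_chart_deriv[OF open_V one_form_smooth[OF assms(1)] pq(2,4)]
      M2.linear_chart_deriv[OF open_V one_form_smooth[OF assms(2)] pq(2,4)] by auto
  \<comment> \<open>With these signs, each of the two Lie derivatives contributes
    \<open>P2(\<alpha>, \<beta>) d\<mu>\<close>, and the exact term of the bracket takes one of them
    away. This explains the coefficient 1 of \<open>d\<mu>\<close> in the result.\<close>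
  have inner: "\<beta> j q \<bullet> anchor P2 \<alpha> j q = ?E q" "\<alpha> j q \<bullet> anchor P2 \<beta> j q = - ?E q"
    using anchor_inner[of P2 j q, OF cotensor2_bilinear[OF P2 pq(4)]] P2_skew[OF pq(4), of "\<beta> j q" "\<alpha> j q"]
    by (simp_all add: M2.field2_eval_chart[OF P2 assms(1,2) pq(2,2,4)] inner_commute)
  have d\<mu>: "chart_deriv A1 i \<mu> p v1 = differential A1 \<mu> i p \<bullet> v1" for v1
    by (rule M1.differential_inner[OF open_UNIV smooth_\<mu> _ pq(3), symmetric]) simp
  show "koszul_bracket PA PP (lift_v A1 A2 \<alpha>) (lift_v A1 A2 \<beta>) (i, j) (p, q) \<bullet> v
      = (?E q *\<^sub>R differential A1 \<mu> i p, \<mu> p *\<^sub>R koszul_bracket A2 P2 \<alpha> \<beta> j q) \<bullet> v"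
    unfolding M.koszul_bracket_inner[OF open_UV cotensor2_PP v_form[OF assms(1)] v_form[OF assms(2)] z] F
      deriv_lift_v[OF assms(1) pq] deriv_lift_v[OF assms(2) pq]
      anchor_v[OF assms(1) pq(2,3,4)] anchor_v[OF assms(2) pq(2,3,4)]
      v_comp[OF assms(1) pq(2,3,4)] v_comp[OF assms(2) pq(2,3,4)]
    by (simp add: inner_prod_def M2.koszul_bracket_inner[OF open_V P2 assms(1,2) pq(2,4)]
        lin[THEN linear_scale] inner_add_right inner d\<mu> algebra_simps)
qed

lemma derive_along_h:
  assumes "one_form A1 U \<alpha>" "p \<in> U" "q \<in> V"
  shows "smooth_fun A1 U \<phi> \<Longrightarrow> derive_along PA (anchor PP (lift_h A1 A2 \<alpha>)) (\<lambda>z. \<phi> (fst z)) (p, q)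
      = derive_along A1 (anchor P1 \<alpha>) \<phi> p"
    and "smooth_fun A2 V \<psi> \<Longrightarrow> derive_along PA (anchor PP (lift_h A1 A2 \<alpha>)) (\<lambda>z. \<psi> (snd z)) (p, q) = 0"
proof -
  obtain i j where ij: "chart_at PA (p, q) = (i, j)" "p \<in> chart_dom A1 i" "q \<in> chart_dom A2 j"
    by (rule chart_at_prod)
  show "derive_along PA (anchor PP (lift_h A1 A2 \<alpha>)) (\<lambda>z. \<phi> (fst z)) (p, q)
      = derive_along A1 (anchor P1 \<alpha>) \<phi> p" if \<phi>: "smooth_fun A1 U \<phi>"
  proof -
    have "chart_smooth A1 U i \<phi>"
      using \<phi> by (simp add: smooth_fun_def)
    from chart_deriv_fst[OF open_U this assms(2) ij(2,3)] show ?thesis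
      unfolding derive_along_def[of PA] ij(1) anchor_h[OF assms(1,2) ij(2,3)]
      by (simp add: M1.derive_along_chart[OF open_U P1 assms(1) \<phi> assms(2) ij(2)])
  qed
  show "derive_along PA (anchor PP (lift_h A1 A2 \<alpha>)) (\<lambda>z. \<psi> (snd z)) (p, q) = 0"
    if "smooth_fun A2 V \<psi>"
  proof -
    have \<psi>: "chart_smooth A2 V j \<psi>"
      using that by (simp add: smooth_fun_def)
    from chart_deriv_snd[OF open_V this assms(3) ij(2,3)] show ?thesis
      unfolding derive_along_def[of PA] ij(1) anchor_h[OF assms(1,2) ij(2,3)]
      by (simp add: linear_0[OF M2.linear_chart_deriv[OF open_V \<psi> assms(3) ij(3)]])
  qed
qed

lemma derive_along_v:
  assumes "one_form A2 V \<alpha>" "p \<in> U" "q \<in> V"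
  shows "smooth_fun A1 U \<phi> \<Longrightarrow> derive_along PA (anchor PP (lift_v A1 A2 \<alpha>)) (\<lambda>z. \<phi> (fst z)) (p, q) = 0"
    and "smooth_fun A2 V \<psi> \<Longrightarrow> derive_along PA (anchor PP (lift_v A1 A2 \<alpha>)) (\<lambda>z. \<psi> (snd z)) (p, q)
      = \<mu> p * derive_along A2 (anchor P2 \<alpha>) \<psi> q"
proof -
  obtain i j where ij: "chart_at PA (p, q) = (i, j)" "p \<in> chart_dom A1 i" "q \<in> chart_dom A2 j"
    by (rule chart_at_prod)
  show "derive_along PA (anchor PP (lift_v A1 A2 \<alpha>)) (\<lambda>z. \<phi> (fst z)) (p, q) = 0"
    if "smooth_fun A1 U \<phi>"
  proof -
    have \<phi>: "chart_smooth A1 U i \<phi>"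
      using that by (simp add: smooth_fun_def)
    from chart_deriv_fst[OF open_U this assms(2) ij(2,3)] show ?thesis
      unfolding derive_along_def[of PA] ij(1) anchor_v[OF assms(1,3) ij(2,3)]
      by (simp add: linear_0[OF M1.linear_chart_deriv[OF open_U \<phi> assms(2) ij(2)]])
  qed
  show "derive_along PA (anchor PP (lift_v A1 A2 \<alpha>)) (\<lambda>z. \<psi> (snd z)) (p, q)
      = \<mu> p * derive_along A2 (anchor P2 \<alpha>) \<psi> q" if \<psi>': "smooth_fun A2 V \<psi>"
  proof -
    have \<psi>: "chart_smooth A2 V j \<psi>"
      using \<psi>' by (simp add: smooth_fun_def)
    from chart_deriv_snd[OF open_V this assms(3) ij(2,3)] show ?thesis
      unfolding derive_along_def[of PA] ij(1) anchor_v[OF assms(1,3) ij(2,3)]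
      by (simp add: linear_scale[OF M2.linear_chart_deriv[OF open_V \<psi> assms(3) ij(3)]]
          M2.derive_along_chart[OF open_V P2 assms(1) \<psi>' assms(3) ij(3)])
  qed
qed

end

section \<open>The warped frame\<close>

context smooth_atlas
begin

lemma field2_eval_scale_left:
  "cotensor2 A t \<Longrightarrow> field2_eval A t (scale_field \<phi> \<alpha>) \<beta> p = \<phi> p * field2_eval A t \<alpha> \<beta> p"
  unfolding field2_eval_def scale_field_def
  by (simp add: bilinear_lmul[OF cotensor2_bilinear[OF _ chart_at_dom]])

lemma field2_eval_scale_right:
  "cotensor2 A t \<Longrightarrow> field2_eval A t \<alpha> (scale_field \<phi> \<beta>) p = \<phi> p * field2_eval A t \<alpha> \<beta> p"
  unfolding field2_eval_def scale_field_def
  by (simp add: bilinear_rmul[OF cotensor2_bilinear[OF _ chart_at_dom]])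

lemma derive_along_scale:
  assumes "cotensor2 A P" "open V" "smooth_fun A V \<psi>" "p \<in> V"
  shows "derive_along A (anchor P (scale_field \<phi> \<alpha>)) \<psi> p = \<phi> p * derive_along A (anchor P \<alpha>) \<psi> p"
  unfolding derive_along_eq[OF assms] by (rule field2_eval_scale_left[OF assms(1)])

lemma derive_along_cmult:
  assumes "open V" "smooth_fun A V \<psi>" "p \<in> V"
  shows "derive_along A X (\<lambda>q. c * \<psi> q) p = c * derive_along A X \<psi> p"
  using derive_along_mult[OF assms(1) smooth_fun_const[OF assms(1)] assms(2,3)]
  by (simp add: derive_along_const)

end

context contravariant_frame
begin

text \<open>Instead of differentiating the coordinate formula, the bracket is replaced by the
  torsion expression, where the rules for \<open>D\<close> give the Leibniz rule at once.\<close>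

lemma koszul_scale_right:
  assumes "open V" "smooth_fun A V \<phi>" "one_form A V \<alpha>" "one_form A V \<beta>" "p \<in> V" "p \<in> chart_dom A i"
  shows "koszul_bracket A P \<alpha> (scale_field \<phi> \<beta>) i p
    = \<phi> p *\<^sub>R koszul_bracket A P \<alpha> \<beta> i p + derive_along A (anchor P \<alpha>) \<phi> p *\<^sub>R \<beta> i p"
  unfolding field_eq_onD[OF torsion_free[OF assms(1,3) one_form_scale[OF assms(1,2,4)]] assms(5,6), symmetric]
    field_eq_onD[OF torsion_free[OF assms(1,3,4)] assms(5,6), symmetric]
    field_eq_onD[OF D_scale_right[OF assms(1-4)] assms(5,6)]
    field_eq_onD[OF D_scale_left[OF assms(1,2,4,3)] assms(5,6)]
  by (simp add: scale_field_def algebra_simps)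

lemma koszul_scale_left:
  assumes "open V" "smooth_fun A V \<phi>" "one_form A V \<alpha>" "one_form A V \<beta>" "p \<in> V" "p \<in> chart_dom A i"
  shows "koszul_bracket A P (scale_field \<phi> \<alpha>) \<beta> i p
    = \<phi> p *\<^sub>R koszul_bracket A P \<alpha> \<beta> i p - derive_along A (anchor P \<beta>) \<phi> p *\<^sub>R \<alpha> i p"
  unfolding field_eq_onD[OF torsion_free[OF assms(1) one_form_scale[OF assms(1-3)] assms(4)] assms(5,6), symmetric]
    field_eq_onD[OF torsion_free[OF assms(1,3,4)] assms(5,6), symmetric]
    field_eq_onD[OF D_scale_right[OF assms(1,2,4,3)] assms(5,6)]
    field_eq_onD[OF D_scale_left[OF assms(1-4)] assms(5,6)]
  by (simp add: scale_field_def algebra_simps)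

lemma Br_skew:
  assumes "p \<in> U" "a < DIM('a)" "b < DIM('a)"
  shows "Br a b c p = - Br b a c p"
  using Gam_torsion[OF assms, of c] Gam_torsion[OF assms(1,3,2), of c] by linarith

lemma along_cong:
  "p \<in> U \<Longrightarrow> (\<And>q. q \<in> U \<Longrightarrow> \<phi> q = \<psi> q) \<Longrightarrow> along k \<phi> p = along k \<psi> p"
  unfolding along_def by (rule derive_along_cong[OF open_U])

lemma along_mult:
  assumes "smooth_fun A U \<phi>" "smooth_fun A U \<psi>" "p \<in> U"
  shows "along k (\<lambda>q. \<phi> q * \<psi> q) p = along k \<phi> p * \<psi> p + \<phi> p * along k \<psi> p"
  unfolding along_def by (rule derive_along_mult[OF open_U assms])

lemma along_cmult:
  assumes "smooth_fun A U \<psi>" "p \<in> U"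
  shows "along k (\<lambda>q. c * \<psi> q) p = c * along k \<psi> p"
  unfolding along_def by (rule derive_along_cmult[OF open_U assms])

text \<open>This symmetry follows from skewness of \<open>Gam\<close> in its last two indices and of
  \<open>Br\<close> in its first two. It reduces the mixed blocks of the scalar curvature to
  one.\<close>

lemma Sec_sym:
  assumes p: "p \<in> U" and a: "a < DIM('a)" and b: "b < DIM('a)"
  shows "Sec a b p = Sec b a p"
proof -
  have flip: "along l (Gam k l k) p = - along l (Gam k k l) p" if "k < DIM('a)" "l < DIM('a)" for k l
  proof -
    have "along l (Gam k l k) p = along l (\<lambda>q. (- 1) * Gam k k l q) p"
      by (intro along_cong p) (simp add: Gam_skew[OF _ that(1,2,1)])
    then show ?thesis
      unfolding along_cmult[OF smooth_Gam[OF that(1,1,2)] p] by simp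
  qed
  have "Gam a b c p * Gam b a c p - Gam b b c p * Gam a a c p - Br a b c p * Gam c b a p
      = Gam b a c p * Gam a b c p - Gam a a c p * Gam b b c p - Br b a c p * Gam c a b p"
    if "c < DIM('a)" for c
    using Gam_skew[OF p that a b] Br_skew[OF p a b, of c] by simp
  then show ?thesis
    unfolding Sec_def flip[OF a b] flip[OF b a] by (simp add: mult.commute)
qed

end

text \<open>Separates the horizontal indices, below \<open>DIM('a)\<close>, from the vertical
  ones.\<close>

lemma sum_lessThan_add:
  fixes F :: "nat \<Rightarrow> 'c::comm_monoid_add"
  shows "(\<Sum>c<m + n. F c) = (\<Sum>c<m. F c) + (\<Sum>c<n. F (m + c))"
  by (induction n) (simp_all add: add.assoc)

locale warped_connection =
  F1: contravariant_frame A1 g1 P1 D1 U \<theta> + F2: contravariant_frame A2 g2 P2 D2 V \<eta>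
  for A1 :: "('i, 'm::{t2_space, second_countable_topology}, 'a::euclidean_space) atlas"
    and A2 :: "('j, 'n::{t2_space, second_countable_topology}, 'b::euclidean_space) atlas"
    and g1 P1 D1 U \<theta> g2 P2 D2 V \<eta> +
  fixes f \<mu> :: "'m \<Rightarrow> real"
    and D :: "('i \<times> 'j, 'm \<times> 'n, 'a \<times> 'b) field \<Rightarrow> ('i \<times> 'j, 'm \<times> 'n, 'a \<times> 'b) field
                \<Rightarrow> ('i \<times> 'j, 'm \<times> 'n, 'a \<times> 'b) field"
  assumes smooth_f: "smooth_fun A1 UNIV f" and f_pos: "\<And>p. f p > 0"
    and smooth_\<mu>': "smooth_fun A1 UNIV \<mu>"
    and levi_civita_warped:
      "levi_civita_connection (prod_atlas A1 A2) (warped f g1 g2) (warped \<mu> P1 P2) D"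
begin

sublocale W: warped_product A1 A2 P1 P2 \<mu> U V
  by unfold_locales (rule F1.P F2.P F2.P_skew smooth_\<mu>' F1.open_U F2.open_U; assumption?)+

abbreviation "PA \<equiv> prod_atlas A1 A2"

definition \<phi> :: "'m \<Rightarrow> real" where
  "\<phi> p = 1 / sqrt (f p)"

definition \<phi>h :: "'m \<times> 'n \<Rightarrow> real" where
  "\<phi>h z = \<phi> (fst z)"

abbreviation "E \<equiv> warped_frame A1 A2 f \<theta> \<eta>"

lemma \<phi>_square: "\<phi> p * \<phi> p * f p = 1" "\<phi> p > 0"
  using f_pos[of p] by (simp_all add: \<phi>_def)

lemma smooth_\<phi>: "smooth_fun A1 U \<phi>"
proof -
  have "smooth_fun A1 UNIV (\<lambda>p. f p powr (- (1 / 2)))"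
    by (intro F1.smooth_fun_powr open_UNIV smooth_f f_pos)
  moreover have "(\<lambda>p. f p powr (- (1 / 2))) = \<phi>"
    using f_pos by (intro ext) (simp add: \<phi>_def powr_minus_divide powr_half_sqrt less_imp_le)
  ultimately show ?thesis
    using smooth_fun_subset by fastforce
qed

lemma smooth_\<phi>h: "smooth_fun PA (U \<times> V) \<phi>h"
  unfolding \<phi>h_def[abs_def] by (rule W.smooth_fun_fst[OF F1.open_U F2.open_U smooth_\<phi>])

lemma E_h: "k < DIM('a) \<Longrightarrow> E k = lift_h A1 A2 (\<theta> k)"
  by (simp add: warped_frame_def)

lemma E_v: "E (DIM('a) + i) = scale_field \<phi>h (lift_v A1 A2 (\<eta> i))"
  by (simp add: warped_frame_def \<phi>h_def[abs_def] \<phi>_def case_prod_beta')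

lemmas \<theta>_form = F1.e_form[OF _ subset_refl]
lemmas \<eta>_form = F2.e_form[OF _ subset_refl]

lemma index_cases:
  assumes "k < DIM('a \<times> 'b)"
  obtains (h) "k < DIM('a)" | (v) i where "k = DIM('a) + i" "i < DIM('b)"
  using assms by (metis DIM_prod add_less_cancel_left le_add_diff_inverse not_less)

lemma E_form:
  assumes "k < DIM('a \<times> 'b)"
  shows "one_form PA (U \<times> V) (E k)"
  using assms
proof (cases rule: index_cases)
  case h
  then show ?thesis
    unfolding E_h[OF h] by (intro W.h_form \<theta>_form)
next
  case (v i)
  then show ?thesis
    unfolding v(1) E_v by (intro W.M.one_form_scale W.open_UV smooth_\<phi>h W.v_form \<eta>_form)
qed

abbreviation "GG \<equiv> warped f g1 g2"

lemma cotensor2_GG: "cotensor2 PA GG"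
  by (intro W.cotensor2_warped F1.g F2.g smooth_f)

lemmas eval_scale = W.M.field2_eval_scale_left[OF cotensor2_GG] W.M.field2_eval_scale_right[OF cotensor2_GG]
lemmas eval_hh = W.eval_hh[OF F1.g F2.g, of _ _ _ f]
lemmas eval_vv = W.eval_vv[OF F1.g F2.g, of _ _ _ f]
lemmas eval_hv = W.eval_hv[OF F1.g F2.g, of _ _ _ _ f]

lemma eval_E_hh:
  assumes "p \<in> U" "k < DIM('a)" "l < DIM('a)"
  shows "field2_eval PA GG (E k) (E l) (p, q) = F1.G (\<theta> k) (\<theta> l) p"
  unfolding E_h[OF assms(2)] E_h[OF assms(3)] F1.G_def
  by (intro eval_hh \<theta>_form assms)

lemma eval_E_hv:
  assumes "p \<in> U" "q \<in> V" "k < DIM('a)" "i < DIM('b)"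
  shows "field2_eval PA GG (E k) (E (DIM('a) + i)) (p, q) = 0"
    "field2_eval PA GG (E (DIM('a) + i)) (E k) (p, q) = 0"
  unfolding E_h[OF assms(3)] E_v eval_scale
  by (simp_all add: eval_hv \<theta>_form \<eta>_form assms)

lemma eval_E_vv:
  assumes "q \<in> V" "i < DIM('b)" "j < DIM('b)"
  shows "field2_eval PA GG (E (DIM('a) + i)) (E (DIM('a) + j)) (p, q) = F2.G (\<eta> i) (\<eta> j) q"
  using \<phi>_square(1)[of p]
  unfolding E_v eval_scale eval_vv[OF \<eta>_form[OF assms(2)] \<eta>_form[OF assms(3)] assms(1)]
  by (simp add: \<phi>h_def F2.G_def flip: mult.assoc)

lemma orthonormal_E: "orthonormal_frame PA GG (U \<times> V) E"
  unfolding orthonormal_frame_def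
proof (intro conjI ballI allI impI)
  fix z k assume "z \<in> U \<times> V" and k: "k < DIM('a \<times> 'b)"
  then obtain p q where z: "z = (p, q)" "p \<in> U" "q \<in> V"
    by auto
  show "field2_eval PA GG (E k) (E k) z \<in> {1, - 1}"
    using k
  proof (cases rule: index_cases)
    case h
    then show ?thesis
      using F1.eps_cases[OF z(2) h] by (simp add: z eval_E_hh F1.eps_def)
  next
    case (v i)
    then show ?thesis
      using F2.eps_cases[OF z(3) v(2)] z by (simp add: eval_E_vv F2.eps_def)
  qed
  fix l assume l: "l < DIM('a \<times> 'b)" and kl: "k \<noteq> l"
  show "field2_eval PA GG (E k) (E l) z = 0"
    using k
  proof (cases rule: index_cases)
    case h
    show ?thesis
      using l
    proof (cases rule: index_cases)
      case h': h
      then show ?thesis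
        using F1.G_orth[OF z(2) h h' kl] by (simp add: z eval_E_hh h)
    qed (simp add: z eval_E_hv h)
  next
    case (v i)
    show ?thesis
      using l
    proof (cases rule: index_cases)
      case (v j)
      then show ?thesis
        using F2.G_orth[OF z(3), of i j] kl \<open>k = DIM('a) + i\<close> \<open>i < DIM('b)\<close> by (simp add: z eval_E_vv)
    qed (simp add: z eval_E_hv v)
  qed
qed (rule E_form)

text \<open>Third use of the frame locale, so that \<open>Gam_koszul\<close>, \<open>Sec\<close> and
  \<open>Sec_sym\<close> hold on the product with the warped frame.\<close>

sublocale F: contravariant_frame PA GG "warped \<mu> P1 P2" D "U \<times> V" E
proof unfold_locales
  fix k z and a b :: "'a \<times> 'b"
  assume "z \<in> chart_dom PA k"
  then obtain i j p q where eqs: "k = (i, j)" "z = (p, q)" "p \<in> chart_dom A1 i" "q \<in> chart_dom A2 j"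
    by (cases k, cases z) (auto simp: prod_atlas_simps)
  obtain a1 a2 b1 b2 where ab: "a = (a1, a2)" "b = (b1, b2)"
    by (cases a, cases b)
  show "warped f g1 g2 k z a b = warped f g1 g2 k z b a"
    unfolding eqs ab W.warped_Pair F1.g_sym[OF eqs(3), of a1] F2.g_sym[OF eqs(4), of a2] ..
  show "warped \<mu> P1 P2 k z a b = - warped \<mu> P1 P2 k z b a"
    unfolding eqs ab W.warped_Pair using F1.P_skew[OF eqs(3), of a1 b1] F2.P_skew[OF eqs(4), of a2 b2] by simp
qed (rule cotensor2_GG W.cotensor2_PP levi_civita_warped W.open_UV orthonormal_E)+

lemma eps_E:
  assumes "p \<in> U" "q \<in> V"
  shows "k < DIM('a) \<Longrightarrow> F.eps k (p, q) = F1.eps k p"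
    and "i < DIM('b) \<Longrightarrow> F.eps (DIM('a) + i) (p, q) = F2.eps i q"
  by (simp_all add: F.eps_def F.G_def F1.eps_def F2.eps_def eval_E_hh eval_E_vv assms)

lemma along_E_h:
  assumes "p \<in> U" "q \<in> V" "k < DIM('a)" "smooth_fun A1 U \<psi>" "smooth_fun A2 V \<rho>"
  shows "F.along k (\<lambda>z. \<psi> (fst z) * \<rho> (snd z)) (p, q) = F1.along k \<psi> p * \<rho> q"
proof -
  note s = W.smooth_fun_fst[OF F1.open_U F2.open_U assms(4)] W.smooth_fun_snd[OF F1.open_U F2.open_U assms(5)]
  have z: "(p, q) \<in> U \<times> V"
    using assms by simp
  show ?thesis
    unfolding F.along_mult[OF s z] unfolding F.along_def E_h[OF assms(3)]
      W.derive_along_h(1)[OF \<theta>_form[OF assms(3)] assms(1,2,4)]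
      W.derive_along_h(2)[OF \<theta>_form[OF assms(3)] assms(1,2,5)]
    by (simp add: F1.along_def)
qed

lemma along_E_v:
  assumes "p \<in> U" "q \<in> V" "i < DIM('b)" "smooth_fun A1 U \<psi>" "smooth_fun A2 V \<rho>"
  shows "F.along (DIM('a) + i) (\<lambda>z. \<psi> (fst z) * \<rho> (snd z)) (p, q) = \<phi> p * \<mu> p * \<psi> p * F2.along i \<rho> q"
proof -
  note s = W.smooth_fun_fst[OF F1.open_U F2.open_U assms(4)] W.smooth_fun_snd[OF F1.open_U F2.open_U assms(5)]
  have z: "(p, q) \<in> U \<times> V"
    using assms by simp
  show ?thesis
    unfolding F.along_mult[OF s z] unfolding F.along_def E_v
      W.M.derive_along_scale[OF W.cotensor2_PP W.open_UV s(1) z]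
      W.M.derive_along_scale[OF W.cotensor2_PP W.open_UV s(2) z]
      W.derive_along_v(1)[OF \<eta>_form[OF assms(3)] assms(1,2,4)]
      W.derive_along_v(2)[OF \<eta>_form[OF assms(3)] assms(1,2,5)]
    by (simp add: F2.along_def \<phi>h_def)
qed

text \<open>The logarithmic derivative of \<open>\<phi>\<close>, that is of \<open>f\<close> to the
  power \<open>- 1 / 2\<close>, along \<open>\<theta> k\<close>.\<close>

definition lam :: "nat \<Rightarrow> 'm \<Rightarrow> real" where
  "lam k p = - F1.along k f p / (2 * f p)"

definition m :: "nat \<Rightarrow> 'm \<Rightarrow> real" where
  "m k p = F1.G (differential A1 \<mu>) (\<theta> k) p"

lemma smooth_f_U: "smooth_fun A1 U f"
  by (rule smooth_fun_subset[OF smooth_f]) simp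

text \<open>Implicit differentiation of \<open>\<phi> * \<phi> * f = 1\<close>.\<close>

lemma along_\<phi>:
  assumes "p \<in> U"
  shows "F1.along k \<phi> p = lam k p * \<phi> p"
proof -
  have "F1.along k (\<lambda>q. \<phi> q * \<phi> q * f q) p = 0"
    using F1.along_cong[OF assms, of "\<lambda>q. \<phi> q * \<phi> q * f q" "\<lambda>q. 1"] \<phi>_square(1)
    by (simp add: F1.along_def F1.derive_along_const)
  then have "\<phi> p * (2 * F1.along k \<phi> p * f p + \<phi> p * F1.along k f p) = 0"
    using F1.along_mult[OF F1.smooth_fun_mult[OF F1.open_U smooth_\<phi> smooth_\<phi>] smooth_f_U assms, of k]
      F1.along_mult[OF smooth_\<phi> smooth_\<phi> assms, of k]
    by (simp add: algebra_simps)
  then have "2 * F1.along k \<phi> p * f p + \<phi> p * F1.along k f p = 0"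
    using \<phi>_square(2)[of p] by simp
  then show ?thesis
    using f_pos[of p] by (simp add: lam_def field_simps)
qed

lemma d\<mu>_form: "one_form A1 U (differential A1 \<mu>)"
  by (rule F1.one_form_differential[OF F1.open_U smooth_fun_subset[OF smooth_\<mu>']]) simp

lemma koszul_h:
  assumes "k < DIM('a)" "l < DIM('a)"
  shows "field_eq_on PA (U \<times> V) (koszul_bracket PA (warped \<mu> P1 P2) (E k) (E l))
    (lift_h A1 A2 (koszul_bracket A1 P1 (\<theta> k) (\<theta> l)))"
  unfolding field_eq_on_def
proof (intro allI ballI)
  fix k' z assume "z \<in> (U \<times> V) \<inter> chart_dom PA k'"
  then obtain i j p q where eqs: "k' = (i, j)" "z = (p, q)"
    and pq: "p \<in> U" "q \<in> V" "p \<in> chart_dom A1 i" "q \<in> chart_dom A2 j"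
    by (cases k', cases z) (auto simp: prod_atlas_simps)
  note forms = \<theta>_form[OF assms(1)] \<theta>_form[OF assms(2)]
  show "koszul_bracket PA (warped \<mu> P1 P2) (E k) (E l) k' z
      = lift_h A1 A2 (koszul_bracket A1 P1 (\<theta> k) (\<theta> l)) k' z"
    unfolding eqs E_h[OF assms(1)] E_h[OF assms(2)] W.koszul_hh[OF forms pq]
      W.h_comp[OF F1.koszul_form[OF F1.open_U forms] pq(1,3,4)] ..
qed

text \<open>The lifts themselves commute, so only the derivative of the factor \<open>\<phi>\<close>
  survives; written with \<open>lam\<close> it is again a multiple of the frame form.\<close>

lemma koszul_hv:
  assumes "k < DIM('a)" "i < DIM('b)"
  shows "field_eq_on PA (U \<times> V) (koszul_bracket PA (warped \<mu> P1 P2) (E k) (E (DIM('a) + i)))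
    (scale_field (\<lambda>z. lam k (fst z)) (E (DIM('a) + i)))"
  unfolding field_eq_on_def
proof (intro allI ballI)
  fix k' z assume z: "z \<in> (U \<times> V) \<inter> chart_dom PA k'"
  then obtain i' j' p q where eqs: "k' = (i', j')" "z = (p, q)"
    and pq: "p \<in> U" "q \<in> V" "p \<in> chart_dom A1 i'" "q \<in> chart_dom A2 j'"
    by (cases k', cases z) (auto simp: prod_atlas_simps)
  note forms = \<theta>_form[OF assms(1)] \<eta>_form[OF assms(2)]
  have "derive_along PA (anchor (warped \<mu> P1 P2) (lift_h A1 A2 (\<theta> k))) \<phi>h (p, q) = lam k p * \<phi> p"
    using W.derive_along_h(1)[OF forms(1) pq(1,2) smooth_\<phi>] along_\<phi>[OF pq(1)]
    by (simp add: F1.along_def \<phi>h_def[abs_def])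
  then show "koszul_bracket PA (warped \<mu> P1 P2) (E k) (E (DIM('a) + i)) k' z
      = scale_field (\<lambda>z. lam k (fst z)) (E (DIM('a) + i)) k' z"
    unfolding E_h[OF assms(1)] E_v
    using z F.koszul_scale_right[OF W.open_UV smooth_\<phi>h W.h_form[OF forms(1)] W.v_form[OF forms(2)], of z k']
      W.koszul_hv[OF forms pq]
    by (simp add: scale_field_def \<phi>h_def eqs)
qed

lemma koszul_v:
  assumes "i < DIM('b)" "j < DIM('b)"
  shows "field_eq_on PA (U \<times> V) (koszul_bracket PA (warped \<mu> P1 P2) (E (DIM('a) + i)) (E (DIM('a) + j)))
    (\<lambda>k z. scale_field (\<lambda>z. (\<phi> (fst z))\<^sup>2 * F2.Bv i j (snd z)) (lift_h A1 A2 (differential A1 \<mu>)) k z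
      + scale_field (\<lambda>z. (\<phi> (fst z))\<^sup>2 * \<mu> (fst z)) (lift_v A1 A2 (koszul_bracket A2 P2 (\<eta> i) (\<eta> j))) k z)"
  unfolding field_eq_on_def
proof (intro allI ballI)
  fix k' z assume z: "z \<in> (U \<times> V) \<inter> chart_dom PA k'"
  then obtain i' j' p q where eqs: "k' = (i', j')" "z = (p, q)"
    and pq: "p \<in> U" "q \<in> V" "p \<in> chart_dom A1 i'" "q \<in> chart_dom A2 j'"
    by (cases k', cases z) (auto simp: prod_atlas_simps)
  have z': "z \<in> U \<times> V" "z \<in> chart_dom PA k'"
    using z by auto
  note forms = \<eta>_form[OF assms(1)] \<eta>_form[OF assms(2)]
  note lifts = W.v_form[OF forms(1)] W.v_form[OF forms(2)]
  \<comment> \<open>\<open>\<phi>\<close> lives on the first factor and the anchors of vertical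
    forms are vertical, so both factors \<open>\<phi>\<close> leave the bracket without derivative
    terms.\<close>
  have zero: "derive_along PA (anchor (warped \<mu> P1 P2) (lift_v A1 A2 (\<eta> l))) \<phi>h z = 0" if "l < DIM('b)" for l
    using W.derive_along_v(1)[OF \<eta>_form[OF that] pq(1,2) smooth_\<phi>] by (simp add: \<phi>h_def[abs_def] eqs)
  have zero': "derive_along PA (anchor (warped \<mu> P1 P2) (scale_field \<phi>h (lift_v A1 A2 (\<eta> i)))) \<phi>h z = 0"
    unfolding W.M.derive_along_scale[OF W.cotensor2_PP W.open_UV smooth_\<phi>h z'(1)] zero[OF assms(1)] by simp
  have "koszul_bracket PA (warped \<mu> P1 P2) (E (DIM('a) + i)) (E (DIM('a) + j)) k' z
      = (\<phi>h z * \<phi>h z) *\<^sub>R koszul_bracket PA (warped \<mu> P1 P2) (lift_v A1 A2 (\<eta> i)) (lift_v A1 A2 (\<eta> j)) k' z"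
    unfolding E_v
      F.koszul_scale_right[OF W.open_UV smooth_\<phi>h W.M.one_form_scale[OF W.open_UV smooth_\<phi>h lifts(1)] lifts(2) z']
      F.koszul_scale_left[OF W.open_UV smooth_\<phi>h lifts z'] zero[OF assms(2)] zero'
    by simp
  then show "koszul_bracket PA (warped \<mu> P1 P2) (E (DIM('a) + i)) (E (DIM('a) + j)) k' z
      = scale_field (\<lambda>z. (\<phi> (fst z))\<^sup>2 * F2.Bv i j (snd z)) (lift_h A1 A2 (differential A1 \<mu>)) k' z
        + scale_field (\<lambda>z. (\<phi> (fst z))\<^sup>2 * \<mu> (fst z)) (lift_v A1 A2 (koszul_bracket A2 P2 (\<eta> i) (\<eta> j))) k' z"
    by (simp add: eqs W.koszul_vv[OF forms pq] W.h_comp[OF d\<mu>_form pq(1,3,4)]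
        W.v_comp[OF F2.koszul_form[OF F2.open_U forms] pq(2,3,4)] scale_field_def \<phi>h_def F2.Bv_def
        power2_eq_square)
qed

section \<open>Bracket and connection coefficients of the warped frame\<close>

context
  fixes p q
  assumes p: "p \<in> U" and q: "q \<in> V"
begin

lemma z: "(p, q) \<in> U \<times> V"
  using p q by simp

lemma lt_h: "k < DIM('a) \<Longrightarrow> k < DIM('a \<times> 'b)"
  and lt_v: "i < DIM('b) \<Longrightarrow> DIM('a) + i < DIM('a \<times> 'b)"
  by simp_all

lemma Br_hh:
  assumes "k < DIM('a)" "l < DIM('a)"
  shows "c < DIM('a) \<Longrightarrow> F.Br k l c (p, q) = F1.Br k l c p"
    and "j < DIM('b) \<Longrightarrow> F.Br k l (DIM('a) + j) (p, q) = 0"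
  unfolding F.Br_def F.G_cong_left[OF koszul_h[OF assms] z]
  unfolding F.G_def F1.Br_def F1.G_def
  using F1.koszul_form[OF F1.open_U \<theta>_form[OF assms(1)] \<theta>_form[OF assms(2)]]
  by (simp_all add: E_h E_v eval_scale eval_hh eval_hv \<theta>_form \<eta>_form p q)

lemma Br_hv:
  assumes "k < DIM('a)" "i < DIM('b)"
  shows "c < DIM('a) \<Longrightarrow> F.Br k (DIM('a) + i) c (p, q) = 0"
    and "j < DIM('b) \<Longrightarrow> F.Br k (DIM('a) + i) (DIM('a) + j) (p, q) = (if i = j then lam k p * F2.eps i q else 0)"
  unfolding F.Br_def F.G_cong_left[OF koszul_hv[OF assms] z]
  unfolding F.G_def eval_scale
  using assms F2.G_orth[OF q, of i j]
  by (simp_all add: eval_E_hv eval_E_vv p q F2.eps_def)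

lemma Br_vv:
  assumes "i < DIM('b)" "j < DIM('b)"
  shows "c < DIM('a) \<Longrightarrow> F.Br (DIM('a) + i) (DIM('a) + j) c (p, q) = (\<phi> p)\<^sup>2 * F2.Bv i j q * m c p"
    and "l < DIM('b) \<Longrightarrow> F.Br (DIM('a) + i) (DIM('a) + j) (DIM('a) + l) (p, q) = \<phi> p * \<mu> p * F2.Br i j l q"
proof -
  note K = F2.koszul_form[OF F2.open_U \<eta>_form[OF assms(1)] \<eta>_form[OF assms(2)]]
  note expand = F.G_cong_left[OF koszul_v[OF assms] z] F.G_add_left
  show "F.Br (DIM('a) + i) (DIM('a) + j) c (p, q) = (\<phi> p)\<^sup>2 * F2.Bv i j q * m c p" if "c < DIM('a)"
    unfolding F.Br_def expand unfolding F.G_def eval_scale m_def F1.G_def using K that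
    by (simp add: E_h eval_hh eval_hv d\<mu>_form \<theta>_form p q)
  \<comment> \<open>The bracket carries \<open>\<phi>^2 * \<mu>\<close>, the third frame form
    \<open>\<phi>\<close> and the metric \<open>f\<close>; as \<open>\<phi>^2 * f = 1\<close>, there
    remains \<open>\<phi> * \<mu>\<close>.\<close>
  show "F.Br (DIM('a) + i) (DIM('a) + j) (DIM('a) + l) (p, q) = \<phi> p * \<mu> p * F2.Br i j l q" if "l < DIM('b)"
    unfolding F.Br_def expand unfolding F.G_def E_v eval_scale F2.Br_def F2.G_def using K that \<phi>_square(1)[of p]
    by (simp add: eval_vv eval_hv d\<mu>_form \<eta>_form p q \<phi>h_def power2_eq_square)
qed

lemma Br_vh:
  assumes "k < DIM('a)" "i < DIM('b)"
  shows "c < DIM('a) \<Longrightarrow> F.Br (DIM('a) + i) k c (p, q) = 0"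
    and "j < DIM('b) \<Longrightarrow> F.Br (DIM('a) + i) k (DIM('a) + j) (p, q) = (if i = j then - lam k p * F2.eps i q else 0)"
  unfolding F.Br_skew[OF z lt_v[OF assms(2)] lt_h[OF assms(1)]] using Br_hv[OF assms] by simp_all

lemma Gam_hhh:
  assumes "k < DIM('a)" "l < DIM('a)" "c < DIM('a)"
  shows "F.Gam k l c (p, q) = F1.Gam k l c p"
  using assms by (simp add: F.Gam_koszul[OF z] F1.Gam_koszul[OF p] Br_hh)

text \<open>All bracket coefficients with exactly one vertical index vanish.\<close>

lemma Gam_hhv:
  assumes "k < DIM('a)" "l < DIM('a)" "i < DIM('b)"
  shows "F.Gam k l (DIM('a) + i) (p, q) = 0"
    and "F.Gam k (DIM('a) + i) l (p, q) = 0"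
    and "F.Gam (DIM('a) + i) k l (p, q) = 0"
  using assms by (simp_all add: F.Gam_koszul[OF z] Br_hh Br_hv Br_vh)

text \<open>In the third coefficient the part symmetric in \<open>i\<close> and \<open>j\<close>
  comes from \<open>f\<close> through \<open>lam\<close>, and the skew part from
  \<open>\<mu>\<close> through \<open>m\<close>. The second is its negative with \<open>k\<close>
  and \<open>j\<close> exchanged, and the first sees the skew part only.\<close>

lemma Gam_hvv:
  assumes "k < DIM('a)" "i < DIM('b)" "j < DIM('b)"
  shows "F.Gam k (DIM('a) + i) (DIM('a) + j) (p, q) = - (\<phi> p)\<^sup>2 * F2.Bv i j q * m k p / 2"
    and "F.Gam (DIM('a) + i) k (DIM('a) + j) (p, q)
      = - (if i = j then lam k p * F2.eps i q else 0) - (\<phi> p)\<^sup>2 * F2.Bv i j q * m k p / 2"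
    and "F.Gam (DIM('a) + i) (DIM('a) + j) k (p, q)
      = (if i = j then lam k p * F2.eps i q else 0) + (\<phi> p)\<^sup>2 * F2.Bv i j q * m k p / 2"
proof -
  have Bv: "F2.Bv j i q = - F2.Bv i j q"
    by (rule F2.Bv_skew)
  show "F.Gam k (DIM('a) + i) (DIM('a) + j) (p, q) = - (\<phi> p)\<^sup>2 * F2.Bv i j q * m k p / 2"
    and "F.Gam (DIM('a) + i) k (DIM('a) + j) (p, q)
      = - (if i = j then lam k p * F2.eps i q else 0) - (\<phi> p)\<^sup>2 * F2.Bv i j q * m k p / 2"
    and "F.Gam (DIM('a) + i) (DIM('a) + j) k (p, q)
      = (if i = j then lam k p * F2.eps i q else 0) + (\<phi> p)\<^sup>2 * F2.Bv i j q * m k p / 2"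
    unfolding F.Gam_koszul[OF z lt_h[OF assms(1)] lt_v[OF assms(2)] lt_v[OF assms(3)]]
      F.Gam_koszul[OF z lt_v[OF assms(2)] lt_h[OF assms(1)] lt_v[OF assms(3)]]
      F.Gam_koszul[OF z lt_v[OF assms(2)] lt_v[OF assms(3)] lt_h[OF assms(1)]]
      Br_hv(2)[OF assms(1,2,3)] Br_vh(2)[OF assms(1,2,3)] Br_hv(2)[OF assms(1,3,2)] Br_vh(2)[OF assms(1,3,2)]
      Br_vv(1)[OF assms(2,3,1)] Br_vv(1)[OF assms(3,2,1)] Bv
    by (auto simp: field_simps)
qed

lemma Gam_vvv:
  assumes "i < DIM('b)" "j < DIM('b)" "l < DIM('b)"
  shows "F.Gam (DIM('a) + i) (DIM('a) + j) (DIM('a) + l) (p, q) = \<phi> p * \<mu> p * F2.Gam i j l q"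
  unfolding F.Gam_koszul[OF z lt_v[OF assms(1)] lt_v[OF assms(2)] lt_v[OF assms(3)]]
    F2.Gam_koszul[OF q assms] Br_vv(2)[OF assms] Br_vv(2)[OF assms(2,3,1)] Br_vv(2)[OF assms(3,1,2)]
  by (simp add: algebra_simps)

lemmas Gam_E = Gam_hhh Gam_hhv Gam_hvv Gam_vvv

end

text \<open>The coefficients that \<open>Sec\<close> differentiates are, on
  \<open>U \<times> V\<close>, products of one function on each factor. A horizontal form
  differentiates the first factor, a vertical one the second with an extra
  \<open>\<phi> * \<mu>\<close>.\<close>

lemma along_E:
  assumes "p \<in> U" "q \<in> V" and \<psi>: "smooth_fun A1 U \<psi>" and \<rho>: "smooth_fun A2 V \<rho>"
    and H: "\<And>p q. p \<in> U \<Longrightarrow> q \<in> V \<Longrightarrow> H (p, q) = \<psi> p * \<rho> q"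
  shows "k < DIM('a) \<Longrightarrow> F.along k H (p, q) = F1.along k \<psi> p * \<rho> q"
    and "i < DIM('b) \<Longrightarrow> F.along (DIM('a) + i) H (p, q) = \<phi> p * \<mu> p * \<psi> p * F2.along i \<rho> q"
proof -
  have "F.along c H (p, q) = F.along c (\<lambda>z. \<psi> (fst z) * \<rho> (snd z)) (p, q)" for c
    using H assms(1,2) by (intro F.along_cong) auto
  then show "k < DIM('a) \<Longrightarrow> F.along k H (p, q) = F1.along k \<psi> p * \<rho> q"
    "i < DIM('b) \<Longrightarrow> F.along (DIM('a) + i) H (p, q) = \<phi> p * \<mu> p * \<psi> p * F2.along i \<rho> q"
    by (simp_all add: along_E_h along_E_v assms)
qed

lemma smooth_lam: "k < DIM('a) \<Longrightarrow> smooth_fun A1 U (lam k)"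
proof (rule F1.smooth_fun_cong[OF F1.open_U])
  assume "k < DIM('a)"
  then show "smooth_fun A1 U (\<lambda>p. (- 1 / 2) * (F1.along k f p * f p powr (- 1)))"
    by (intro F1.smooth_fun_mult F1.smooth_fun_const F1.smooth_along F1.smooth_fun_powr F1.open_U
        smooth_f_U f_pos)
  show "(- 1 / 2) * (F1.along k f p * f p powr (- 1)) = lam k p" for p
    using f_pos[of p] by (simp add: lam_def powr_minus_divide)
qed

text \<open>A quotient rule, obtained by applying the product rule to \<open>lam k * f\<close>,
  which is \<open>- 1 / 2\<close> times the derivative of \<open>f\<close>.\<close>

lemma along_lam:
  assumes "p \<in> U" "k < DIM('a)"
  shows "F1.along k (lam k) p
    = - F1.along k (F1.along k f) p / (2 * f p) + (F1.along k f p)\<^sup>2 / (2 * (f p)\<^sup>2)"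
proof -
  have "F1.along k (\<lambda>q. lam k q * f q) p = F1.along k (\<lambda>q. (- 1 / 2) * F1.along k f q) p"
    using f_pos by (intro F1.along_cong[OF assms(1)]) (simp add: lam_def less_imp_neq[symmetric])
  then have "F1.along k (lam k) p * f p + lam k p * F1.along k f p = - F1.along k (F1.along k f) p / 2"
    unfolding F1.along_mult[OF smooth_lam[OF assms(2)] smooth_f_U assms(1)]
      F1.along_cmult[OF F1.smooth_along[OF smooth_f_U assms(2)] assms(1)] by simp
  then have "F1.along k (lam k) p
      = (- F1.along k (F1.along k f) p / 2 - lam k p * F1.along k f p) / f p"
    using f_pos[of p] by (simp add: field_simps)
  then show ?thesis
    using f_pos[of p] by (simp add: lam_def power2_eq_square diff_divide_distrib)
qed

definition K :: "'m \<Rightarrow> real" where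
  "K p = F1.G (differential A1 \<mu>) (differential A1 \<mu>) p"

definition N :: "'m \<Rightarrow> real" where
  "N p = F1.G (F1.Jd f) (F1.Jd f) p"

lemma K_sum: "p \<in> U \<Longrightarrow> K p = (\<Sum>k<DIM('a). F1.eps k p * (m k p)\<^sup>2)"
  unfolding K_def by (subst F1.G_parseval) (simp_all add: m_def power2_eq_square)

lemma lam_sum: "p \<in> U \<Longrightarrow> (\<Sum>k<DIM('a). F1.eps k p * (lam k p)\<^sup>2) = N p / (4 * (f p)\<^sup>2)"
  unfolding N_def by (simp add: F1.Jd_norm[OF smooth_f_U] lam_def sum_divide_distrib power2_eq_square)

lemma \<phi>_power2: "(\<phi> p)\<^sup>2 = 1 / f p"
  using \<phi>_square(1)[of p] f_pos[of p] by (simp add: field_simps power2_eq_square)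

section \<open>The three curvature blocks and their sums\<close>

context
  fixes p q
  assumes p: "p \<in> U" and q: "q \<in> V"
begin

text \<open>Two horizontal forms have neither a vertical bracket nor a vertical covariant
  derivative, so the vertical summands of \<open>Sec\<close> vanish.\<close>

lemma Sec_hh:
  assumes "k < DIM('a)" "l < DIM('a)"
  shows "F.Sec k l (p, q) = F1.Sec k l p"
proof -
  have along: "F.along c (F.Gam a b c') (p, q) = F1.along c (F1.Gam a b c') p"
    if "a < DIM('a)" "b < DIM('a)" "c < DIM('a)" "c' < DIM('a)" for a b c c'
    using along_E(1)[OF p q F1.smooth_Gam[OF that(1,2,4)] F2.smooth_fun_const[OF F2.open_U, of 1], of "F.Gam a b c'" c]
      Gam_E(1)[OF _ _ that(1,2,4)] that(3) by simp
  have "(\<Sum>j<DIM('b). F.eps (DIM('a) + j) (p, q) * (F.Gam k l (DIM('a) + j) (p, q) * F.Gam l k (DIM('a) + j) (p, q)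
      - F.Gam l l (DIM('a) + j) (p, q) * F.Gam k k (DIM('a) + j) (p, q)
      - F.Br k l (DIM('a) + j) (p, q) * F.Gam (DIM('a) + j) l k (p, q))) = 0"
    using assms by (intro sum.neutral) (simp add: Gam_E(2) Br_hh p q)
  then show ?thesis
    unfolding F.Sec_def F1.Sec_def DIM_prod sum_lessThan_add
    using assms by (simp add: along eps_E Gam_E(1) Br_hh p q)
qed

lemma Sec_hv:
  assumes k: "k < DIM('a)" and i: "i < DIM('b)"
  shows "F.Sec k (DIM('a) + i) (p, q) = F2.eps i q *
      (F1.along k (lam k) p - (\<Sum>l<DIM('a). F1.eps l p * (lam l p * F1.Gam k k l p)) - (lam k p)\<^sup>2)
    + (m k p)\<^sup>2 / (4 * (f p)\<^sup>2) * (\<Sum>j<DIM('b). F2.eps j q * (F2.Bv i j q)\<^sup>2)"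
proof -
  have Bv0: "F2.Bv i i q' = 0" for q'
    using F2.Bv_skew[of i i q'] by simp
  have 1: "F.along k (F.Gam (DIM('a) + i) (DIM('a) + i) k) (p, q) = F1.along k (lam k) p * F2.eps i q"
    by (rule along_E(1)[OF p q smooth_lam[OF k] F2.smooth_eps[OF subset_refl F2.open_U i] _ k])
      (simp add: Gam_E(7)[OF _ _ k i i] Bv0)
  have 2: "F.along (DIM('a) + i) (F.Gam k (DIM('a) + i) k) (p, q) = 0"
    using along_E(2)[OF p q F1.smooth_fun_const[OF F1.open_U, of 0] F2.smooth_fun_const[OF F2.open_U, of 0],
        of "F.Gam k (DIM('a) + i) k" i] Gam_E(3)[OF _ _ k k i] i
    by (simp add: F2.along_def F2.derive_along_const)
  have 3: "(\<Sum>c<DIM('a). F.eps c (p, q) * (F.Gam k (DIM('a) + i) c (p, q) * F.Gam (DIM('a) + i) k c (p, q)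
      - F.Gam (DIM('a) + i) (DIM('a) + i) c (p, q) * F.Gam k k c (p, q) - F.Br k (DIM('a) + i) c (p, q) * F.Gam c (DIM('a) + i) k (p, q)))
      = - (F2.eps i q * (\<Sum>l<DIM('a). F1.eps l p * (lam l p * F1.Gam k k l p)))"
    unfolding sum_distrib_left sum_negf[symmetric]
    by (rule sum.cong) (simp_all add: eps_E Gam_E Br_hv p q k i Bv0)
  \<comment> \<open>Since \<open>Bv i i\<close> vanishes, the index \<open>j = i\<close> yields only
    the square of \<open>lam\<close>. Each other index yields a product of two equal skew parts,
    with \<open>\<phi>^4 = 1 / f^2\<close>.\<close>
  have 4: "(\<Sum>j<DIM('b). F.eps (DIM('a) + j) (p, q) * (F.Gam k (DIM('a) + i) (DIM('a) + j) (p, q) * F.Gam (DIM('a) + i) k (DIM('a) + j) (p, q)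
      - F.Gam (DIM('a) + i) (DIM('a) + i) (DIM('a) + j) (p, q) * F.Gam k k (DIM('a) + j) (p, q)
      - F.Br k (DIM('a) + i) (DIM('a) + j) (p, q) * F.Gam (DIM('a) + j) (DIM('a) + i) k (p, q)))
      = (\<Sum>j<DIM('b). (m k p)\<^sup>2 / (4 * (f p)\<^sup>2) * (F2.eps j q * (F2.Bv i j q)\<^sup>2)
          - (if j = i then F2.eps i q * (lam k p)\<^sup>2 else 0))"
  proof (rule sum.cong[OF refl])
    fix j assume "j \<in> {..<DIM('b)}"
    then have j: "j < DIM('b)"
      by simp
    show "F.eps (DIM('a) + j) (p, q) * (F.Gam k (DIM('a) + i) (DIM('a) + j) (p, q) * F.Gam (DIM('a) + i) k (DIM('a) + j) (p, q)
        - F.Gam (DIM('a) + i) (DIM('a) + i) (DIM('a) + j) (p, q) * F.Gam k k (DIM('a) + j) (p, q)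
        - F.Br k (DIM('a) + i) (DIM('a) + j) (p, q) * F.Gam (DIM('a) + j) (DIM('a) + i) k (p, q))
      = (m k p)\<^sup>2 / (4 * (f p)\<^sup>2) * (F2.eps j q * (F2.Bv i j q)\<^sup>2)
          - (if j = i then F2.eps i q * (lam k p)\<^sup>2 else 0)"
    proof (cases "j = i")
      case True
      show ?thesis
        using F2.eps_cases[OF q i]
        by (auto simp: True eps_E Gam_E Br_hv p q k i Bv0 power2_eq_square)
    next
      case False
      then show ?thesis
        by (simp add: eps_E Gam_E Br_hv p q k i j \<phi>_power2) (simp add: power2_eq_square)
    qed
  qed
  show ?thesis
    unfolding F.Sec_def DIM_prod sum_lessThan_add 1 2 3 4 sum_subtractf
    using i by (simp add: algebra_simps sum_distrib_left sum_divide_distrib)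
qed

lemma Sec_vv:
  assumes i: "i < DIM('b)" and j: "j < DIM('b)"
  shows "F.Sec (DIM('a) + i) (DIM('a) + j) (p, q) = (\<mu> p)\<^sup>2 / f p * F2.Sec i j q
    - N p / (4 * (f p)\<^sup>2) * (F2.eps i q * F2.eps j q - (if i = j then 1 else 0))
    - 3 * K p / (4 * (f p)\<^sup>2) * (F2.Bv i j q)\<^sup>2"
proof -
  have \<phi>\<mu>: "smooth_fun A1 U (\<lambda>p. \<phi> p * \<mu> p)"
    using smooth_fun_subset[OF smooth_\<mu>'] by (intro F1.smooth_fun_mult F1.open_U smooth_\<phi>) auto
  have along: "F.along (DIM('a) + a) (F.Gam (DIM('a) + b) (DIM('a) + c) (DIM('a) + d)) (p, q)
      = (\<mu> p)\<^sup>2 / f p * F2.along a (F2.Gam b c d) q"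
    if "a < DIM('b)" "b < DIM('b)" "c < DIM('b)" "d < DIM('b)" for a b c d
  proof -
    have "F.along (DIM('a) + a) (F.Gam (DIM('a) + b) (DIM('a) + c) (DIM('a) + d)) (p, q)
        = \<phi> p * \<mu> p * (\<phi> p * \<mu> p) * F2.along a (F2.Gam b c d) q"
      by (rule along_E(2)[OF p q \<phi>\<mu> F2.smooth_Gam[OF that(2-4)] _ that(1)])
        (simp add: Gam_E(8)[OF _ _ that(2-4)])
    also have "\<phi> p * \<mu> p * (\<phi> p * \<mu> p) = (\<mu> p)\<^sup>2 * (\<phi> p)\<^sup>2"
      by (simp add: power2_eq_square)
    finally show ?thesis
      by (simp add: \<phi>_power2)
  qed
  have Bv: "F2.Bv j i q = - F2.Bv i j q" "F2.Bv i i q = 0" "F2.Bv j j q = 0"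
    using F2.Bv_skew[of j i q] F2.Bv_skew[of i i q] F2.Bv_skew[of j j q] by simp_all
  \<comment> \<open>The coefficient \<open>3 / 4\<close> of the \<open>\<mu>\<close> part is
    \<open>1 / 4\<close> from the product of the two skew coefficients plus \<open>1 / 2\<close>
    from the bracket term. The \<open>lam\<close> part comes from the two diagonal coefficients and
    is cancelled when \<open>i = j\<close>.\<close>
  have h: "(\<Sum>c<DIM('a). F.eps c (p, q) * (F.Gam (DIM('a) + i) (DIM('a) + j) c (p, q) * F.Gam (DIM('a) + j) (DIM('a) + i) c (p, q)
      - F.Gam (DIM('a) + j) (DIM('a) + j) c (p, q) * F.Gam (DIM('a) + i) (DIM('a) + i) c (p, q)
      - F.Br (DIM('a) + i) (DIM('a) + j) c (p, q) * F.Gam c (DIM('a) + j) (DIM('a) + i) (p, q)))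
      = (\<Sum>c<DIM('a). - (F2.eps i q * F2.eps j q - (if i = j then 1 else 0)) * (F1.eps c p * (lam c p)\<^sup>2)
        - 3 / (4 * (f p)\<^sup>2) * (F2.Bv i j q)\<^sup>2 * (F1.eps c p * (m c p)\<^sup>2))"
  proof (rule sum.cong[OF refl])
    fix c assume "c \<in> {..<DIM('a)}"
    then have c: "c < DIM('a)"
      by simp
    show "F.eps c (p, q) * (F.Gam (DIM('a) + i) (DIM('a) + j) c (p, q) * F.Gam (DIM('a) + j) (DIM('a) + i) c (p, q)
        - F.Gam (DIM('a) + j) (DIM('a) + j) c (p, q) * F.Gam (DIM('a) + i) (DIM('a) + i) c (p, q)
        - F.Br (DIM('a) + i) (DIM('a) + j) c (p, q) * F.Gam c (DIM('a) + j) (DIM('a) + i) (p, q))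
      = - (F2.eps i q * F2.eps j q - (if i = j then 1 else 0)) * (F1.eps c p * (lam c p)\<^sup>2)
        - 3 / (4 * (f p)\<^sup>2) * (F2.Bv i j q)\<^sup>2 * (F1.eps c p * (m c p)\<^sup>2)"
    proof (cases "i = j")
      case True
      show ?thesis
        using F2.eps_square[OF q i] Bv(2)
        by (simp add: eps_E Gam_E Br_vv p q i c flip: True)
    next
      case False
      then show ?thesis
        using Bv by (simp add: eps_E Gam_E Br_vv p q i j c \<phi>_power2)
          (simp add: field_simps power2_eq_square)
    qed
  qed
  have v: "(\<Sum>l<DIM('b). F.eps (DIM('a) + l) (p, q) * (F.Gam (DIM('a) + i) (DIM('a) + j) (DIM('a) + l) (p, q) * F.Gam (DIM('a) + j) (DIM('a) + i) (DIM('a) + l) (p, q)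
      - F.Gam (DIM('a) + j) (DIM('a) + j) (DIM('a) + l) (p, q) * F.Gam (DIM('a) + i) (DIM('a) + i) (DIM('a) + l) (p, q)
      - F.Br (DIM('a) + i) (DIM('a) + j) (DIM('a) + l) (p, q) * F.Gam (DIM('a) + l) (DIM('a) + j) (DIM('a) + i) (p, q)))
      = (\<mu> p)\<^sup>2 / f p * (\<Sum>l<DIM('b). F2.eps l q * (F2.Gam i j l q * F2.Gam j i l q
         - F2.Gam j j l q * F2.Gam i i l q - F2.Br i j l q * F2.Gam l j i q))"
  proof -
    have "(\<mu> p)\<^sup>2 / f p = (\<phi> p * \<mu> p) * (\<phi> p * \<mu> p)"
      using \<phi>_power2[of p] by (simp add: power_mult_distrib flip: power2_eq_square)
    then show ?thesis
      unfolding sum_distrib_left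
      by (intro sum.cong) (simp_all add: eps_E Gam_E(8)[OF p q] Br_vv p q i j, simp add: algebra_simps)
  qed
  show ?thesis
    unfolding F.Sec_def F2.Sec_def DIM_prod sum_lessThan_add h v along[OF i j j i] along[OF j i j i]
      sum_subtractf sum_distrib_left[symmetric] lam_sum[OF p] K_sum[OF p, symmetric]
    by (simp add: algebra_simps)
qed

lemma Sec_hv_sum:
  "(\<Sum>k<DIM('a). \<Sum>i<DIM('b). F1.eps k p * F2.eps i q * F.Sec k (DIM('a) + i) (p, q))
    = real DIM('b) * (triangle_op A1 g1 P1 D1 f p / (2 * f p) + N p / (4 * (f p)\<^sup>2))
      + K p / (4 * (f p)\<^sup>2) * J_norm_sq A2 g2 P2 q"
proof -
  define X where "X k = F1.along k (lam k) p - (\<Sum>l<DIM('a). F1.eps l p * (lam l p * F1.Gam k k l p)) - (lam k p)\<^sup>2" for k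
  define B where "B i = (\<Sum>j<DIM('b). F2.eps j q * (F2.Bv i j q)\<^sup>2)" for i
  have "F1.eps k p * F2.eps i q * F.Sec k (DIM('a) + i) (p, q)
      = F1.eps k p * X k + (F1.eps k p * (m k p)\<^sup>2) / (4 * (f p)\<^sup>2) * (F2.eps i q * B i)"
    if "k < DIM('a)" "i < DIM('b)" for k i
    using F2.eps_square[OF q that(2)] unfolding Sec_hv[OF that] X_def[symmetric] B_def[symmetric]
    by (simp add: algebra_simps)
  then have "(\<Sum>k<DIM('a). \<Sum>i<DIM('b). F1.eps k p * F2.eps i q * F.Sec k (DIM('a) + i) (p, q))
      = (\<Sum>k<DIM('a). \<Sum>i<DIM('b). F1.eps k p * X k + (F1.eps k p * (m k p)\<^sup>2) / (4 * (f p)\<^sup>2) * (F2.eps i q * B i))"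
    by simp
  also have "\<dots> = real DIM('b) * (\<Sum>k<DIM('a). F1.eps k p * X k)
      + K p / (4 * (f p)\<^sup>2) * (\<Sum>i<DIM('b). F2.eps i q * B i)"
    unfolding K_sum[OF p] sum_divide_distrib sum_product by (simp add: sum.distrib sum_distrib_left)
  also have "(\<Sum>i<DIM('b). F2.eps i q * B i) = J_norm_sq A2 g2 P2 q"
    unfolding F2.J_norm_sq_frame[OF q] B_def by (simp add: sum_distrib_left mult.assoc)
  also have "(\<Sum>k<DIM('a). F1.eps k p * X k) = triangle_op A1 g1 P1 D1 f p / (2 * f p) + N p / (4 * (f p)\<^sup>2)"
  proof -
    define T where "T k = F1.along k (F1.along k f) p
        - (\<Sum>c<DIM('a). F1.eps c p * (F1.along c f p * F1.Gam k k c p))" for k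
    have "X k = - T k / (2 * f p) + (F1.along k f p)\<^sup>2 / (4 * (f p)\<^sup>2)" if "k < DIM('a)" for k
    proof -
      have "(\<Sum>l<DIM('a). F1.eps l p * (lam l p * F1.Gam k k l p))
          = - (\<Sum>c<DIM('a). F1.eps c p * (F1.along c f p * F1.Gam k k c p)) / (2 * f p)"
        unfolding sum_negf[symmetric] sum_divide_distrib by (simp add: lam_def)
      \<comment> \<open>The factor \<open>1 / 2\<close> from \<open>along_lam\<close> minus the
        \<open>1 / 4\<close> in the square of \<open>lam\<close> leaves
        \<open>1 / 4\<close>.\<close>
      moreover have "(F1.along k f p)\<^sup>2 / (2 * (f p)\<^sup>2) - (lam k p)\<^sup>2 = (F1.along k f p)\<^sup>2 / (4 * (f p)\<^sup>2)"
        by (simp add: lam_def power_divide power_mult_distrib)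
      ultimately show ?thesis
        unfolding X_def T_def along_lam[OF p that] by (simp add: diff_divide_distrib)
    qed
    then have "(\<Sum>k<DIM('a). F1.eps k p * X k) = (\<Sum>k<DIM('a). F1.eps k p * (- T k / (2 * f p))
        + F1.eps k p * ((F1.along k f p)\<^sup>2 / (4 * (f p)\<^sup>2)))"
      by (simp add: right_diff_distrib)
    also have "\<dots> = - (\<Sum>k<DIM('a). F1.eps k p * T k) / (2 * f p) + N p / (4 * (f p)\<^sup>2)"
      unfolding N_def F1.Jd_norm[OF smooth_f_U p]
      by (simp add: sum.distrib sum_divide_distrib sum_subtractf)
    finally show ?thesis
      unfolding F1.triangle_op_frame[OF smooth_f_U p] T_def by simp
  qed
  finally show ?thesis .
qed

lemma Sec_vv_sum:
  "(\<Sum>i<DIM('b). \<Sum>j<DIM('b). F2.eps i q * F2.eps j q * F.Sec (DIM('a) + i) (DIM('a) + j) (p, q))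
    = (\<mu> p)\<^sup>2 / f p * scalar_curvature A2 g2 P2 D2 \<eta> q
      - N p / (4 * (f p)\<^sup>2) * (real DIM('b) * (real DIM('b) - 1))
      - 3 * K p / (4 * (f p)\<^sup>2) * J_norm_sq A2 g2 P2 q"
proof -
  let ?N = "N p / (4 * (f p)\<^sup>2)" and ?K = "3 * K p / (4 * (f p)\<^sup>2)" and ?M = "(\<mu> p)\<^sup>2 / f p"
  \<comment> \<open>The two outer signs turn the coefficient of \<open>N\<close> into 1 for
    \<open>i \<noteq> j\<close> and 0 otherwise, so the sum counts the ordered pairs of distinct
    indices.\<close>
  have "F2.eps i q * F2.eps j q * F.Sec (DIM('a) + i) (DIM('a) + j) (p, q)
      = ?M * (F2.eps i q * F2.eps j q * F2.Sec i j q) - ?N * (1 - (if i = j then 1 else 0))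
        - ?K * (F2.eps i q * F2.eps j q * (F2.Bv i j q)\<^sup>2)"
    if "i < DIM('b)" "j < DIM('b)" for i j
    unfolding Sec_vv[OF that] using F2.eps_cases[OF q that(1)] F2.eps_cases[OF q that(2)]
    by (auto simp: algebra_simps)
  then have "(\<Sum>i<DIM('b). \<Sum>j<DIM('b). F2.eps i q * F2.eps j q * F.Sec (DIM('a) + i) (DIM('a) + j) (p, q))
      = (\<Sum>i<DIM('b). \<Sum>j<DIM('b). ?M * (F2.eps i q * F2.eps j q * F2.Sec i j q)
        - ?N * (1 - (if i = j then 1 else 0)) - ?K * (F2.eps i q * F2.eps j q * (F2.Bv i j q)\<^sup>2))"
    by simp
  also have "\<dots> = ?M * (\<Sum>i<DIM('b). \<Sum>j<DIM('b). F2.eps i q * F2.eps j q * F2.Sec i j q)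
      - ?N * (\<Sum>i<DIM('b). \<Sum>j<DIM('b). 1 - (if i = j then 1 else 0))
      - ?K * (\<Sum>i<DIM('b). \<Sum>j<DIM('b). F2.eps i q * F2.eps j q * (F2.Bv i j q)\<^sup>2)"
    unfolding sum_subtractf sum_distrib_left[symmetric] ..
  also have "(\<Sum>i<DIM('b). \<Sum>j<DIM('b). 1 - (if i = j then 1 else 0)) = real DIM('b) * (real DIM('b) - 1)"
    by (simp add: sum_subtractf)
  finally show ?thesis
    unfolding F2.scalar_curvature_Sec[OF q] F2.J_norm_sq_frame[OF q] .
qed

lemma scalar_curvature_warped:
  "scalar_curvature PA GG (warped \<mu> P1 P2) D E (p, q) =
    scalar_curvature A1 g1 P1 D1 \<theta> p + (\<mu> p)\<^sup>2 / f p * scalar_curvature A2 g2 P2 D2 \<eta> q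
    - K p / (4 * (f p)\<^sup>2) * J_norm_sq A2 g2 P2 q
    - (real DIM('b) * (real DIM('b) - 3) * N p / (4 * (f p)\<^sup>2)
       - real DIM('b) / f p * triangle_op A1 g1 P1 D1 f p)"
proof -
  have z: "(p, q) \<in> U \<times> V"
    using p q by simp
  let ?hv = "\<Sum>k<DIM('a). \<Sum>i<DIM('b). F1.eps k p * F2.eps i q * F.Sec k (DIM('a) + i) (p, q)"
  \<comment> \<open>The vertical-horizontal block equals the horizontal-vertical one by
    \<open>Sec_sym\<close>; hence the factor 2 in the next step.\<close>
  have "(\<Sum>i<DIM('b). \<Sum>k<DIM('a). F2.eps i q * F1.eps k p * F.Sec (DIM('a) + i) k (p, q)) = ?hv"
    by (subst sum.swap) (simp add: F.Sec_sym[OF z] mult.commute)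
  then have "scalar_curvature PA GG (warped \<mu> P1 P2) D E (p, q)
      = (\<Sum>k<DIM('a). \<Sum>l<DIM('a). F1.eps k p * F1.eps l p * F1.Sec k l p) + 2 * ?hv
        + (\<Sum>i<DIM('b). \<Sum>j<DIM('b). F2.eps i q * F2.eps j q * F.Sec (DIM('a) + i) (DIM('a) + j) (p, q))"
    unfolding F.scalar_curvature_Sec[OF z] DIM_prod sum_lessThan_add sum.distrib
    by (simp add: eps_E p q Sec_hh)
  then show ?thesis
    unfolding Sec_hv_sum Sec_vv_sum F1.scalar_curvature_Sec[OF p, symmetric]
    using f_pos[of p] by (simp add: field_simps power2_eq_square)
qed

end

end

section \<open>The formula under the stated hypotheses\<close>

theorem corollary4:
  fixes A1 :: "('i, 'm::{t2_space, second_countable_topology}, 'a::euclidean_space) atlas"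
    and A2 :: "('j, 'n::{t2_space, second_countable_topology}, 'b::euclidean_space) atlas"
    and gt1 g1 P1 :: "('i, 'm, 'a) field2"
    and gt2 g2 P2 :: "('j, 'n, 'b) field2"
    and f \<mu> :: "'m \<Rightarrow> real"
    and D1 :: "('i, 'm, 'a) field \<Rightarrow> ('i, 'm, 'a) field \<Rightarrow> ('i, 'm, 'a) field"
    and D2 :: "('j, 'n, 'b) field \<Rightarrow> ('j, 'n, 'b) field \<Rightarrow> ('j, 'n, 'b) field"
    and D :: "('i \<times> 'j, 'm \<times> 'n, 'a \<times> 'b) field \<Rightarrow> ('i \<times> 'j, 'm \<times> 'n, 'a \<times> 'b) field
                \<Rightarrow> ('i \<times> 'j, 'm \<times> 'n, 'a \<times> 'b) field"
    and U1 :: "'m set" and U2 :: "'n set"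
    and \<theta> :: "nat \<Rightarrow> ('i, 'm, 'a) field"
    and \<eta> :: "nat \<Rightarrow> ('j, 'n, 'b) field"
    and n2 :: nat
  assumes "smooth_manifold A1" and "smooth_manifold A2"
    and "pseudo_riemannian_metric A1 gt1" and "pseudo_riemannian_metric A2 gt2"
    and "g1 = cometric gt1" and "g2 = cometric gt2"
    and "n2 = DIM('b)"
    and "bivector_field A1 P1" and "bivector_field A2 P2"
    and "smooth_fun A1 UNIV f" and "\<And>p. f p > 0"
    and "smooth_fun A1 UNIV \<mu>"
    and "levi_civita_connection A1 g1 P1 D1"
    and "levi_civita_connection A2 g2 P2 D2"
    and "levi_civita_connection (prod_atlas A1 A2) (warped f g1 g2) (warped \<mu> P1 P2) D"
    and "open U1" and "orthonormal_frame A1 g1 U1 \<theta>"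
    and "open U2" and "orthonormal_frame A2 g2 U2 \<eta>"
    and "p \<in> U1" and "q \<in> U2"
  shows "scalar_curvature (prod_atlas A1 A2) (warped f g1 g2) (warped \<mu> P1 P2) D
           (warped_frame A1 A2 f \<theta> \<eta>) (p, q) =
         scalar_curvature A1 g1 P1 D1 \<theta> p
         + (\<mu> p)\<^sup>2 / f p * scalar_curvature A2 g2 P2 D2 \<eta> q
         - field2_eval A1 g1 (differential A1 \<mu>) (differential A1 \<mu>) p / (4 * (f p)\<^sup>2)
             * J_norm_sq A2 g2 P2 q
         - (real n2 * (real n2 - 3)
              * field2_eval A1 g1 (J_form g1 P1 (differential A1 f))
                  (J_form g1 P1 (differential A1 f)) p / (4 * (f p)\<^sup>2)
            - real n2 / f p * triangle_op A1 g1 P1 D1 f p)"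
proof -
  interpret M1: smooth_atlas A1
    by unfold_locales (rule assms)
  interpret M2: smooth_atlas A2
    by unfold_locales (rule assms)
  have skew1: "P1 i p a b = - P1 i p b a" if "p \<in> chart_dom A1 i" for i p a b
    using assms(8) that unfolding bivector_field_def by blast
  have skew2: "P2 j q a b = - P2 j q b a" if "q \<in> chart_dom A2 j" for j q a b
    using assms(9) that unfolding bivector_field_def by blast
  interpret F1: contravariant_frame A1 g1 P1 D1 U1 \<theta>
    by unfold_locales
      (simp_all add: assms(5) M1.cotensor2_cometric[OF assms(3)] bivector_field_cotensor2[OF assms(8)]
        cometric_sym[OF assms(3)] assms(13,16,17)[unfolded assms(5)], rule skew1)
  interpret F2: contravariant_frame A2 g2 P2 D2 U2 \<eta>
    by unfold_locales
      (simp_all add: assms(6) M2.cotensor2_cometric[OF assms(4)] bivector_field_cotensor2[OF assms(9)]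
        cometric_sym[OF assms(4)] assms(14,18,19)[unfolded assms(6)], rule skew2)
  interpret warped_connection A1 A2 g1 P1 D1 U1 \<theta> g2 P2 D2 U2 \<eta> f \<mu> D
    by unfold_locales (rule assms)+
  show ?thesis
    using scalar_curvature_warped[OF assms(20,21)]
    unfolding K_def N_def F1.G_def F1.Jd_def assms(7) .
qed

end
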